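(* Let $\boldsymbol{a}=(a_1,\ldots,a_n)\in\mathbb{Z}^n$ be the weight vector of an effective linear action of $\mathbb{C}^\times$ on $\mathbb{C}^n$, i.e. $\gcd(a_1,\ldots,a_n)=1$. Assume that there is an integer $k$ with $0<k<n$ such that $a_i<0$ for $i\leq k$ and $a_i>0$ for $i>k$. Then $\dim\big(\mathbb{C}[\mathbb{C}^n]^{\mathbb{C}^\times_{\boldsymbol{a}}}\big)=n-1$, and $$ \gamma_0(\boldsymbol{a})=\frac{-S_{n-2}(\boldsymbol{a})}{\prod\limits_{p=1}^k\prod\limits_{q=k+1}^n(a_p-a_q)}. $$ In particular, $\gamma_0(\boldsymbol{a})\neq 0$. When moreover $a_i\neq a_j$ for all $i\neq j$ with $i,j\leq k$, this can be expressed as $$ \gamma_0(\boldsymbol{a})=\sum_{i=1}^k\frac{-a_i^{n-2}}{\prod\limits_{\substack{j=1\\ j\neq i}}^n(a_i-a_j)}. $$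
   Context: The action with weight vector $\boldsymbol{a}$ is $w\cdot(z_1,\ldots,z_n)=(w^{a_1}z_1,\ldots,w^{a_n}z_n)$. $R=\mathbb{C}[\mathbb{C}^n]^{\mathbb{C}^\times_{\boldsymbol{a}}}$ is the algebra of invariant polynomials graded by polynomial degree, $\dim$ is Krull dimension, $\operatorname{Hilb}_{\boldsymbol{a}}(t)=\sum_{d\geq0}\dim_{\mathbb{C}}(R_d)t^d$ is its Hilbert series (a rational function), and $\gamma_m(\boldsymbol{a})$ are the coefficients of its Laurent expansion at $t=1$: $\operatorname{Hilb}_{\boldsymbol{a}}(t)=\sum_{m\geq 0}\gamma_m(\boldsymbol{a})(1-t)^{m-\dim R}$. For two sets of indeterminates $\boldsymbol{x}=(x_1,\ldots,x_k)$, $\boldsymbol{y}=(y_1,\ldots,y_m)$ with $N=k+m$ and an integer $u\leq N-2$, $S_u(\boldsymbol{x},\boldsymbol{y})=\det M/(\operatorname{V}(\boldsymbol{x})\operatorname{V}(\boldsymbol{y}))$, where $\operatorname{V}(x_1,\ldots,x_k)=\prod_{1\leq i<j\leq k}(x_i-x_j)$ and $M$ is the $N\times N$ matrix with first row $(x_1^u,\ldots,x_k^u,0,\ldots,0)$ and $r$-th row $(x_1^{N-r},\ldots,x_k^{N-r},y_1^{N-r},\ldots,y_m^{N-r})$ for $r=2,\ldots,N$. This is a polynomial in $\boldsymbol{y}$ and the $x_i^{\pm1}$, so it may be evaluated also when some variables coincide. $S_u(\boldsymbol{a})$ means $S_u$ evaluated with $\boldsymbol{x}=$ the negative entries and $\boldsymbol{y}=$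 the positive entries of $\boldsymbol{a}$. *)

theory Defs
  imports
    "HOL-Library.Poly_Mapping"
    "HOL-Library.Extended_Nat"
    "HOL-Algebra.Ideal"
    "HOL-Complex_Analysis.Laurent_Convergence"
    "Jordan_Normal_Form.Determinant"
begin

text \<open>Coordinates on \<open>\<complex>\<^sup>n\<close>, weights and variables are indexed by \<open>{1..n}\<close>. A point or a weight vector
  is a function on \<open>nat\<close> of which only the values on \<open>{1..n}\<close> matter. A polynomial is a finitely
  supported map from exponent vectors to coefficients.\<close>

type_synonym cpoly = "(nat \<Rightarrow>\<^sub>0 nat) \<Rightarrow>\<^sub>0 complex"

definition poly_carrier :: "nat \<Rightarrow> cpoly set" where
  "poly_carrier n = {p. \<forall>m \<in> Poly_Mapping.keys p. Poly_Mapping.keys m \<subseteq> {1..n}}"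

definition cpoly_eval :: "cpoly \<Rightarrow> (nat \<Rightarrow> complex) \<Rightarrow> complex" where
  "cpoly_eval p z = (\<Sum>m\<in>Poly_Mapping.keys p. Poly_Mapping.lookup p m *
      (\<Prod>i\<in>Poly_Mapping.keys m. z i ^ Poly_Mapping.lookup m i))"

definition cpoly_scale :: "complex \<Rightarrow> cpoly \<Rightarrow> cpoly" where
  "cpoly_scale c p = Poly_Mapping.single 0 c * p"

definition homogeneous :: "nat \<Rightarrow> cpoly \<Rightarrow> bool" where
  "homogeneous d p \<longleftrightarrow>
     (\<forall>m \<in> Poly_Mapping.keys p. (\<Sum>i\<in>Poly_Mapping.keys m. Poly_Mapping.lookup m i) = d)"

definition torus_act :: "(nat \<Rightarrow> int) \<Rightarrow> complex \<Rightarrow> (nat \<Rightarrow> complex) \<Rightarrow> nat \<Rightarrow> complex" where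
  "torus_act a w z = (\<lambda>i. w powi a i * z i)"

definition invariants :: "nat \<Rightarrow> (nat \<Rightarrow> int) \<Rightarrow> cpoly set" where
  "invariants n a = {p \<in> poly_carrier n.
     \<forall>w z. w \<noteq> 0 \<longrightarrow> cpoly_eval p (torus_act a w z) = cpoly_eval p z}"

definition invariant_ring :: "nat \<Rightarrow> (nat \<Rightarrow> int) \<Rightarrow> cpoly ring" where
  "invariant_ring n a =
     \<lparr>carrier = invariants n a, monoid.mult = (*), one = 1, zero = 0, add = (+)\<rparr>"

definition krull_dim :: "('a, 'b) ring_scheme \<Rightarrow> enat" where
  "krull_dim R = Sup {enat l | l P.
     (\<forall>i\<le>l. primeideal (P i) R) \<and> (\<forall>i<l. P i \<subset> P (Suc i))}"

definition hilbert_series :: "nat \<Rightarrow> (nat \<Rightarrow> int) \<Rightarrow> complex fps" where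
  "hilbert_series n a = Abs_fps (\<lambda>d. of_nat
     (vector_space.dim cpoly_scale {p \<in> invariants n a. homogeneous d p}))"

text \<open>\<open>g\<close> is the coefficient sequence in \<open>Hilb(t) = (\<Sum>m\<ge>0. g m * (1 - t)^(m - dim R))\<close>: the Hilbert
  series is a rational function \<open>P / Q\<close>, and this is expanded at \<open>t = 1\<close> in the local parameter
  \<open>s = 1 - t\<close>. The shift makes \<open>g m\<close> the coefficient of \<open>s^(m - dim R)\<close> and also requires that
  the pole order is at most \<open>dim R\<close>.\<close>

definition hilbert_laurent_coeffs :: "nat \<Rightarrow> (nat \<Rightarrow> int) \<Rightarrow> (nat \<Rightarrow> complex) \<Rightarrow> bool" where
  "hilbert_laurent_coeffs n a g \<longleftrightarrow>
     (\<exists>P Q :: complex poly. Q \<noteq> 0 \<and>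
        fps_of_poly P = hilbert_series n a * fps_of_poly Q \<and>
        (\<lambda>s. poly P (1 - s) / poly Q (1 - s)) has_laurent_expansion
          fls_shift (int (the_enat (krull_dim (invariant_ring n a)))) (fps_to_fls (Abs_fps g)))"

definition hilbert_gamma :: "nat \<Rightarrow> (nat \<Rightarrow> int) \<Rightarrow> nat \<Rightarrow> complex" where
  "hilbert_gamma n a = (THE g. hilbert_laurent_coeffs n a g)"

text \<open>Laurent polynomials, with exponents in \<open>int\<close>. In \<open>S_laurent k m u\<close> the variables with index
  \<open>1..k\<close> are \<open>x\<^sub>1, \<dots>, x\<^sub>k\<close> and those with index \<open>k+1..k+m\<close> are \<open>y\<^sub>1, \<dots>, y\<^sub>m\<close>.\<close>

type_synonym claurent = "(nat \<Rightarrow>\<^sub>0 int) \<Rightarrow>\<^sub>0 complex"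

definition var_pow :: "nat \<Rightarrow> int \<Rightarrow> claurent" where
  "var_pow i e = Poly_Mapping.single (Poly_Mapping.single i e) 1"

definition claurent_eval :: "claurent \<Rightarrow> (nat \<Rightarrow> complex) \<Rightarrow> complex" where
  "claurent_eval f v = (\<Sum>m\<in>Poly_Mapping.keys f. Poly_Mapping.lookup f m *
      (\<Prod>i\<in>Poly_Mapping.keys m. v i powi Poly_Mapping.lookup m i))"

definition vandermonde :: "nat set \<Rightarrow> claurent" where
  "vandermonde I = (\<Prod>(i, j)\<in>{(i, j). i \<in> I \<and> j \<in> I \<and> i < j}. var_pow i 1 - var_pow j 1)"

text \<open>Matrix indices start at \<open>0\<close>: row \<open>r\<close> of the mathematical matrix is row \<open>r - 1\<close> here.\<close>

definition S_matrix :: "nat \<Rightarrow> nat \<Rightarrow> int \<Rightarrow> claurent mat" where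
  "S_matrix k m u = mat (k + m) (k + m) (\<lambda>(i, j).
     if i = 0 then (if j < k then var_pow (j + 1) u else 0)
     else var_pow (j + 1) (int (k + m) - int (i + 1)))"

definition S_laurent :: "nat \<Rightarrow> nat \<Rightarrow> int \<Rightarrow> claurent" where
  "S_laurent k m u = (THE f.
     f * (vandermonde {1..k} * vandermonde {k+1..k+m}) = det (S_matrix k m u))"

definition S_weights :: "int \<Rightarrow> nat \<Rightarrow> (nat \<Rightarrow> int) \<Rightarrow> complex" where
  "S_weights u n a =
     (let xs = filter (\<lambda>c. c < 0) (map a [1..<n+1]);
          ys = filter (\<lambda>c. c > 0) (map a [1..<n+1])
      in claurent_eval (S_laurent (length xs) (length ys) u)
           (\<lambda>i. of_int ((xs @ ys) ! (i - 1))))"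

text \<open>The scalar action is a vector space, and the conditions in both definite descriptions are
  satisfied by at most one object.\<close>

lemma vector_space_cpoly_scale: "vector_space cpoly_scale"
  by unfold_locales
    (simp_all add: cpoly_scale_def algebra_simps single_add mult_single flip: mult.assoc)

lemma hilbert_laurent_coeffs_unique:
  assumes "hilbert_laurent_coeffs n a g" "hilbert_laurent_coeffs n a h"
  shows "g = h"
proof -
  let ?D = "int (the_enat (krull_dim (invariant_ring n a)))"
  obtain P Q where 1: "Q \<noteq> 0" "fps_of_poly P = hilbert_series n a * fps_of_poly Q"
    "(\<lambda>s. poly P (1 - s) / poly Q (1 - s)) has_laurent_expansion
       fls_shift ?D (fps_to_fls (Abs_fps g))"
    using assms(1) unfolding hilbert_laurent_coeffs_def by blast
  obtain P' Q' where 2: "Q' \<noteq> 0" "fps_of_poly P' = hilbert_series n a * fps_of_poly Q'"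
    "(\<lambda>s. poly P' (1 - s) / poly Q' (1 - s)) has_laurent_expansion
       fls_shift ?D (fps_to_fls (Abs_fps h))"
    using assms(2) unfolding hilbert_laurent_coeffs_def by blast
  have "fps_of_poly (P * Q') = fps_of_poly (P' * Q)"
    using 1(2) 2(2) by (simp add: fps_of_poly_mult mult_ac)
  hence PQ: "P * Q' = P' * Q" by (simp only: fps_of_poly_eq_iff)
  have fin: "finite ({s. poly Q (1 - s) = 0} \<union> {s. poly Q' (1 - s) = 0})"
  proof -
    have "finite ((\<lambda>x. 1 - x) ` {s. poly (Q * Q') s = 0})"
      using 1(1) 2(1) by (intro finite_imageI poly_roots_finite) simp
    moreover have "{s. poly Q (1 - s) = 0} \<union> {s. poly Q' (1 - s) = 0} \<subseteq>
        (\<lambda>x. 1 - x) ` {s. poly (Q * Q') s = 0}"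
      by (auto simp: image_iff intro!: exI[of _ "1 - _"])
    ultimately show ?thesis by (rule finite_subset[rotated])
  qed
  have "eventually (\<lambda>s. s \<notin> {s. poly Q (1 - s) = 0} \<union> {s. poly Q' (1 - s) = 0}) (at 0)"
    using islimpt_finite[OF fin] by (simp add: islimpt_iff_eventually)
  hence "eventually (\<lambda>s. poly P (1 - s) / poly Q (1 - s) = poly P' (1 - s) / poly Q' (1 - s)) (at 0)"
  proof eventually_elim
    case (elim s)
    have "poly (P * Q') (1 - s) = poly (P' * Q) (1 - s)" using PQ by simp
    thus ?case using elim by (simp add: field_simps)
  qed
  note cong = has_laurent_expansion_cong[OF this refl]
  have "(\<lambda>s. poly P' (1 - s) / poly Q' (1 - s)) has_laurent_expansion
       fls_shift ?D (fps_to_fls (Abs_fps g))"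
    using 1(3) by (rule cong[THEN iffD1])
  with 2(3) have eq: "fls_shift ?D (fps_to_fls (Abs_fps g)) = fls_shift ?D (fps_to_fls (Abs_fps h))"
    using has_laurent_expansion_unique by blast
  have "g m = h m" for m
    using arg_cong[OF eq, of "\<lambda>F. fls_nth F (int m - ?D)"] by simp
  thus ?thesis by blast
qed

lemma vandermonde_nonzero:
  assumes "finite I"
  shows "vandermonde I \<noteq> 0"
proof -
  have "finite {(i, j). i \<in> I \<and> j \<in> I \<and> i < j}"
    by (rule finite_subset[of _ "I \<times> I"]) (use assms in auto)
  moreover have "var_pow i 1 - var_pow j 1 \<noteq> 0" if "i < j" for i j
  proof
    assume "var_pow i 1 - var_pow j 1 = 0"
    hence "Poly_Mapping.keys (var_pow i 1) = Poly_Mapping.keys (var_pow j 1)" by simp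
    hence "Poly_Mapping.single i (1::int) = Poly_Mapping.single j 1" by (simp add: var_pow_def)
    hence "Poly_Mapping.keys (Poly_Mapping.single i (1::int)) =
        Poly_Mapping.keys (Poly_Mapping.single j (1::int))" by (rule arg_cong)
    thus False using that by simp
  qed
  ultimately show ?thesis unfolding vandermonde_def by (auto simp: prod_zero_iff)
qed

lemma S_laurent_unique:
  assumes "f * (vandermonde {1..k} * vandermonde {k+1..k+m}) = det (S_matrix k m u)"
    and "g * (vandermonde {1..k} * vandermonde {k+1..k+m}) = det (S_matrix k m u)"
  shows "f = g"
  using assms vandermonde_nonzero[of "{1..k}"] vandermonde_nonzero[of "{k+1..k+m}"]
  by (metis finite_atLeastAtMost mult_cancel_right no_zero_divisors)

end

theory Submission
  imports Defs
begin

text \<open>The invariant ring is spanned by the monomials \<open>z^m\<close> with \<open>a \<cdot> m = 0\<close>, so the Hilbert series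
  counts solutions of a linear Diophantine equation. The elimination step of Elliott and MacMahon
  replaces two variables of weights \<open>b\<^sub>p < 0 < b\<^sub>q\<close> by pairs in which one of them is merged with the
  other; iterating it leads to systems all of whose nonzero weights have the same sign. There the
  series is a product of geometric series. This proves rationality, bounds the pole order at
  \<open>t = 1\<close> and computes the leading coefficient recursively. The sum
  \<open>\<Sum> - b\<^sub>i^(n-2) / \<Prod>(b\<^sub>i e\<^sub>j - b\<^sub>j e\<^sub>i)\<close> over the negative \<open>b\<^sub>i\<close>, where the \<open>i\<close>-th variable has degree \<open>e\<^sub>i\<close>,
  obeys the same recursion. Its denominators may vanish along the way; so the degrees are perturbed to polynomials
  \<open>E\<^sub>i(\<epsilon>)\<close> that are linearly independent over the integers, a property that every merging step
  preserves, and \<open>\<epsilon> \<rightarrow> 0\<close> at the end. For \<open>\<epsilon> \<noteq> 0\<close> the ratios \<open>a\<^sub>i / E\<^sub>i(\<epsilon>)\<close> are distinct, and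
  Lagrange interpolation identifies the sum with \<open>S\<^sub>n\<^sub>-\<^sub>2\<close> of these ratios. The Krull dimension is at least
  \<open>n - 1\<close> by a chain of faces of the cone of exponents, and at most \<open>n - 1\<close> since \<open>n\<close> invariants
  are algebraically dependent.\<close>

section \<open>Merging two variables\<close>

text \<open>Merging adds degrees as well as weights, so the recursion leaves the standard grading at
  once and has to allow arbitrary positive degrees. The sum over the negative weights comes from the
  Molien-Weyl integral: to leading order its integrand is \<open>1 / \<Prod>(E_j + b_j x)\<close>,
  and the sum is minus the sum of the residues at the poles with \<open>b_j < 0\<close>. The
  elimination step becomes \<open>1/(u v) = 1/(u (u + v)) + 1/(v (u + v))\<close> for two such
  linear factors. The third, diagonal term of the elimination has one variable fewer and as a rule a
  smaller pole. It counts only when the two weights cancel and all others are 0; there gcd 1 forces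
  the weights -1 and 1, and this is how effectiveness fixes the constant. The closed formulas do not
  show that the coefficient is nonzero, since the summands may have both signs. So positivity is
  carried through the recursion, where all contributions are nonnegative. \<open>S\<close> is a
  Laurent polynomial, so the formula in terms of \<open>S\<close> survives the limit also when
  negative weights coincide.\<close>

definition solutions :: "nat set \<Rightarrow> (nat \<Rightarrow> int) \<Rightarrow> (nat \<Rightarrow> nat) \<Rightarrow> nat \<Rightarrow> (nat \<Rightarrow> nat) set" where
  "solutions I b e d = {m. (\<forall>i. i \<notin> I \<longrightarrow> m i = 0) \<and> (\<Sum>i\<in>I. b i * int (m i)) = 0 \<and>
     (\<Sum>i\<in>I. e i * m i) = d}"

definition solution_series :: "nat set \<Rightarrow> (nat \<Rightarrow> int) \<Rightarrow> (nat \<Rightarrow> nat) \<Rightarrow> complex fps" where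
  "solution_series I b e = Abs_fps (\<lambda>d. of_nat (card (solutions I b e d)))"

lemma finite_solutions:
  assumes "finite I" "\<And>i. i \<in> I \<Longrightarrow> e i > 0"
  shows "finite (solutions I b e d)"
proof (rule finite_subset)
  show "solutions I b e d \<subseteq> {m. \<forall>i. (i \<in> I \<longrightarrow> m i \<in> {..d}) \<and> (i \<notin> I \<longrightarrow> m i = 0)}"
  proof clarsimp
    fix m i assume m: "m \<in> solutions I b e d"
    have "m i \<le> d" if "i \<in> I"
    proof -
      have "m i \<le> e i * m i" using assms(2)[OF that] by simp
      also have "\<dots> \<le> (\<Sum>i\<in>I. e i * m i)"
        by (rule member_le_sum) (use that assms in auto)
      finally show ?thesis using m by (simp add: solutions_def)
    qed
    then show "(i \<in> I \<longrightarrow> m i \<le> d) \<and> (i \<notin> I \<longrightarrow> m i = 0)"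
      using m by (auto simp: solutions_def)
  qed
  show "finite {m. \<forall>i. (i \<in> I \<longrightarrow> m i \<in> {..d}) \<and> (i \<notin> I \<longrightarrow> m i = 0)}"
    using assms(1) by (intro finite_set_of_finite_funs) auto
qed

text \<open>Replacing the coefficient of q by a sum is the transpose of the shear that adds
  \<open>m q\<close> to \<open>m p\<close>. The semiring is general because the identity serves for
  integer weights and natural degrees alike.\<close>

lemma sum_merge:
  fixes c :: "nat \<Rightarrow> 'a :: comm_semiring_1"
  assumes "finite I" "p \<in> I" "q \<in> I" "p \<noteq> q"
  shows "(\<Sum>i\<in>I. (c(q := c p + c q)) i * of_nat (m i)) =
    (\<Sum>i\<in>I. c i * of_nat ((m(p := m p + m q)) i))"
proof -
  have I: "I = insert p (insert q (I - {p, q}))" using assms by auto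
  have eq: "(\<Sum>i\<in>I - {p,q}. (c(q := c p + c q)) i * of_nat (m i)) =
    (\<Sum>i\<in>I - {p,q}. c i * of_nat ((m(p := m p + m q)) i))"
    by (rule sum.cong) auto
  show ?thesis
    by (subst (1 2) I, subst (1 2) sum.insert_remove)
      (use assms eq in \<open>auto simp: algebra_simps Diff_insert2[symmetric] insert_commute\<close>)
qed

lemma sum_merge_drop:
  fixes c :: "nat \<Rightarrow> 'a :: comm_semiring_1"
  assumes "finite I" "p \<in> I" "q \<in> I" "p \<noteq> q"
  shows "(\<Sum>i\<in>I - {q}. (c(p := c p + c q)) i * of_nat (m i)) =
    (\<Sum>i\<in>I. c i * of_nat ((m(q := m p)) i))"
proof -
  have I: "I = insert q (insert p (I - {p, q}))" using assms by auto
  have J: "I - {q} = insert p (I - {p, q})" using assms by auto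
  have eq: "(\<Sum>i\<in>I - {p,q}. (c(p := c p + c q)) i * of_nat (m i)) =
    (\<Sum>i\<in>I - {p,q}. c i * of_nat ((m(q := m p)) i))"
    by (rule sum.cong) auto
  have "(\<Sum>i\<in>I. c i * of_nat ((m(q := m p)) i)) =
    c q * of_nat (m p) + (c p * of_nat (m p) +
      (\<Sum>i\<in>I - {p,q}. c i * of_nat ((m(q := m p)) i)))"
    by (subst I, subst sum.insert) (use assms in auto)
  moreover have "(\<Sum>i\<in>I - {q}. (c(p := c p + c q)) i * of_nat (m i)) =
     (c p + c q) * of_nat (m p) + (\<Sum>i\<in>I - {p,q}. (c(p := c p + c q)) i * of_nat (m i))"
    by (subst J, subst sum.insert) (use assms in auto)
  ultimately show ?thesis by (simp add: eq algebra_simps)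
qed

text \<open>Where \<open>m q \<le> m p\<close>, the monomial is a power of the product of the two
  variables times a power of the p-th one. With that product as the new q-th variable, weights and
  degrees add up and the exponents become \<open>m p - m q\<close> and \<open>m q\<close>.\<close>

lemma solutions_merge:
  assumes I: "finite I" "p \<in> I" "q \<in> I" "p \<noteq> q"
  shows "{m \<in> solutions I b e d. m q \<le> m p} = (\<lambda>m. m(p := m p + m q)) `
    solutions I (b(q := b p + b q)) (e(q := e p + e q)) d" (is "?A = ?f ` ?B")
    and "inj_on (\<lambda>m. m(p := m p + m q)) (S :: (nat \<Rightarrow> nat) set)"
proof -
  have iff: "m \<in> ?B \<longleftrightarrow> ?f m \<in> solutions I b e d" for m
    using sum_merge[OF I, of b m] sum_merge[OF I, of e m] I unfolding solutions_def by auto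
  show "?A = ?f ` ?B"
  proof (intro subset_antisym subsetI)
    fix m assume m: "m \<in> ?A"
    have eq: "?f (m(p := m p - m q)) = m" using m I by auto
    have "m(p := m p - m q) \<in> ?B" unfolding iff eq using m by simp
    thus "m \<in> ?f ` ?B" by (rule image_eqI[rotated]) (use eq in simp)
  next
    fix m assume "m \<in> ?f ` ?B"
    thus "m \<in> ?A" using I by (auto simp: iff simp del: fun_upd_apply) simp_all
  qed
  show "inj_on ?f S"
  proof (rule inj_onI, rule ext)
    fix m m' i assume "?f m = ?f m'"
    hence *: "?f m i = ?f m' i" for i by simp
    show "m i = m' i" using *[of i] *[of q] I by (auto split: if_splits)
  qed
qed

text \<open>On the diagonal only powers of the product occur, so one variable is enough. It is
  stored at p; injectivity rests on solutions over \<open>I - {q}\<close> vanishing at q.\<close>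

lemma solutions_merge_diag:
  assumes I: "finite I" "p \<in> I" "q \<in> I" "p \<noteq> q"
  shows "{m \<in> solutions I b e d. m q = m p} = (\<lambda>m. m(q := m p)) `
    solutions (I - {q}) (b(p := b p + b q)) (e(p := e p + e q)) d" (is "?A = ?f ` ?B")
    and "inj_on (\<lambda>m. m(q := m p)) (solutions (I - {q}) b' e' d)"
proof -
  have iff: "m \<in> ?B \<longleftrightarrow> ?f m \<in> solutions I b e d \<and> m q = 0" for m
    using sum_merge_drop[OF I, of b m] sum_merge_drop[OF I, of e m] I unfolding solutions_def by auto
  show "?A = ?f ` ?B"
  proof (intro subset_antisym subsetI)
    fix m assume m: "m \<in> ?A"
    have eq: "?f (m(q := 0)) = m" using m I by auto
    have "m(q := 0) \<in> ?B" unfolding iff eq using m by simp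
    thus "m \<in> ?f ` ?B" by (rule image_eqI[rotated]) (use eq in simp)
  next
    fix m assume "m \<in> ?f ` ?B"
    thus "m \<in> ?A" using I by (auto simp: iff simp del: fun_upd_apply) simp_all
  qed
  show "inj_on ?f (solutions (I - {q}) b' e' d)"
  proof (rule inj_onI, rule ext)
    fix m m' i assume a: "m \<in> solutions (I - {q}) b' e' d" "m' \<in> solutions (I - {q}) b' e' d"
      and "?f m = ?f m'"
    hence *: "?f m i = ?f m' i" for i by simp
    show "m i = m' i" using *[of i] I a by (auto simp: solutions_def split: if_splits)
  qed
qed

text \<open>This is the identity \<open>1/((1-x)(1-y)) = (1/(1-x) + 1/(1-y) - 1) / (1-xy)\<close> of MacMahon's
  partition analysis.\<close>

lemma solution_series_elliott:
  assumes I: "finite I" "p \<in> I" "q \<in> I" "p \<noteq> q" and e: "\<And>i. i \<in> I \<Longrightarrow> e i > 0"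
  shows "solution_series I b e =
    solution_series I (b(q := b p + b q)) (e(q := e p + e q)) +
    solution_series I (b(p := b p + b q)) (e(p := e p + e q)) -
    solution_series (I - {q}) (b(p := b p + b q)) (e(p := e p + e q))"
proof (rule fps_ext)
  fix d
  let ?S = "solutions I b e d"
  let ?A = "{m \<in> ?S. m q \<le> m p}" and ?B = "{m \<in> ?S. m p \<le> m q}"
  have fin: "finite ?A" "finite ?B" using finite_solutions[of I e b d] I(1) e by simp_all
  have A: "card ?A = card (solutions I (b(q := b p + b q)) (e(q := e p + e q)) d)"
    unfolding solutions_merge(1)[OF I] by (rule card_image[OF solutions_merge(2)[OF I]])
  have B: "card ?B = card (solutions I (b(p := b p + b q)) (e(p := e p + e q)) d)"
    using card_image[OF solutions_merge(2)[OF I(1) I(3) I(2) I(4)[symmetric]]]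
      solutions_merge(1)[OF I(1) I(3) I(2) I(4)[symmetric], where b=b and e=e and d=d] by (simp add: add.commute)
  have "?A \<inter> ?B = {m \<in> ?S. m q = m p}" by auto
  hence C: "card (?A \<inter> ?B) = card (solutions (I - {q}) (b(p := b p + b q)) (e(p := e p + e q)) d)"
    using solutions_merge_diag[OF I] by (simp add: card_image)
  have "?A \<union> ?B = ?S" by auto
  hence "card ?S + card (?A \<inter> ?B) = card ?A + card ?B"
    using card_Un_Int[OF fin] by simp
  from arg_cong[OF this, of "of_nat :: nat \<Rightarrow> complex"] show "solution_series I b e $ d =
    (solution_series I (b(q := b p + b q)) (e(q := e p + e q)) +
    solution_series I (b(p := b p + b q)) (e(p := e p + e q)) -
    solution_series (I - {q}) (b(p := b p + b q)) (e(p := e p + e q))) $ d"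
    unfolding A B C by (simp add: solution_series_def algebra_simps)
qed

text \<open>The case distinction on the sign of an entry of largest absolute value makes the recursion
  terminate: merging into that entry lowers it, and merging into the other entry
  lowers the number of entries of the opposite sign.\<close>

lemma elliott_induct [consumes 1, case_names nonneg nonpos step]:
  fixes b :: "nat \<Rightarrow> int"
  assumes fin: "finite I"
    and nonneg: "\<And>I b. finite I \<Longrightarrow> (\<And>i. i \<in> I \<Longrightarrow> b i \<ge> 0) \<Longrightarrow> P I b"
    and nonpos: "\<And>I b. finite I \<Longrightarrow> (\<And>i. i \<in> I \<Longrightarrow> b i \<le> 0) \<Longrightarrow> P I b"
    and step: "\<And>I b p q. finite I \<Longrightarrow> p \<in> I \<Longrightarrow> q \<in> I \<Longrightarrow> b p < 0 \<Longrightarrow> b q > 0 \<Longrightarrow>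
      P I (b(q := b p + b q)) \<Longrightarrow> P I (b(p := b p + b q)) \<Longrightarrow>
      P (I - {q}) (b(p := b p + b q)) \<Longrightarrow> P I b"
  shows "P I b"
proof -
  define top where "top M I b = {i \<in> I. \<bar>b i\<bar> = int M}" for M and I :: "nat set" and b
  \<comment> \<open>The measure is lexicographic: the bound M on the absolute values, the number of
    entries that attain it (at most c), and in \<open>pos\<close> and \<open>neg\<close> the number
    of entries whose sign is opposite to a chosen top entry.\<close>
  have main: "P I b" if "finite I" "\<And>i. i \<in> I \<Longrightarrow> \<bar>b i\<bar> \<le> int M" "card (top M I b) \<le> c" for M c I b
    using that
  proof (induction M arbitrary: c I b)
    case 0
    thus ?case by (intro nonneg) auto
  next
    case (Suc M)
    note outer = Suc.IH and prems = Suc.prems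
    have low: "P I b" if "finite I" "\<And>i. i \<in> I \<Longrightarrow> \<bar>b i\<bar> \<le> int (Suc M)" "top (Suc M) I b = {}" for I b
    proof (rule outer[OF that(1) _ order_refl])
      fix i assume i: "i \<in> I"
      have "\<bar>b i\<bar> \<noteq> int (Suc M)" using i that(3) by (auto simp: top_def)
      thus "\<bar>b i\<bar> \<le> int M" using that(2)[OF i] by linarith
    qed
    from prems show ?case
    proof (induction c arbitrary: I b)
      case 0
      have "finite (top (Suc M) I b)" using 0(1) by (simp add: top_def)
      hence "top (Suc M) I b = {}" using 0(3) by simp
      thus ?case by (intro low 0)
    next
      case (Suc c)
      note inner = Suc.IH
      have pos: "P I b" if "finite I" "\<And>i. i \<in> I \<Longrightarrow> \<bar>b i\<bar> \<le> int (Suc M)"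
        "card (top (Suc M) I b) \<le> Suc c" "q \<in> I" "b q = int (Suc M)" for I b q
        using that
      proof (induction "card {i \<in> I. b i < 0}" arbitrary: I b rule: less_induct)
        case less
        show ?case
        proof (cases "\<exists>p \<in> I. b p < 0")
          case False
          thus ?thesis by (intro nonneg less) (auto simp: not_less)
        next
          case True
          then obtain p where p: "p \<in> I" "b p < 0" by blast
          have bp: "\<bar>b p\<bar> \<le> int (Suc M)" using less p by blast
          have fin: "finite (top (Suc M) I b)" "finite {i \<in> I. b i < 0}"
            using less.prems(1) by (auto simp: top_def)
          have q: "q \<in> top (Suc M) I b" using less by (auto simp: top_def)
          have cq: "card (top (Suc M) I b - {q}) \<le> c" using q less fin by simp
          have pq: "p \<noteq> q" using p less by auto
          show ?thesis
          proof (rule step[of I p q b, OF less.prems(1) p(1) less.prems(4) p(2)])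
            show "0 < b q" using less by simp
            \<comment> \<open>From \<open>- int (Suc M) \<le> b p < 0\<close> and
              \<open>b q = int (Suc M)\<close> the sum lies in \<open>{0..int M}\<close>. Merged
              into q it takes q off the top; merged into p it adds nothing to the top and leaves one
              negative entry fewer.\<close>
            have "top (Suc M) I (b(q := b p + b q)) \<subseteq> top (Suc M) I b - {q}"
              using p bp less.prems(5) by (auto simp: top_def)
            from card_mono[OF _ this] have "card (top (Suc M) I (b(q := b p + b q))) \<le> c"
              using cq fin by simp
            thus "P I (b(q := b p + b q))"
              by (rule inner[rotated 2]) (use less.prems(1,2,5) p bp in auto)
            have "top (Suc M) (I - {q}) (b(p := b p + b q)) \<subseteq> top (Suc M) I b - {q}"
              using p bp less.prems(5) by (auto simp: top_def)
            from card_mono[OF _ this] have "card (top (Suc M) (I - {q}) (b(p := b p + b q))) \<le> c"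
              using cq fin by simp
            thus "P (I - {q}) (b(p := b p + b q))"
              by (rule inner[rotated 2]) (use less.prems(1,2,5) p bp in auto)
            have "top (Suc M) I (b(p := b p + b q)) \<subseteq> top (Suc M) I b"
              using p bp less.prems(5) by (auto simp: top_def)
            from card_mono[OF _ this] have c1: "card (top (Suc M) I (b(p := b p + b q))) \<le> Suc c"
              using less.prems(3) fin by simp
            have "{i \<in> I. (b(p := b p + b q)) i < 0} \<subset> {i \<in> I. b i < 0}"
              using p bp less.prems(5) pq by auto
            hence "card {i \<in> I. (b(p := b p + b q)) i < 0} < card {i \<in> I. b i < 0}"
              by (rule psubset_card_mono[OF fin(2)])
            thus "P I (b(p := b p + b q))"
              by (rule less.hyps[OF _ _ _ c1]) (use less.prems(1,2,4,5) p bp pq in auto)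
          qed
        qed
      qed
      have neg: "P I b" if "finite I" "\<And>i. i \<in> I \<Longrightarrow> \<bar>b i\<bar> \<le> int (Suc M)"
        "card (top (Suc M) I b) \<le> Suc c" "p \<in> I" "b p = - int (Suc M)" for I b p
        using that
      proof (induction "card {i \<in> I. b i > 0}" arbitrary: I b rule: less_induct)
        case less
        show ?case
        proof (cases "\<exists>q \<in> I. b q > 0")
          case False
          thus ?thesis by (intro nonpos less) (auto simp: not_less)
        next
          case True
          then obtain q where q: "q \<in> I" "b q > 0" by blast
          have bq: "\<bar>b q\<bar> \<le> int (Suc M)" using less q by blast
          have fin: "finite (top (Suc M) I b)" "finite {i \<in> I. b i > 0}"
            using less.prems(1) by (auto simp: top_def)
          have p: "p \<in> top (Suc M) I b" using less by (auto simp: top_def)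
          have cp: "card (top (Suc M) I b - {p}) \<le> c" using p less fin by simp
          have pq: "p \<noteq> q" using q less by auto
          show ?thesis
          proof (rule step[of I p q b, OF less.prems(1) less.prems(4) q(1) _ q(2)])
            show "b p < 0" using less by simp
            have "top (Suc M) I (b(p := b p + b q)) \<subseteq> top (Suc M) I b - {p}"
              using q bq less.prems(5) by (auto simp: top_def)
            from card_mono[OF _ this] have "card (top (Suc M) I (b(p := b p + b q))) \<le> c"
              using cp fin by simp
            thus "P I (b(p := b p + b q))"
              by (rule inner[rotated 2]) (use less.prems(1,2,5) q bq in auto)
            have "top (Suc M) (I - {q}) (b(p := b p + b q)) \<subseteq> top (Suc M) I b - {p}"
              using q bq less.prems(5) by (auto simp: top_def)
            from card_mono[OF _ this] have "card (top (Suc M) (I - {q}) (b(p := b p + b q))) \<le> c"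
              using cp fin by simp
            thus "P (I - {q}) (b(p := b p + b q))"
              by (rule inner[rotated 2]) (use less.prems(1,2,5) q bq in auto)
            have "top (Suc M) I (b(q := b p + b q)) \<subseteq> top (Suc M) I b"
              using q bq less.prems(5) by (auto simp: top_def)
            from card_mono[OF _ this] have c1: "card (top (Suc M) I (b(q := b p + b q))) \<le> Suc c"
              using less.prems(3) fin by simp
            have "{i \<in> I. (b(q := b p + b q)) i > 0} \<subset> {i \<in> I. b i > 0}"
              using q bq less.prems(5) pq by auto
            hence "card {i \<in> I. (b(q := b p + b q)) i > 0} < card {i \<in> I. b i > 0}"
              by (rule psubset_card_mono[OF fin(2)])
            thus "P I (b(q := b p + b q))"
              by (rule less.hyps[OF _ _ _ c1]) (use less.prems(1,2,4,5) q bq pq in auto)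
          qed
        qed
      qed
      show ?case
      proof (cases "top (Suc M) I b = {}")
        case True
        thus ?thesis by (intro low Suc.prems)
      next
        case False
        then obtain i where "i \<in> I" "\<bar>b i\<bar> = int (Suc M)" by (auto simp: top_def)
        hence "b i = int (Suc M) \<or> b i = - int (Suc M)" by linarith
        thus ?thesis
          using pos[OF Suc.prems \<open>i \<in> I\<close>] neg[OF Suc.prems \<open>i \<in> I\<close>] by blast
      qed
    qed
  qed
  define M where "M = (\<Sum>i\<in>I. nat \<bar>b i\<bar>)"
  have "\<bar>b i\<bar> \<le> int M" if "i \<in> I" for i
    unfolding M_def using member_le_sum[of i I "\<lambda>i. \<bar>b i\<bar>"] that fin by simp
  from main[OF fin this order_refl] show ?thesis .
qed

section \<open>Poles at \<open>t = 1\<close>\<close>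

text \<open>Here \<open>s\<close> stands for \<open>1 - t\<close>.\<close>

definition pole_limit :: "complex fps \<Rightarrow> nat \<Rightarrow> complex \<Rightarrow> bool" where
  "pole_limit F r g \<longleftrightarrow> (\<exists>P Q :: complex poly. Q \<noteq> 0 \<and> fps_of_poly P = F * fps_of_poly Q \<and>
     ((\<lambda>s. s ^ r * (poly P (1 - s) / poly Q (1 - s))) \<longlongrightarrow> g) (at 0))"

section \<open>Arithmetic of pole orders and leading coefficients\<close>

lemma eventually_poly_1_minus_nonzero:
  fixes Q :: "complex poly"
  assumes "Q \<noteq> 0"
  shows "eventually (\<lambda>s. poly Q (1 - s) \<noteq> 0) (at 0)"
proof -
  have "finite ((\<lambda>x. 1 - x) ` {s. poly Q s = 0})"
    using assms by (intro finite_imageI poly_roots_finite)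
  moreover have "{s. poly Q (1 - s) = 0} \<subseteq> (\<lambda>x. 1 - x) ` {s. poly Q s = 0}"
    by (auto simp: image_iff intro!: exI[of _ "1 - _"])
  ultimately have "finite {s. poly Q (1 - s) = 0}" by (rule finite_subset[rotated])
  thus ?thesis using islimpt_finite[of "{s. poly Q (1 - s) = 0}" 0]
    by (simp add: islimpt_iff_eventually)
qed

lemma pole_limit_add:
  assumes "pole_limit F r g" "pole_limit G r h"
  shows "pole_limit (F + G) r (g + h)"
proof -
  obtain P Q where 1: "Q \<noteq> 0" "fps_of_poly P = F * fps_of_poly Q"
    "((\<lambda>s. s ^ r * (poly P (1 - s) / poly Q (1 - s))) \<longlongrightarrow> g) (at 0)"
    using assms(1) unfolding pole_limit_def by blast
  obtain P' Q' where 2: "Q' \<noteq> 0" "fps_of_poly P' = G * fps_of_poly Q'"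
    "((\<lambda>s. s ^ r * (poly P' (1 - s) / poly Q' (1 - s))) \<longlongrightarrow> h) (at 0)"
    using assms(2) unfolding pole_limit_def by blast
  have "((\<lambda>s. s ^ r * (poly (P * Q' + P' * Q) (1 - s) / poly (Q * Q') (1 - s))) \<longlongrightarrow> g + h) (at 0)"
  proof (rule Lim_transform_eventually[OF tendsto_add[OF 1(3) 2(3)]])
    show "eventually (\<lambda>s. s ^ r * (poly P (1 - s) / poly Q (1 - s)) +
        s ^ r * (poly P' (1 - s) / poly Q' (1 - s)) =
        s ^ r * (poly (P * Q' + P' * Q) (1 - s) / poly (Q * Q') (1 - s))) (at 0)"
      using eventually_poly_1_minus_nonzero[OF 1(1)] eventually_poly_1_minus_nonzero[OF 2(1)]
      by eventually_elim (simp add: field_simps)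
  qed
  moreover have "fps_of_poly (P * Q' + P' * Q) = (F + G) * fps_of_poly (Q * Q')"
    using 1(2) 2(2) by (simp add: fps_of_poly_mult fps_of_poly_add algebra_simps)
  ultimately show ?thesis using 1(1) 2(1) unfolding pole_limit_def by (metis no_zero_divisors)
qed

lemma pole_limit_uminus:
  assumes "pole_limit F r g"
  shows "pole_limit (- F) r (- g)"
proof -
  obtain P Q where 1: "Q \<noteq> 0" "fps_of_poly P = F * fps_of_poly Q"
    "((\<lambda>s. s ^ r * (poly P (1 - s) / poly Q (1 - s))) \<longlongrightarrow> g) (at 0)"
    using assms(1) unfolding pole_limit_def by blast
  have "((\<lambda>s. s ^ r * (poly (- P) (1 - s) / poly Q (1 - s))) \<longlongrightarrow> - g) (at 0)"
    using tendsto_minus[OF 1(3)] by simp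
  moreover have "fps_of_poly (- P) = - F * fps_of_poly Q" using 1(2) by (simp add: fps_of_poly_uminus)
  ultimately show ?thesis using 1(1) unfolding pole_limit_def by blast
qed

lemma pole_limit_diff:
  assumes "pole_limit F r g" "pole_limit G r h"
  shows "pole_limit (F - G) r (g - h)"
  using pole_limit_add[OF assms(1) pole_limit_uminus[OF assms(2)]] by simp

lemma pole_limit_less:
  assumes "pole_limit F r g" "r < r'"
  shows "pole_limit F r' 0"
proof -
  obtain P Q where 1: "Q \<noteq> 0" "fps_of_poly P = F * fps_of_poly Q"
    "((\<lambda>s. s ^ r * (poly P (1 - s) / poly Q (1 - s))) \<longlongrightarrow> g) (at 0)"
    using assms(1) unfolding pole_limit_def by blast
  have "((\<lambda>s::complex. s ^ (r' - r)) \<longlongrightarrow> 0 ^ (r' - r)) (at 0)" by (intro tendsto_intros)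
  from tendsto_mult[OF this 1(3)]
  have "((\<lambda>s. s ^ (r' - r) * (s ^ r * (poly P (1 - s) / poly Q (1 - s)))) \<longlongrightarrow> 0) (at 0)"
    using assms(2) by (simp add: power_0_left)
  moreover have "s ^ (r' - r) * (s ^ r * x) = s ^ r' * x" for s x :: complex
    using assms(2) by (simp flip: power_add mult.assoc)
  ultimately have "((\<lambda>s. s ^ r' * (poly P (1 - s) / poly Q (1 - s))) \<longlongrightarrow> 0) (at 0)" by simp
  with 1 show ?thesis unfolding pole_limit_def by blast
qed

section \<open>Geometric series and systems of one sign\<close>

lemma tendsto_geometric_pole:
  assumes "e > 0"
  shows "((\<lambda>s::complex. s / (1 - (1 - s) ^ e)) \<longlongrightarrow> 1 / of_nat e) (at 0)"
proof -
  have "((\<lambda>s::complex. \<Sum>i<e. (1 - s) ^ i) \<longlongrightarrow> (\<Sum>i<e. (1 - 0) ^ i)) (at 0)"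
    by (intro tendsto_intros)
  hence "((\<lambda>s::complex. 1 / (\<Sum>i<e. (1 - s) ^ i)) \<longlongrightarrow> 1 / of_nat e) (at 0)"
    using assms by (intro tendsto_intros) auto
  thus ?thesis
  proof (rule Lim_transform_eventually)
    have "1 - (1 - s) ^ e = s * (\<Sum>i<e. (1 - s) ^ i)" for s :: complex
      using one_diff_power_eq[of "1 - s" e] by simp
    thus "eventually (\<lambda>s::complex. 1 / (\<Sum>i<e. (1 - s) ^ i) = s / (1 - (1 - s) ^ e)) (at 0)"
      by (simp add: eventually_at_filter)
  qed
qed

text \<open>A variable of weight 0 is unconstrained. Lowering its exponent by one maps the solutions
  that use it onto all solutions of degree \<open>d - e j\<close>, which accounts for the factor
  \<open>1 - t^(e j)\<close>.\<close>

lemma solution_series_insert: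
  assumes I: "finite I" "j \<notin> I" and e: "\<And>i. i \<in> insert j I \<Longrightarrow> e i > 0" and b: "b j = 0"
  shows "solution_series (insert j I) b e * (1 - fps_X ^ e j) = solution_series I b e"
proof (rule fps_ext)
  fix d
  have ej: "e j > 0" using e by simp
  let ?S = "solutions (insert j I) b e"
  have zero: "{m \<in> ?S d. m j = 0} = solutions I b e d"
    using I by (auto simp: solutions_def) (metis)+
  have fin: "finite (?S d)" using finite_solutions[of "insert j I" e] I(1) e by simp
  have "card (?S d) = card {m \<in> ?S d. m j = 0} + card {m \<in> ?S d. m j \<noteq> 0}"
    using fin by (subst card_Un_disjoint[symmetric]) (auto intro: arg_cong[of _ _ card])
  moreover have "card {m \<in> ?S d. m j \<noteq> 0} = (if d < e j then 0 else card (?S (d - e j)))"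
  proof (cases "d < e j")
    case True
    have "m j = 0" if "m \<in> ?S d" for m
    proof (rule ccontr)
      assume "m j \<noteq> 0"
      hence "e j \<le> e j * m j" by simp
      also have "\<dots> \<le> d" using that I by (simp add: solutions_def)
      finally show False using True by simp
    qed
    hence "{m \<in> ?S d. m j \<noteq> 0} = {}" by auto
    thus ?thesis by (simp only: True card.empty if_True)
  next
    case False
    have upd: "(\<Sum>i\<in>I. c i * f ((m(j := x)) i)) = (\<Sum>i\<in>I. c i * f (m i))"
      for c :: "nat \<Rightarrow> 'b :: comm_semiring_0" and f :: "nat \<Rightarrow> 'b" and m x
      by (rule sum.cong) (use I in auto)
    have "{m \<in> ?S d. m j \<noteq> 0} = (\<lambda>m. m(j := Suc (m j))) ` ?S (d - e j)"
    proof (intro subset_antisym subsetI)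
      fix m assume m: "m \<in> {m \<in> ?S d. m j \<noteq> 0}"
      have "m(j := m j - 1) \<in> ?S (d - e j)"
        using m I b upd[of b int m] upd[of e "\<lambda>x. x" m] by (auto simp: solutions_def diff_mult_distrib2)
      moreover have "m = (m(j := m j - 1))(j := Suc ((m(j := m j - 1)) j))" using m by auto
      ultimately show "m \<in> (\<lambda>m. m(j := Suc (m j))) ` ?S (d - e j)" by blast
    next
      fix m assume "m \<in> (\<lambda>m. m(j := Suc (m j))) ` ?S (d - e j)"
      thus "m \<in> {m \<in> ?S d. m j \<noteq> 0}"
        using I b upd[of b int] upd[of e "\<lambda>x. x"] False by (auto simp: solutions_def)
    qed
    moreover have "inj_on (\<lambda>m. m(j := Suc (m j))) (?S (d - e j))"
    proof (rule inj_onI, rule ext)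
      fix m m' :: "nat \<Rightarrow> nat" and i assume "m(j := Suc (m j)) = m'(j := Suc (m' j))"
      hence *: "(m(j := Suc (m j))) i = (m'(j := Suc (m' j))) i" for i by simp
      show "m i = m' i" using *[of i] by (auto split: if_splits)
    qed
    ultimately show ?thesis using False by (simp add: card_image)
  qed
  ultimately show "(solution_series (insert j I) b e * (1 - fps_X ^ e j)) $ d = solution_series I b e $ d"
    using ej unfolding zero
    by (auto simp: solution_series_def algebra_simps fps_X_power_mult_nth)
qed

lemma solution_series_zero_weights:
  assumes "finite I" "\<And>i. i \<in> I \<Longrightarrow> e i > 0" "\<And>i. i \<in> I \<Longrightarrow> b i = 0"
  shows "solution_series I b e * (\<Prod>i\<in>I. 1 - fps_X ^ e i) = 1"
  using assms
proof (induction I rule: finite_induct)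
  case empty
  have "solutions {} b e d = (if d = 0 then {\<lambda>_. 0} else {})" for d
    by (auto simp: solutions_def)
  thus ?case by (auto simp: solution_series_def fps_eq_iff)
next
  case (insert j I)
  thus ?case using solution_series_insert[of I j e b] by (simp add: mult.assoc[symmetric])
qed

text \<open>A vanishing sum of terms of one sign vanishes termwise, so variables of nonzero weight
  do not occur in solutions.\<close>

lemma solution_series_support:
  assumes I: "finite I" and b: "(\<forall>i\<in>I. b i \<ge> 0) \<or> (\<forall>i\<in>I. b i \<le> 0)"
  shows "solution_series I b e = solution_series {i \<in> I. b i = 0} b e"
proof -
  have "solutions I b e d = solutions {i \<in> I. b i = 0} b e d" for d
  proof (intro subset_antisym subsetI)
    fix m assume m: "m \<in> solutions I b e d"
    have z: "b i * int (m i) = 0" if "i \<in> I" for i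
      using b
    proof
      assume "\<forall>i\<in>I. b i \<ge> 0"
      thus ?thesis using m that sum_nonneg_eq_0_iff[OF I, of "\<lambda>i. b i * int (m i)"]
        by (auto simp: solutions_def)
    next
      assume "\<forall>i\<in>I. b i \<le> 0"
      thus ?thesis using m that sum_nonneg_eq_0_iff[OF I, of "\<lambda>i. - (b i * int (m i))"]
        by (auto simp: solutions_def sum_negf mult_nonpos_nonneg)
    qed
    have "(\<Sum>i\<in>I. e i * m i) = (\<Sum>i\<in>{i\<in>I. b i = 0}. e i * m i)"
      using z I by (intro sum.mono_neutral_right) force+
    moreover have "m i = 0" if "i \<notin> {i \<in> I. b i = 0}" for i
      using that z[of i] m by (auto simp: solutions_def)
    ultimately show "m \<in> solutions {i \<in> I. b i = 0} b e d"
      using m by (simp add: solutions_def)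
  next
    fix m assume m: "m \<in> solutions {i \<in> I. b i = 0} b e d"
    have "(\<Sum>i\<in>I. e i * m i) = (\<Sum>i\<in>{i\<in>I. b i = 0}. e i * m i)"
      using m I by (intro sum.mono_neutral_right) (auto simp: solutions_def)
    moreover have "(\<Sum>i\<in>I. b i * int (m i)) = (\<Sum>i\<in>{i\<in>I. b i = 0}. b i * int (m i))"
      using m I by (intro sum.mono_neutral_right) (auto simp: solutions_def)
    ultimately show "m \<in> solutions I b e d" using m by (auto simp: solutions_def)
  qed
  thus ?thesis by (simp add: solution_series_def)
qed

lemma pole_limit_zero_weights:
  assumes "finite I" "\<And>i. i \<in> I \<Longrightarrow> e i > 0" "\<And>i. i \<in> I \<Longrightarrow> b i = 0"
  shows "pole_limit (solution_series I b e) (card I) (\<Prod>i\<in>I. 1 / of_nat (e i))"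
  unfolding pole_limit_def
proof (intro exI conjI)
  let ?Q = "\<Prod>i\<in>I. 1 - monom 1 (e i) :: complex poly"
  have Q: "fps_of_poly ?Q = (\<Prod>i\<in>I. 1 - fps_X ^ e i)"
    by (simp add: fps_of_poly_prod fps_of_poly_diff fps_of_poly_monom)
  show "fps_of_poly 1 = solution_series I b e * fps_of_poly ?Q"
    using solution_series_zero_weights[OF assms, of "\<lambda>i. i"] unfolding Q by simp
  thus "?Q \<noteq> 0" by auto
  have "((\<lambda>s::complex. \<Prod>i\<in>I. s / (1 - (1 - s) ^ e i)) \<longlongrightarrow> (\<Prod>i\<in>I. 1 / of_nat (e i))) (at 0)"
    by (intro tendsto_prod tendsto_geometric_pole assms)
  moreover have "(\<Prod>i\<in>I. s / (1 - (1 - s) ^ e i)) = s ^ card I * (poly 1 (1 - s) / poly ?Q (1 - s))"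
    for s :: complex
    by (simp add: prod_dividef poly_prod poly_monom)
  ultimately show "((\<lambda>s. s ^ card I * (poly 1 (1 - s) / poly ?Q (1 - s))) \<longlongrightarrow> (\<Prod>i\<in>I. 1 / of_nat (e i))) (at 0)"
    by simp
qed

lemma pole_limit_same_sign:
  assumes "finite I" "\<And>i. i \<in> I \<Longrightarrow> e i > 0" and b: "(\<forall>i\<in>I. b i \<ge> 0) \<or> (\<forall>i\<in>I. b i \<le> 0)"
    and "card {i \<in> I. b i = 0} < r"
  shows "pole_limit (solution_series I b e) r 0"
  unfolding solution_series_support[OF assms(1) b]
  by (rule pole_limit_less[OF pole_limit_zero_weights]) (use assms in auto)

text \<open>The limit 0 says that one nonzero weight already lowers the pole order below the number
  of variables. Applied to the diagonal term of the elimination, with its \<open>card I - 1\<close>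
  variables, it makes that term invisible at order \<open>card I - 1\<close>.\<close>

lemma pole_limit_card:
  assumes "finite I" "\<And>i. i \<in> I \<Longrightarrow> e i > 0" "\<exists>i\<in>I. b i \<noteq> 0"
  shows "pole_limit (solution_series I b e) (card I) 0"
  using assms
proof (induction I b arbitrary: e rule: elliott_induct)
  case (nonneg I b)
  have "{i \<in> I. b i = 0} \<subset> I" using nonneg by auto
  thus ?case using nonneg by (intro pole_limit_same_sign psubset_card_mono) auto
next
  case (nonpos I b)
  have "{i \<in> I. b i = 0} \<subset> I" using nonpos by auto
  thus ?case using nonpos by (intro pole_limit_same_sign psubset_card_mono) auto
next
  case (step I b p q)
  have pq: "p \<noteq> q" using step by auto
  have c: "card (I - {q}) < card I" using step by (intro psubset_card_mono) auto
  have 1: "pole_limit (solution_series I (b(q := b p + b q)) (e(q := e p + e q))) (card I) 0"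
    by (rule step.IH) (use step pq in \<open>auto intro!: bexI[of _ p]\<close>)
  have 2: "pole_limit (solution_series I (b(p := b p + b q)) (e(p := e p + e q))) (card I) 0"
    by (rule step.IH) (use step pq in \<open>auto intro!: bexI[of _ q]\<close>)
  \<comment> \<open>The diagonal term may lose all its nonzero weights; then its pole order is at
    most \<open>card (I - {q})\<close>, still less than \<open>card I\<close>.\<close>
  have 3: "pole_limit (solution_series (I - {q}) (b(p := b p + b q)) (e(p := e p + e q))) (card I) 0"
  proof (cases "\<exists>i\<in>I - {q}. (b(p := b p + b q)) i \<noteq> 0")
    case True
    show ?thesis by (rule pole_limit_less[OF step.IH(3)[OF _ True] c]) (use step in auto)
  next
    case False
    show ?thesis by (rule pole_limit_less[OF pole_limit_zero_weights c]) (use step False in auto)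
  qed
  show ?case
    using pole_limit_diff[OF pole_limit_add[OF 1 2] 3] solution_series_elliott[of I p q e b] step.hyps
      step.prems(1) pq by simp
qed

section \<open>The leading coefficient\<close>

definition lagrange_poly :: "'i set \<Rightarrow> ('i \<Rightarrow> 'a :: field) \<Rightarrow> ('i \<Rightarrow> 'a) \<Rightarrow> 'a poly" where
  "lagrange_poly J x y =
     (\<Sum>i\<in>J. Polynomial.smult (y i / (\<Prod>j\<in>J - {i}. x i - x j)) (\<Prod>j\<in>J - {i}. [:- x j, 1:]))"

lemma lagrange_poly_eval:
  assumes "finite J" "inj_on x J" "k \<in> J"
  shows "poly (lagrange_poly J x y) (x k) = y k"
proof -
  have "poly (lagrange_poly J x y) (x k) =
    (\<Sum>i\<in>J. if i = k then y k else 0)"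
    unfolding lagrange_poly_def poly_sum
  proof (rule sum.cong[OF refl])
    fix i assume i: "i \<in> J"
    show "poly (Polynomial.smult (y i / (\<Prod>j\<in>J - {i}. x i - x j)) (\<Prod>j\<in>J - {i}. [:- x j, 1:])) (x k) =
      (if i = k then y k else 0)"
    proof (cases "i = k")
      case True
      have "(\<Prod>j\<in>J - {k}. x k - x j) \<noteq> 0"
        using assms by (auto simp: prod_zero_iff inj_on_def)
      thus ?thesis using True by (simp add: poly_prod)
    next
      case False
      hence "(\<Prod>j\<in>J - {i}. x k - x j) = 0"
        using assms i by (intro prod_zero) auto
      thus ?thesis using False by (simp add: poly_prod)
    qed
  qed
  thus ?thesis using assms by simp
qed

lemma degree_prod_linear:
  fixes x :: "'i \<Rightarrow> 'a :: idom"
  assumes "finite J"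
  shows "degree (\<Prod>j\<in>J. [:- x j, 1:]) = card J" "coeff (\<Prod>j\<in>J. [:- x j, 1:]) (card J) = 1"
proof -
  show d: "degree (\<Prod>j\<in>J. [:- x j, 1:]) = card J"
    by (subst degree_prod_eq_sum_degree) auto
  have "lead_coeff (\<Prod>j\<in>J. [:- x j, 1:]) = 1" by (subst lead_coeff_prod) auto
  thus "coeff (\<Prod>j\<in>J. [:- x j, 1:]) (card J) = 1" by (simp add: d)
qed

lemma degree_lagrange_poly:
  assumes "finite J"
  shows "degree (lagrange_poly J x y) \<le> card J - 1"
  unfolding lagrange_poly_def
proof (rule degree_sum_le[OF assms])
  fix i assume "i \<in> J"
  thus "degree (Polynomial.smult (y i / (\<Prod>j\<in>J - {i}. x i - x j)) (\<Prod>j\<in>J - {i}. [:- x j, 1:])) \<le> card J - 1"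
    using degree_prod_linear(1)[of "J - {i}" x] assms
    by (intro order_trans[OF degree_smult_le]) simp
qed

text \<open>The top coefficient is the divided difference of y at the nodes x. It is the link
  between sums of residues and determinants with an altered Vandermonde row.\<close>

lemma coeff_lagrange_poly:
  assumes "finite J"
  shows "coeff (lagrange_poly J x y) (card J - 1) = (\<Sum>i\<in>J. y i / (\<Prod>j\<in>J - {i}. x i - x j))"
  unfolding lagrange_poly_def coeff_sum
proof (rule sum.cong[OF refl])
  fix i assume "i \<in> J"
  thus "coeff (Polynomial.smult (y i / (\<Prod>j\<in>J - {i}. x i - x j)) (\<Prod>j\<in>J - {i}. [:- x j, 1:])) (card J - 1) =
      y i / (\<Prod>j\<in>J - {i}. x i - x j)"
    using degree_prod_linear(2)[of "J - {i}" x] assms by simp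
qed

text \<open>The sum is the coefficient at \<open>card J - 1 > 0\<close> of the polynomial that
  interpolates the constant 1, and this polynomial is 1 itself.\<close>

lemma sum_inverse_prod_diff:
  fixes x :: "'i \<Rightarrow> 'a :: field"
  assumes "finite J" "inj_on x J" "card J \<ge> 2"
  shows "(\<Sum>i\<in>J. 1 / (\<Prod>j\<in>J - {i}. x i - x j)) = 0"
proof -
  have "lagrange_poly J x (\<lambda>_. 1) = 1"
  proof (rule poly_eqI_degree[of "x ` J"])
    fix z assume "z \<in> x ` J"
    thus "poly (lagrange_poly J x (\<lambda>_. 1)) z = poly 1 z"
      using lagrange_poly_eval[OF assms(1,2), of _ "\<lambda>_. 1"] by auto
  qed (use assms degree_lagrange_poly[OF assms(1), of x "\<lambda>_. 1"] in \<open>auto simp: card_image\<close>)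
  thus ?thesis using coeff_lagrange_poly[OF assms(1), of x "\<lambda>_. 1"] assms(3) by simp
qed

text \<open>For simple poles, minus the sum of the residues of
  \<open>1 / (\<Prod>j\<in>I. E j + b j * x)\<close> at \<open>- E i / b i\<close> with
  \<open>b i < 0\<close>. Clearing denominators in the \<open>card I - 1\<close> other factors and
  dividing by the slope \<open>b i\<close> of the vanishing one gives the exponent
  \<open>card I - 2\<close>.\<close>

definition leading_sum :: "nat set \<Rightarrow> (nat \<Rightarrow> int) \<Rightarrow> (nat \<Rightarrow> real) \<Rightarrow> real" where
  "leading_sum I b E = (\<Sum>i\<in>{i\<in>I. b i < 0}. - (of_int (b i) ^ (card I - 2)) /
     (\<Prod>j\<in>I - {i}. of_int (b i) * E j - of_int (b j) * E i))"

text \<open>This makes the poles \<open>- E i / b i\<close> distinct; against an index with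
  \<open>b j = 0\<close> it says \<open>E j \<noteq> 0\<close>.\<close>

definition generic_slopes :: "nat set \<Rightarrow> (nat \<Rightarrow> int) \<Rightarrow> (nat \<Rightarrow> real) \<Rightarrow> bool" where
  "generic_slopes I b E \<longleftrightarrow> (\<forall>i\<in>I. \<forall>j\<in>I. i \<noteq> j \<longrightarrow> b i \<noteq> 0 \<longrightarrow>
     of_int (b i) * E j - of_int (b j) * E i \<noteq> 0)"

lemma generic_slopesD:
  assumes "generic_slopes I b E" "i \<in> I" "j \<in> I" "i \<noteq> j" "b i \<noteq> 0"
  shows "of_int (b i) * E j - of_int (b j) * E i \<noteq> 0"
  using assms unfolding generic_slopes_def by blast

text \<open>With \<open>u = E p + b p * x\<close> and \<open>v = E q + b q * x\<close> this is
  \<open>1/(u v) = 1/(u (u + v)) + 1/(v (u + v))\<close> read off at the residues. A pole from W is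
  split by partial fractions, the pole of u occurs only in the first summand, that of v is not
  counted as \<open>b q > 0\<close>, and the pole of \<open>u + v\<close> cancels.\<close>

lemma leading_sum_merge:
  assumes I: "finite I" "p \<in> I" "q \<in> I" and b: "b p < 0" "b q > 0"
    and gen: "generic_slopes I b E" "generic_slopes I (b(q := b p + b q)) (E(q := E p + E q))"
  shows "leading_sum I b E =
    leading_sum I (b(q := b p + b q)) (E(q := E p + E q)) +
    leading_sum I (b(p := b p + b q)) (E(p := E p + E q))"
proof -
  define b1 E1 b2 E2 where "b1 = b(q := b p + b q)" "E1 = E(q := E p + E q)"
    "b2 = b(p := b p + b q)" "E2 = E(p := E p + E q)"
  note upd = this
  define D where "D b E i j = real_of_int (b i) * E j - of_int (b j) * E i" for b E and i j :: nat
  define T where "T b E i = - (real_of_int (b i) ^ (card I - 2)) / (\<Prod>j\<in>I - {i}. D b E i j)" for b E i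
  define W where "W = I - {p, q}"
  have pq: "p \<noteq> q" using b by auto
  have W: "finite W" "p \<notin> W" "q \<notin> W" "I = insert p (insert q W)" using I by (auto simp: W_def)
  have prodW: "(\<Prod>j\<in>I - {i}. f j) = f p * (f q * (\<Prod>j\<in>W - {i}. f j))"
    if "i \<in> W" for i and f :: "nat \<Rightarrow> real"
  proof -
    have "I - {i} = insert p (insert q (W - {i}))" using that W by auto
    thus ?thesis using W pq by simp
  qed
  have prodp: "(\<Prod>j\<in>I - {p}. f j) = f q * (\<Prod>j\<in>W. f j)" for f :: "nat \<Rightarrow> real"
  proof -
    have "I - {p} = insert q W" using W pq by auto
    thus ?thesis using W pq by simp
  qed
  have prodq: "(\<Prod>j\<in>I - {q}. f j) = f p * (\<Prod>j\<in>W. f j)" for f :: "nat \<Rightarrow> real"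
  proof -
    have "I - {q} = insert p W" using W pq by auto
    thus ?thesis using W pq by simp
  qed
  have TW: "T b E i = T b1 E1 i + T b2 E2 i" if i: "i \<in> W" "b i < 0" for i
  proof -
    let ?P = "\<Prod>j\<in>W - {i}. D b E i j"
    have ne: "i \<noteq> p" "i \<noteq> q" using i W by auto
    have P: "(\<Prod>j\<in>W - {i}. D b1 E1 i j) = ?P" "(\<Prod>j\<in>W - {i}. D b2 E2 i j) = ?P"
      by (rule prod.cong; use W i in \<open>auto simp: D_def upd\<close>)+
    have D1: "D b1 E1 i p = D b E i p" "D b1 E1 i q = D b E i p + D b E i q"
      "D b2 E2 i p = D b E i p + D b E i q" "D b2 E2 i q = D b E i q"
      using ne pq by (auto simp: D_def upd algebra_simps)
    have nz: "D b E i p \<noteq> 0" "D b E i q \<noteq> 0" "D b E i p + D b E i q \<noteq> 0"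
    proof -
      show "D b E i p \<noteq> 0" "D b E i q \<noteq> 0"
        unfolding D_def by (rule generic_slopesD[OF gen(1)]; use i W ne I in auto)+
      have "D b1 E1 i q \<noteq> 0"
        unfolding D_def upd by (rule generic_slopesD[OF gen(2)]) (use i W ne I in auto)
      thus "D b E i p + D b E i q \<noteq> 0" by (simp add: D1)
    qed
    have bi: "b1 i = b i" "b2 i = b i" using ne by (auto simp: upd)
    show ?thesis
      unfolding T_def prodW[OF i(1)] P D1 bi using nz
      by (simp add: divide_simps) (simp add: algebra_simps)
  qed
  have Tp: "T b1 E1 p = T b E p"
  proof -
    have "(\<Prod>j\<in>W. D b1 E1 p j) = (\<Prod>j\<in>W. D b E p j)"
      by (rule prod.cong) (use W pq in \<open>auto simp: D_def upd\<close>)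
    thus ?thesis unfolding T_def prodp using pq by (simp add: upd D_def algebra_simps)
  qed
  \<comment> \<open>The pole of \<open>u + v\<close> is stored at q in the first merged system and
    at p in the second. Its residues are opposite because \<open>D\<close> is antisymmetric and its
    value at p and q is unchanged by merging.\<close>
  have Tq: "T b1 E1 q + T b2 E2 p = 0"
  proof -
    have "(\<Prod>j\<in>W. D b1 E1 q j) = (\<Prod>j\<in>W. D b2 E2 p j)"
      by (rule prod.cong) (use W pq in \<open>auto simp: D_def upd\<close>)
    moreover have "D b1 E1 q p = - D b2 E2 p q" using pq by (simp add: D_def upd algebra_simps)
    moreover have "b1 q = b2 p" by (simp add: upd)
    ultimately show ?thesis unfolding T_def prodp prodq by simp
  qed
  define N where "N = {i \<in> W. b i < 0}"
  have N: "finite N" "p \<notin> N" "q \<notin> N" using W by (auto simp: N_def)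
  have L: "leading_sum I b E = T b E p + (\<Sum>i\<in>N. T b E i)"
  proof -
    have "{i\<in>I. b i < 0} = insert p N" using W b pq by (auto simp: N_def)
    thus ?thesis unfolding leading_sum_def T_def D_def using N by simp
  qed
  have "leading_sum I b1 E1 + leading_sum I b2 E2 = T b1 E1 p + (\<Sum>i\<in>N. T b1 E1 i) + (\<Sum>i\<in>N. T b2 E2 i)"
  \<comment> \<open>The sign of the merged weight decides whether the pole of \<open>u + v\<close>
    is counted in both systems or in neither.\<close>
  proof (cases "b p + b q < 0")
    case True
    have "{i\<in>I. b1 i < 0} = insert p (insert q N)" "{i\<in>I. b2 i < 0} = insert p N"
      using W b pq True by (auto simp: N_def upd)
    thus ?thesis unfolding leading_sum_def T_def[symmetric] D_def[symmetric] using N pq Tq by simp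
  next
    case False
    have "{i\<in>I. b1 i < 0} = insert p N" "{i\<in>I. b2 i < 0} = N"
      using W b pq False by (auto simp: N_def upd)
    thus ?thesis unfolding leading_sum_def T_def[symmetric] D_def[symmetric] using N pq by simp
  qed
  also have "\<dots> = leading_sum I b E"
    using TW by (simp add: L Tp sum.distrib[symmetric] N_def)
  finally show ?thesis by (simp add: upd)
qed

text \<open>Without positive weights every pole is counted, and the residues of a rational function
  that decays at least like \<open>x^(-2)\<close> add up to 0; two nonzero weights give this decay.
  In terms of the slopes \<open>r i = E i / b i\<close> it is the vanishing of a divided difference
  of a constant.\<close>

lemma leading_sum_nonpos:
  assumes I: "finite I" and b: "\<And>i. i \<in> I \<Longrightarrow> b i \<le> 0" and two: "card {i\<in>I. b i \<noteq> 0} \<ge> 2"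
    and gen: "generic_slopes I b E"
  shows "leading_sum I b E = 0"
proof -
  define J where "J = {i\<in>I. b i \<noteq> 0}"
  define Z where "Z = {i\<in>I. b i = 0}"
  define r where "r i = E i / of_int (b i)" for i
  have J: "finite J" and Z: "finite Z" and IJZ: "I = J \<union> Z" "J \<inter> Z = {}"
    using I by (auto simp: J_def Z_def)
  have cI: "card I = card J + card Z" unfolding IJZ(1) using J Z IJZ(2) by (rule card_Un_disjoint)
  have cJ: "card J \<ge> 2" using two by (simp add: J_def)
  have inj: "inj_on r J"
  proof (rule inj_onI, rule ccontr)
    fix i j assume ij: "i \<in> J" "j \<in> J" "r i = r j" "i \<noteq> j"
    hence "of_int (b i) * E j - of_int (b j) * E i = 0"
      by (simp add: r_def J_def field_simps)
    thus False using generic_slopesD[OF gen, of i j] ij by (auto simp: J_def)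
  qed
  \<comment> \<open>Free of i: the denominator supplies \<open>b i\<close> to the power
    \<open>card I - 1\<close>, one more than the numerator, and the surplus factor completes the
    product of the \<open>b j\<close> over J. The sign comes from
    \<open>b i * E j - b j * E i = - b i * b j * (r i - r j)\<close>.\<close>
  define C where "C = - ((- 1) ^ (card J - 1)) / ((\<Prod>j\<in>Z. E j) * (\<Prod>j\<in>J. real_of_int (b j)))"
  have EZ: "E j \<noteq> 0" if "j \<in> Z" for j
  proof -
    obtain i where "i \<in> J" using cJ J by (metis card.empty equals0I not_numeral_le_zero)
    hence "of_int (b i) * E j - of_int (b j) * E i \<noteq> 0"
      using that by (intro generic_slopesD[OF gen]) (auto simp: J_def Z_def)
    thus ?thesis using that by (auto simp: Z_def)
  qed
  have term_eq: "- (real_of_int (b i) ^ (card I - 2)) / (\<Prod>j\<in>I - {i}. of_int (b i) * E j - of_int (b j) * E i) =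
    C * (1 / (\<Prod>j\<in>J - {i}. r i - r j))" if i: "i \<in> J" for i
  proof -
    have bi: "real_of_int (b i) \<noteq> 0" using i by (simp add: J_def)
    have "I - {i} = Z \<union> (J - {i})" using IJZ i by auto
    hence "(\<Prod>j\<in>I - {i}. of_int (b i) * E j - of_int (b j) * E i) =
      (\<Prod>j\<in>Z. of_int (b i) * E j - of_int (b j) * E i) *
      (\<Prod>j\<in>J - {i}. of_int (b i) * E j - of_int (b j) * E i)"
      using J Z IJZ(2) by (simp only:) (rule prod.union_disjoint; auto)
    also have "(\<Prod>j\<in>Z. of_int (b i) * E j - of_int (b j) * E i) = (\<Prod>j\<in>Z. of_int (b i) * E j)"
      by (rule prod.cong) (auto simp: Z_def)
    also have "\<dots> = of_int (b i) ^ card Z * (\<Prod>j\<in>Z. E j)" by (simp add: prod.distrib)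
    also have "(\<Prod>j\<in>J - {i}. of_int (b i) * E j - of_int (b j) * E i) =
      (\<Prod>j\<in>J - {i}. of_int (b i) * ((-1) * (of_int (b j) * (r i - r j))))"
      by (rule prod.cong) (use i in \<open>auto simp: J_def r_def field_simps\<close>)
    also have "\<dots> = of_int (b i) ^ (card J - 1) * ((-1) ^ (card J - 1) *
        ((\<Prod>j\<in>J - {i}. of_int (b j)) * (\<Prod>j\<in>J - {i}. r i - r j)))"
      using i J by (simp only: prod.distrib prod_constant card_Diff_singleton)
    finally have *: "(\<Prod>j\<in>I - {i}. of_int (b i) * E j - of_int (b j) * E i) =
      of_int (b i) ^ card Z * (\<Prod>j\<in>Z. E j) * (of_int (b i) ^ (card J - 1) * ((-1) ^ (card J - 1) *
        ((\<Prod>j\<in>J - {i}. of_int (b j)) * (\<Prod>j\<in>J - {i}. r i - r j))))" .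
    have pJ: "(\<Prod>j\<in>J. real_of_int (b j)) = of_int (b i) * (\<Prod>j\<in>J - {i}. of_int (b j))"
      using J i by (rule prod.remove)
    have "Suc (card I - 2) = card Z + (card J - 1)" using cI cJ by simp
    hence pw: "real_of_int (b i) * of_int (b i) ^ (card I - 2) = of_int (b i) ^ card Z * of_int (b i) ^ (card J - 1)"
      by (metis power_Suc power_add)
    have nz: "(\<Prod>j\<in>J - {i}. real_of_int (b j)) \<noteq> 0" "(\<Prod>j\<in>Z. E j) \<noteq> 0"
      "(\<Prod>j\<in>J - {i}. r i - r j) \<noteq> 0"
      using J Z EZ inj i by (auto simp: prod_zero_iff J_def inj_on_def)
    have sgn: "(- 1 :: real) ^ (card J - 1) * (- 1) ^ (card J - 1) = 1"
      by (simp flip: power_mult_distrib)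
    show ?thesis unfolding * C_def pJ using nz bi pw sgn
      by (simp add: field_simps)
  qed
  have "{i\<in>I. b i < 0} = J" using b by (force simp: J_def)
  hence "leading_sum I b E = (\<Sum>i\<in>J. C * (1 / (\<Prod>j\<in>J - {i}. r i - r j)))"
    unfolding leading_sum_def using term_eq by simp
  also have "\<dots> = 0" unfolding sum_distrib_left[symmetric] using sum_inverse_prod_diff[OF J inj cJ] by simp
  finally show ?thesis .
qed

text \<open>Independence of the polynomials and not of their values: at 0 they will take natural
  numbers as values, and two of these are always dependent.\<close>

definition int_independent :: "nat set \<Rightarrow> (nat \<Rightarrow> real poly) \<Rightarrow> bool" where
  "int_independent I E \<longleftrightarrow> (\<forall>c :: nat \<Rightarrow> int.
     (\<Sum>i\<in>I. Polynomial.smult (of_int (c i)) (E i)) = 0 \<longrightarrow> (\<forall>i\<in>I. c i = 0))"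

lemma int_independent_merge:
  assumes I: "finite I" "p \<in> I" "q \<in> I" "p \<noteq> q" and ind: "int_independent I E"
  shows "int_independent I (E(q := E p + E q))"
  unfolding int_independent_def
proof (intro allI impI)
  fix c :: "nat \<Rightarrow> int"
  define c' where "c' = c(p := c p + c q)"
  define W where "W = I - {p, q}"
  have W: "finite W" "p \<notin> W" "q \<notin> W" "I = insert p (insert q W)" using I by (auto simp: W_def)
  have eq: "(\<Sum>i\<in>W. Polynomial.smult (of_int (c i)) ((E(q := E p + E q)) i)) =
    (\<Sum>i\<in>W. Polynomial.smult (of_int (c' i)) (E i))"
    by (rule sum.cong) (use W in \<open>auto simp: c'_def\<close>)
  assume "(\<Sum>i\<in>I. Polynomial.smult (of_int (c i)) ((E(q := E p + E q)) i)) = 0"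
  hence "(\<Sum>i\<in>I. Polynomial.smult (of_int (c' i)) (E i)) = 0"
    using I(4) W(1-3) eq unfolding W(4)
    by (simp add: c'_def smult_add_right smult_add_left algebra_simps)
  hence z: "\<forall>i\<in>I. c' i = 0" using ind unfolding int_independent_def by blast
  have "c q = 0" using bspec[OF z I(3)] I(4) by (simp add: c'_def)
  moreover have "c p + c q = 0" using bspec[OF z I(2)] by (simp add: c'_def)
  ultimately show "\<forall>i\<in>I. c i = 0" using z by (auto simp: c'_def split: if_splits)
qed

text \<open>Each condition concerns a nontrivial integer combination of two of the polynomials,
  hence a nonzero polynomial with finitely many roots.\<close>

lemma eventually_generic_slopes:
  assumes I: "finite I" and ind: "int_independent I E"
  shows "eventually (\<lambda>x. generic_slopes I b (\<lambda>i. poly (E i) x)) (at 0)"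
proof -
  have "eventually (\<lambda>x. of_int (b i) * poly (E j) x - of_int (b j) * poly (E i) x \<noteq> 0) (at 0)"
    if ij: "i \<in> I" "j \<in> I" "i \<noteq> j" "b i \<noteq> 0" for i j
  proof -
    define P where "P = Polynomial.smult (of_int (b i)) (E j) - Polynomial.smult (of_int (b j)) (E i)"
    have "P \<noteq> 0"
    proof
      assume "P = 0"
      define c where "c = (\<lambda>k. if k = j then b i else if k = i then - b j else 0)"
      have "(\<Sum>k\<in>I. Polynomial.smult (of_int (c k)) (E k)) = (\<Sum>k\<in>{i,j}. Polynomial.smult (of_int (c k)) (E k))"
        by (rule sum.mono_neutral_right) (use I ij in \<open>auto simp: c_def\<close>)
      also have "\<dots> = P" using ij by (simp add: c_def P_def)
      finally have "c j = 0" using \<open>P = 0\<close> ij ind unfolding int_independent_def by blast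
      thus False using ij by (simp add: c_def)
    qed
    hence "finite {x. poly P x = 0}" by (rule poly_roots_finite)
    hence "eventually (\<lambda>x. poly P x \<noteq> 0) (at 0)"
      using islimpt_finite[of "{x. poly P x = 0}" 0] by (simp add: islimpt_iff_eventually)
    thus ?thesis by (simp add: P_def)
  qed
  thus ?thesis unfolding generic_slopes_def using I
    by (intro eventually_ball_finite ballI) (auto simp: eventually_conj_iff)
qed

lemma Gcd_merge:
  fixes b :: "nat \<Rightarrow> int"
  assumes "p \<in> I" "q \<in> I" "p \<noteq> q" and gcd: "Gcd (b ` I) = 1"
  shows "Gcd ((b(q := b p + b q)) ` I) = 1"
proof -
  let ?g = "Gcd ((b(q := b p + b q)) ` I)"
  have *: "?g dvd (b(q := b p + b q)) i" if "i \<in> I" for i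
    by (rule Gcd_dvd) (use that in blast)
  have p: "?g dvd b p" using *[OF assms(1)] assms(3) by simp
  have "?g dvd b p + b q" using *[OF assms(2)] by simp
  hence q: "?g dvd b q" using p by (simp add: dvd_add_right_iff)
  have "?g dvd b i" if "i \<in> I" for i
    using *[OF that] q by (cases "i = q") auto
  hence "?g dvd Gcd (b ` I)" by (intro Gcd_greatest) auto
  thus ?thesis using gcd by simp
qed

text \<open>The pole coefficient and the limit of the sum obey the same recursion. Two nonzero
  weights are kept throughout so that systems of one sign, where the recursion ends, give 0 on both
  sides.\<close>

lemma pole_limit_leading_sum:
  assumes "finite I" "\<And>i. i \<in> I \<Longrightarrow> e i > 0" "\<And>i. i \<in> I \<Longrightarrow> poly (E i) 0 = real (e i)"
    "int_independent I E" "card {i\<in>I. b i \<noteq> 0} \<ge> 2" "Gcd (b ` I) = 1"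
  shows "\<exists>g\<ge>0. pole_limit (solution_series I b e) (card I - 1) (of_real g) \<and>
    ((\<lambda>x. leading_sum I b (\<lambda>i. poly (E i) x)) \<longlongrightarrow> g) (at 0) \<and>
    ((\<exists>i\<in>I. b i < 0) \<and> (\<exists>i\<in>I. b i > 0) \<longrightarrow> g > 0)"
  using assms
proof (induction I b arbitrary: e E rule: elliott_induct)
  case (nonneg I b)
  have "card {i \<in> I. b i = 0} + card {i \<in> I. b i \<noteq> 0} = card I"
    using nonneg(1) by (subst card_Un_disjoint[symmetric]) (auto intro: arg_cong[of _ _ card])
  hence c: "card {i \<in> I. b i = 0} < card I - 1" using nonneg by linarith
  have "{i \<in> I. b i < 0} = {}" using nonneg by force
  hence "leading_sum I b E' = 0" for E' by (simp only: leading_sum_def sum.empty)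
  moreover have "pole_limit (solution_series I b e) (card I - 1) 0"
    using nonneg c by (intro pole_limit_same_sign) auto
  ultimately show ?case using nonneg(2) by (intro exI[of _ 0]) (auto simp: not_less)
next
  case (nonpos I b)
  have "card {i \<in> I. b i = 0} + card {i \<in> I. b i \<noteq> 0} = card I"
    using nonpos(1) by (subst card_Un_disjoint[symmetric]) (auto intro: arg_cong[of _ _ card])
  hence c: "card {i \<in> I. b i = 0} < card I - 1" using nonpos by linarith
  have "eventually (\<lambda>x. 0 = leading_sum I b (\<lambda>i. poly (E i) x)) (at 0)"
    using eventually_generic_slopes[OF nonpos(1,5), of b]
    by eventually_elim (use nonpos leading_sum_nonpos in auto)
  hence "((\<lambda>x. leading_sum I b (\<lambda>i. poly (E i) x)) \<longlongrightarrow> 0) (at 0)"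
    by (rule Lim_transform_eventually[OF tendsto_const])
  moreover have "pole_limit (solution_series I b e) (card I - 1) 0"
    using nonpos c by (intro pole_limit_same_sign) auto
  ultimately show ?case using nonpos(2) by (intro exI[of _ 0]) (auto simp: not_less)
next
  case (step I b p q)
  note e = step.prems(1) and E = step.prems(2) and ind = step.prems(3)
    and two = step.prems(4) and gcd = step.prems(5)
  note I = step.hyps(1-3) and b = step.hyps(4,5)
  define W where "W = I - {p, q}"
  have pq: "p \<noteq> q" using b by auto
  have W: "finite W" "p \<notin> W" "q \<notin> W" "I = insert p (insert q W)" using I by (auto simp: W_def)
  have cI: "card I = card W + 2" using W pq by simp
  define b1 e1 E1 where "b1 = b(q := b p + b q)" "e1 = e(q := e p + e q)" "E1 = E(q := E p + E q)"
  define b2 e2 E2 where "b2 = b(p := b p + b q)" "e2 = e(p := e p + e q)" "E2 = E(p := E p + E q)"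
  note upd = b1_e1_E1_def b2_e2_E2_def
  have ell: "solution_series I b e = solution_series I b1 e1 + solution_series I b2 e2 -
      solution_series (I - {q}) b2 e2"
    unfolding upd by (rule solution_series_elliott) (use I pq e in auto)
  have e12: "e1 i > 0" "e2 i > 0" if "i \<in> I" for i using e[OF that] e[OF I(2)] e[OF I(3)] by (auto simp: upd)
  have E12: "poly (E1 i) 0 = real (e1 i)" "poly (E2 i) 0 = real (e2 i)" if "i \<in> I" for i
    using E[OF that] E[OF I(2)] E[OF I(3)] by (auto simp: upd)
  have ind1: "int_independent I E1" unfolding upd by (rule int_independent_merge[OF I pq ind])
  have ind2: "int_independent I E2"
    using int_independent_merge[OF I(1,3,2) pq[symmetric] ind] unfolding upd by (simp add: add.commute)
  have gcd1: "Gcd (b1 ` I) = 1" unfolding upd by (rule Gcd_merge[OF I(2,3) pq gcd])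
  have gcd2: "Gcd (b2 ` I) = 1"
    using Gcd_merge[OF I(3,2) pq[symmetric] gcd] unfolding upd by (simp add: add.commute)
  show ?case
  \<comment> \<open>In the first case each merged system keeps a single nonzero weight, outside the
    reach of the induction hypothesis, and the coefficient is computed directly. There
    \<open>b p\<close> divides all weights, so the gcd leaves only -1 and 1.\<close>
  proof (cases "b p + b q = 0 \<and> (\<forall>i\<in>W. b i = 0)")
    case True
    have bp: "b p = - 1"
    proof -
      have "b p dvd b i" if "i \<in> I" for i using that True W(4) by (auto simp: eq_neg_iff_add_eq_0[symmetric])
      hence "b p dvd Gcd (b ` I)" by (intro Gcd_greatest) auto
      thus ?thesis using gcd b by simp
    qed
    hence bq: "b q = 1" using True by simp
    define P where "P = (\<Prod>i\<in>W. 1 / real (e i))"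
    \<comment> \<open>The solutions are freely generated by the product of the variables p and q, of
      degree \<open>e p + e q\<close>, and by the variables in W; g is the product of the reciprocal
      degrees.\<close>
    define g where "g = 1 / real (e p + e q) * P"
    have prods: "(\<Prod>i\<in>I - {p}. 1 / of_nat (e1 i)) = complex_of_real g"
      "(\<Prod>i\<in>I - {q}. 1 / of_nat (e2 i)) = complex_of_real g"
    proof -
      have "(\<Prod>i\<in>W. 1 / complex_of_nat (e1 i)) = of_real P" "(\<Prod>i\<in>W. 1 / complex_of_nat (e2 i)) = of_real P"
        unfolding P_def of_real_prod by (rule prod.cong; use W in \<open>auto simp: upd\<close>)+
      moreover have "I - {p} = insert q W" "I - {q} = insert p W" using W pq by auto
      ultimately show "(\<Prod>i\<in>I - {p}. 1 / of_nat (e1 i)) = complex_of_real g"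
        "(\<Prod>i\<in>I - {q}. 1 / of_nat (e2 i)) = complex_of_real g"
        using W by (simp_all add: g_def upd)
    qed
    have cp: "card (I - {p}) = card I - 1" "card (I - {q}) = card I - 1" using I by simp_all
    have supp: "{i\<in>I. b1 i = 0} = I - {p}" "{i\<in>I. b2 i = 0} = I - {q}"
      using True W b pq by (auto simp: upd)
    have "solution_series I b1 e1 = solution_series (I - {p}) b1 e1"
      unfolding supp(1)[symmetric] by (rule solution_series_support) (use I True W b pq in \<open>auto simp: upd\<close>)
    moreover have "pole_limit (solution_series (I - {p}) b1 e1) (card I - 1) (of_real g)"
      unfolding prods(1)[symmetric] cp(1)[symmetric]
      by (rule pole_limit_zero_weights) (use I supp e12 in auto)
    ultimately have 1: "pole_limit (solution_series I b1 e1) (card I - 1) (of_real g)" by simp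
    \<comment> \<open>So the second and third term of the elimination cancel, and the first
      remains.\<close>
    have "solution_series I b2 e2 = solution_series (I - {q}) b2 e2"
      unfolding supp(2)[symmetric] by (rule solution_series_support) (use I True W b pq in \<open>auto simp: upd\<close>)
    hence "pole_limit (solution_series I b e) (card I - 1) (of_real g)" using 1 unfolding ell by simp
    moreover have "((\<lambda>x. leading_sum I b (\<lambda>i. poly (E i) x)) \<longlongrightarrow> g) (at 0)"
    proof -
      have "{i\<in>I. b i < 0} = {p}" using True W b by auto
      moreover have "I - {p} = insert q W" using W pq by auto
      moreover have "(\<Prod>j\<in>W. of_int (b p) * poly (E j) x - of_int (b j) * poly (E p) x) =
          (- 1) ^ card W * (\<Prod>j\<in>W. poly (E j) x)" for x
        unfolding prod_constant[symmetric] prod.distrib[symmetric]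
        by (rule prod.cong) (use True bp in auto)
      ultimately have "leading_sum I b (\<lambda>i. poly (E i) x) =
          1 / ((poly (E p) x + poly (E q) x) * (\<Prod>j\<in>W. poly (E j) x))" for x
        unfolding leading_sum_def using W bp bq cI by (simp add: divide_simps)
      moreover have "((\<lambda>x. 1 / ((poly (E p) x + poly (E q) x) * (\<Prod>j\<in>W. poly (E j) x))) \<longlongrightarrow>
          1 / ((poly (E p) 0 + poly (E q) 0) * (\<Prod>j\<in>W. poly (E j) 0))) (at 0)"
      proof (intro tendsto_intros)
        show "(poly (E p) 0 + poly (E q) 0) * (\<Prod>j\<in>W. poly (E j) 0) \<noteq> 0"
          using e[OF I(2)] e E W by (auto simp: prod_zero_iff add_nonneg_eq_0_iff)
      qed
      moreover have "1 / ((poly (E p) 0 + poly (E q) 0) * (\<Prod>j\<in>W. poly (E j) 0)) = g"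
      proof -
        have "(\<Prod>j\<in>W. poly (E j) 0) = (\<Prod>j\<in>W. real (e j))" by (rule prod.cong) (use E W in auto)
        thus ?thesis using E[OF I(2)] E[OF I(3)] by (simp add: g_def P_def prod_dividef)
      qed
      ultimately show ?thesis by simp
    qed
    moreover have "g > 0" unfolding g_def P_def
      by (intro mult_pos_pos prod_pos divide_pos_pos) (use e[OF I(2)] e W in \<open>auto simp flip: of_nat_add\<close>)
    ultimately show ?thesis by (intro exI[of _ g]) auto
  next
    case False
    \<comment> \<open>The merged entry or some entry of W is nonzero; together with the one of p and
      q that keeps its weight it provides two nonzero weights.\<close>
    then obtain r where r: "r = q \<and> b p + b q \<noteq> 0 \<or> r \<in> W \<and> b r \<noteq> 0" by blast
    have "card {p, r} \<le> card {i\<in>I. b1 i \<noteq> 0}"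
      by (rule card_mono) (use r I W b pq in \<open>auto simp: upd\<close>)
    moreover have "p \<noteq> r" using r pq W by auto
    ultimately have two1: "card {i\<in>I. b1 i \<noteq> 0} \<ge> 2" by simp
    obtain r where r: "r = p \<and> b p + b q \<noteq> 0 \<or> r \<in> W \<and> b r \<noteq> 0" using False by blast
    have "card {q, r} \<le> card {i\<in>I. b2 i \<noteq> 0}"
      by (rule card_mono) (use r I W b pq in \<open>auto simp: upd\<close>)
    moreover have "q \<noteq> r" using r pq W by auto
    ultimately have two2: "card {i\<in>I. b2 i \<noteq> 0} \<ge> 2" by simp
    obtain g1 where g1: "g1 \<ge> 0" "pole_limit (solution_series I b1 e1) (card I - 1) (of_real g1)"
      "((\<lambda>x. leading_sum I b1 (\<lambda>i. poly (E1 i) x)) \<longlongrightarrow> g1) (at 0)"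
      "(\<exists>i\<in>I. b1 i < 0) \<and> (\<exists>i\<in>I. b1 i > 0) \<longrightarrow> g1 > 0"
      using step.IH(1)[folded upd, OF e12(1) E12(1) ind1 two1 gcd1] by blast
    obtain g2 where g2: "g2 \<ge> 0" "pole_limit (solution_series I b2 e2) (card I - 1) (of_real g2)"
      "((\<lambda>x. leading_sum I b2 (\<lambda>i. poly (E2 i) x)) \<longlongrightarrow> g2) (at 0)"
      "(\<exists>i\<in>I. b2 i < 0) \<and> (\<exists>i\<in>I. b2 i > 0) \<longrightarrow> g2 > 0"
      using step.IH(2)[folded upd, OF e12(2) E12(2) ind2 two2 gcd2] by blast
    have "pole_limit (solution_series (I - {q}) b2 e2) (card (I - {q})) 0"
    proof (rule pole_limit_card)
      show "\<exists>i\<in>I - {q}. b2 i \<noteq> 0" using False W pq by (auto simp: upd)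
    qed (use I e12 in auto)
    hence g3: "pole_limit (solution_series (I - {q}) b2 e2) (card I - 1) 0" using I by simp
    have "pole_limit (solution_series I b e) (card I - 1) (of_real (g1 + g2))"
      using pole_limit_diff[OF pole_limit_add[OF g1(2) g2(2)] g3] unfolding ell by simp
    moreover have "((\<lambda>x. leading_sum I b (\<lambda>i. poly (E i) x)) \<longlongrightarrow> g1 + g2) (at 0)"
    proof (rule Lim_transform_eventually[OF tendsto_add[OF g1(3) g2(3)]])
      show "eventually (\<lambda>x. leading_sum I b1 (\<lambda>i. poly (E1 i) x) + leading_sum I b2 (\<lambda>i. poly (E2 i) x) =
          leading_sum I b (\<lambda>i. poly (E i) x)) (at 0)"
        using eventually_generic_slopes[OF I(1) ind, of b] eventually_generic_slopes[OF I(1) ind1, of b1]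
      proof eventually_elim
        case (elim x)
        have E1x: "(\<lambda>i. poly (E1 i) x) = (\<lambda>i. poly (E i) x)(q := poly (E p) x + poly (E q) x)"
          and E2x: "(\<lambda>i. poly (E2 i) x) = (\<lambda>i. poly (E i) x)(p := poly (E p) x + poly (E q) x)"
          by (auto simp: upd)
        show ?case using leading_sum_merge[OF I b elim(1)] elim(2) unfolding E1x E2x unfolding upd by simp
      qed
    qed
    moreover have "g1 + g2 > 0"
    proof -
      \<comment> \<open>If \<open>b p + b q > 0\<close>, the first system has mixed signs since it
        keeps \<open>b p\<close>; if it is negative, the second does since it keeps
        \<open>b q\<close>. If it is 0, a nonzero weight in W is opposite in sign to one of these
        two.\<close>
      have "(\<exists>i\<in>I. b1 i < 0) \<and> (\<exists>i\<in>I. b1 i > 0) \<or> (\<exists>i\<in>I. b2 i < 0) \<and> (\<exists>i\<in>I. b2 i > 0)"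
      proof -
        have "b1 p < 0" "b2 q > 0" "b1 q = b p + b q" "b2 p = b p + b q" using b pq by (auto simp: upd)
        moreover have "b1 r = b r" "b2 r = b r" if "r \<in> W" for r using that W by (auto simp: upd)
        ultimately show ?thesis using False W(4) I(2,3) by (metis insertCI linorder_neqE_linordered_idom)
      qed
      thus ?thesis using g1(1,4) g2(1,4) by (metis add_nonneg_pos add_pos_nonneg)
    qed
    ultimately show ?thesis by (intro exI[of _ "g1 + g2"]) auto
  qed
qed

section \<open>The determinant of \<open>S\<^sub>u\<close>\<close>

definition ordered_pairs :: "nat set \<Rightarrow> (nat \<times> nat) set" where
  "ordered_pairs I = {(i, j). i \<in> I \<and> j \<in> I \<and> i < j}"

lemma finite_ordered_pairs: "finite I \<Longrightarrow> finite (ordered_pairs I)"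
  by (rule finite_subset[of _ "I \<times> I"]) (auto simp: ordered_pairs_def)

definition vandermonde_mat :: "nat \<Rightarrow> (nat \<Rightarrow> 'a) \<Rightarrow> 'a :: comm_ring_1 mat" where
  "vandermonde_mat N z = mat N N (\<lambda>(i, j). z (Suc j) ^ (N - Suc i))"

definition first_row_poly_mat :: "nat \<Rightarrow> 'a poly \<Rightarrow> (nat \<Rightarrow> 'a) \<Rightarrow> 'a :: comm_ring_1 mat" where
  "first_row_poly_mat N C z =
     mat N N (\<lambda>(i, j). if i = 0 then poly C (z (Suc j)) else z (Suc j) ^ (N - Suc i))"

text \<open>The rows below carry the powers \<open>N - 2, ..., 0\<close>, so row operations reduce C
  in the first row to its term of degree \<open>N - 1\<close>. These operations are collected in the
  triangular factor T.\<close>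

lemma det_first_row_poly_mat:
  fixes z :: "nat \<Rightarrow> 'a :: idom"
  assumes "degree C < N"
  shows "det (first_row_poly_mat N C z) = coeff C (N - 1) * det (vandermonde_mat N z)"
proof -
  define T where "T = mat N N (\<lambda>(i, j). if i = 0 then coeff C (N - Suc j) else if i = j then 1 else (0 :: 'a))"
  have T: "T \<in> carrier_mat N N" by (simp add: T_def)
  have V: "vandermonde_mat N z \<in> carrier_mat N N" by (simp add: vandermonde_mat_def)
  have "first_row_poly_mat N C z = T * vandermonde_mat N z"
  proof (rule eq_matI)
    fix i j assume "i < dim_row (T * vandermonde_mat N z)" "j < dim_col (T * vandermonde_mat N z)"
    hence ij: "i < N" "j < N" by (auto simp: T_def vandermonde_mat_def)
    have "(T * vandermonde_mat N z) $$ (i, j) =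
        (\<Sum>l<N. T $$ (i, l) * z (Suc j) ^ (N - Suc l))"
      using ij T V
      by (simp add: scalar_prod_def vandermonde_mat_def atLeast0LessThan)
    also have "\<dots> = first_row_poly_mat N C z $$ (i, j)"
    proof (cases "i = 0")
      case True
      have "(\<Sum>l<N. T $$ (i, l) * z (Suc j) ^ (N - Suc l)) =
          (\<Sum>l<N. coeff C (N - Suc l) * z (Suc j) ^ (N - Suc l))"
        by (rule sum.cong) (use True ij in \<open>auto simp: T_def\<close>)
      also have "\<dots> = (\<Sum>l<N. coeff C l * z (Suc j) ^ l)"
        by (rule sum.nat_diff_reindex)
      also have "\<dots> = poly C (z (Suc j))" unfolding poly_altdef
        by (rule sum.mono_neutral_right) (use assms in \<open>auto simp: coeff_eq_0\<close>)
      finally show ?thesis using True ij by (simp add: first_row_poly_mat_def)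
    next
      case False
      have "(\<Sum>l<N. T $$ (i, l) * z (Suc j) ^ (N - Suc l)) =
          (\<Sum>l<N. if l = i then z (Suc j) ^ (N - Suc i) else 0)"
        by (rule sum.cong) (use False ij in \<open>auto simp: T_def\<close>)
      thus ?thesis using False ij by (simp add: first_row_poly_mat_def)
    qed
    finally show "first_row_poly_mat N C z $$ (i, j) = (T * vandermonde_mat N z) $$ (i, j)" by simp
  qed (simp_all add: first_row_poly_mat_def T_def vandermonde_mat_def)
  moreover have "det T = coeff C (N - 1)"
  proof -
    have "det T = prod_list (diag_mat T)"
      by (rule det_upper_triangular[OF _ T]) (auto simp: T_def)
    also have "\<dots> = (\<Prod>i = 0..<N. T $$ (i, i))" using T by (simp add: prod_list_diag_prod)
    also have "\<dots> = (\<Prod>i = 0..<N. if i = 0 then coeff C (N - 1) else 1)"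
      by (rule prod.cong) (auto simp: T_def)
    also have "\<dots> = coeff C (N - 1)" using assms by simp
    finally show ?thesis .
  qed
  ultimately show ?thesis by (simp add: det_mult[OF T V])
qed

text \<open>A monic polynomial with roots at all nodes but the first may replace the first row
  without changing the determinant. It leaves a single nonzero entry, and expansion along that row
  gives the induction step.\<close>

lemma det_vandermonde_mat:
  fixes z :: "nat \<Rightarrow> 'a :: idom"
  shows "det (vandermonde_mat N z) = (\<Prod>(i, j)\<in>ordered_pairs {1..N}. z i - z j)"
proof (induction N arbitrary: z)
  case 0
  thus ?case by (simp add: vandermonde_mat_def ordered_pairs_def)
next
  case (Suc N)
  define C where "C = (\<Prod>j\<in>{2..Suc N}. [:- z j, 1:])"
  have C: "degree C = N" "coeff C N = 1"
    using degree_prod_linear[of "{2..Suc N}" z] by (simp_all add: C_def)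
  let ?M = "first_row_poly_mat (Suc N) C z"
  have M: "?M \<in> carrier_mat (Suc N) (Suc N)" by (simp add: first_row_poly_mat_def)
  have row: "?M $$ (0, j) = (if j = 0 then (\<Prod>j\<in>{2..Suc N}. z 1 - z j) else 0)" if "j < Suc N" for j
  proof -
    have "(\<Prod>l\<in>{2..Suc N}. z (Suc j) - z l) = 0" if "j \<noteq> 0"
      by (rule prod_zero) (use that \<open>j < Suc N\<close> in \<open>auto intro!: bexI[of _ "Suc j"]\<close>)
    thus ?thesis using that by (simp add: first_row_poly_mat_def C_def poly_prod del: prod.cl_ivl_Suc)
  qed
  have del: "mat_delete ?M 0 0 = vandermonde_mat N (\<lambda>i. z (Suc i))"
    by (rule eq_matI) (auto simp: mat_delete_def first_row_poly_mat_def vandermonde_mat_def)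
  have "det (vandermonde_mat (Suc N) z) = det ?M"
    using det_first_row_poly_mat[of C "Suc N" z] C by simp
  also have "\<dots> = (\<Sum>j<Suc N. ?M $$ (0, j) * cofactor ?M 0 j)"
    by (rule laplace_expansion_row[OF M]) simp
  also have "\<dots> = (\<Sum>j<Suc N. if j = 0 then (\<Prod>j\<in>{2..Suc N}. z 1 - z j) * cofactor ?M 0 0 else 0)"
    by (rule sum.cong) (use row in auto)
  also have "\<dots> = (\<Prod>j\<in>{2..Suc N}. z 1 - z j) * cofactor ?M 0 0" by simp
  also have "cofactor ?M 0 0 = (\<Prod>(i, j)\<in>ordered_pairs {1..N}. z (Suc i) - z (Suc j))"
    by (simp add: cofactor_def del Suc.IH)
  also have "\<dots> = (\<Prod>(i, j)\<in>ordered_pairs {2..Suc N}. z i - z j)"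
  proof -
    have "ordered_pairs {2..Suc N} = map_prod Suc Suc ` ordered_pairs {1..N}"
    proof (intro subset_antisym subsetI)
      fix x assume "x \<in> ordered_pairs {2..Suc N}"
      hence "x = map_prod Suc Suc (fst x - 1, snd x - 1)" "(fst x - 1, snd x - 1) \<in> ordered_pairs {1..N}"
        by (auto simp: ordered_pairs_def)
      thus "x \<in> map_prod Suc Suc ` ordered_pairs {1..N}" by blast
    qed (auto simp: ordered_pairs_def)
    thus ?thesis by (simp only:) (subst prod.reindex; auto simp: inj_on_def case_prod_unfold)
  qed
  also have "(\<Prod>j\<in>{2..Suc N}. z 1 - z j) = (\<Prod>(i, j)\<in>{1} \<times> {2..Suc N}. z i - z j)"
    by (simp flip: prod.cartesian_product)
  also have "\<dots> * (\<Prod>(i, j)\<in>ordered_pairs {2..Suc N}. z i - z j) =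
      (\<Prod>(i, j)\<in>{1} \<times> {2..Suc N} \<union> ordered_pairs {2..Suc N}. z i - z j)"
    by (rule prod.union_disjoint[symmetric]) (auto simp: finite_ordered_pairs, auto simp: ordered_pairs_def)
  also have "{1} \<times> {2..Suc N} \<union> ordered_pairs {2..Suc N} = ordered_pairs {1..Suc N}"
    by (auto simp: ordered_pairs_def)
  finally show ?case .
qed

lemma prod_ordered_pairs_split:
  fixes z :: "nat \<Rightarrow> 'a :: comm_ring_1"
  shows "(\<Prod>(i, j)\<in>ordered_pairs {1..k + m}. z i - z j) =
    (\<Prod>p=1..k. \<Prod>q=k+1..k+m. z p - z q) *
    ((\<Prod>(i, j)\<in>ordered_pairs {1..k}. z i - z j) * (\<Prod>(i, j)\<in>ordered_pairs {k+1..k+m}. z i - z j))"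
proof -
  have *: "ordered_pairs {1..k + m} =
      ({1..k} \<times> {k+1..k+m}) \<union> (ordered_pairs {1..k} \<union> ordered_pairs {k+1..k+m})"
    by (auto simp: ordered_pairs_def)
  have "(\<Prod>(i, j)\<in>ordered_pairs {1..k + m}. z i - z j) =
     (\<Prod>(i, j)\<in>{1..k} \<times> {k+1..k+m}. z i - z j) *
     ((\<Prod>(i, j)\<in>ordered_pairs {1..k}. z i - z j) * (\<Prod>(i, j)\<in>ordered_pairs {k+1..k+m}. z i - z j))"
    unfolding *
    by (subst prod.union_disjoint; (subst prod.union_disjoint)?)
      (auto simp: finite_ordered_pairs, auto simp: ordered_pairs_def)
  thus ?thesis by (simp flip: prod.cartesian_product)
qed

text \<open>Interpolation without division: for \<open>y \<in> Y\<close> the polynomial \<open>P(X) = \<Prod>(x\<^sub>p - X)\<close> satisfies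
  \<open>P(X) - P(y) = (X - y) Q(X)\<close>, and \<open>- Q(x\<^sub>p)\<close> serves as \<open>P(y) / (x\<^sub>p - y)\<close>.\<close>

lemma interpolation_common_denominator:
  fixes z :: "'i \<Rightarrow> 'a :: idom"
  assumes fin: "finite X" "finite Y" and X: "X \<noteq> {}"
  obtains C where "degree C < card X + card Y"
    "\<And>i. i \<in> X \<Longrightarrow> poly C (z i) = poly U (z i) * (\<Prod>p\<in>X. \<Prod>q\<in>Y. z p - z q)"
    "\<And>j. j \<in> Y \<Longrightarrow> poly C (z j) = 0"
proof -
  have "\<exists>Q. \<forall>i\<in>X. (z i - z y) * poly Q (z i) = (\<Prod>p\<in>X. z p - z y)" for y
  proof -
    define P where "P = (\<Prod>p\<in>X. [:z p, - 1:])"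
    have ev: "poly P t = (\<Prod>p\<in>X. z p - t)" for t by (simp add: P_def poly_prod)
    have "poly (P - [:poly P (z y):]) (z y) = 0" by simp
    then obtain Q where Q: "P - [:poly P (z y):] = [:- z y, 1:] * Q"
      unfolding poly_eq_0_iff_dvd by blast
    have "(z i - z y) * poly (- Q) (z i) = (\<Prod>p\<in>X. z p - z y)" if "i \<in> X" for i
    proof -
      have "poly P (z i) = 0" unfolding ev by (rule prod_zero) (use fin that in auto)
      thus ?thesis using arg_cong[OF Q, of "\<lambda>p. poly p (z i)"] ev[of "z y"] by (simp add: algebra_simps)
    qed
    thus ?thesis by blast
  qed
  then obtain Q where Q: "\<And>y i. i \<in> X \<Longrightarrow> (z i - z y) * poly (Q y) (z i) = (\<Prod>p\<in>X. z p - z y)"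
    by metis
  define M where "M = (\<Prod>p\<in>X. [:- z p, 1:])"
  have M: "degree M = card X" "coeff M (card X) = 1"
    unfolding M_def by (rule degree_prod_linear[OF fin(1)])+
  have "M \<noteq> 0" using M(2) by auto
  \<comment> \<open>M is monic, so pseudo-division is division with remainder. The remainder h keeps
    the values at the points of X and has degree below \<open>card X\<close>, which leaves room for
    the factor that vanishes on Y.\<close>
  obtain D h where Dh: "pseudo_divmod (U * (\<Prod>y\<in>Y. Q y)) M = (D, h)" by (metis surj_pair)
  have eq: "U * (\<Prod>y\<in>Y. Q y) = M * D + h" and h: "h = 0 \<or> degree h < card X"
    using pseudo_divmod[OF \<open>M \<noteq> 0\<close> Dh] M by simp_all
  define C where "C = (\<Prod>y\<in>Y. [:- z y, 1:]) * h"
  have deg: "degree C < card X + card Y"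
  proof (cases "h = 0")
    case True
    thus ?thesis using X fin by (simp add: C_def card_gt_0_iff)
  next
    case False
    thus ?thesis using h degree_mult_le[of "\<Prod>y\<in>Y. [:- z y, 1:]" h]
      degree_prod_linear(1)[OF fin(2), of z] by (simp add: C_def)
  qed
  have X_val: "poly C (z i) = poly U (z i) * (\<Prod>p\<in>X. \<Prod>q\<in>Y. z p - z q)" if i: "i \<in> X" for i
  proof -
    have "poly M (z i) = 0" unfolding M_def poly_prod by (rule prod_zero) (use fin i in auto)
    hence "poly h (z i) = poly U (z i) * (\<Prod>y\<in>Y. poly (Q y) (z i))"
      using arg_cong[OF eq, of "\<lambda>p. poly p (z i)"] by (simp add: poly_prod)
    hence "poly C (z i) = poly U (z i) * (\<Prod>y\<in>Y. (z i - z y) * poly (Q y) (z i))"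
      by (simp add: C_def poly_prod prod.distrib)
    also have "(\<Prod>y\<in>Y. (z i - z y) * poly (Q y) (z i)) = (\<Prod>y\<in>Y. \<Prod>p\<in>X. z p - z y)"
      using Q[OF i] by simp
    also have "\<dots> = (\<Prod>p\<in>X. \<Prod>q\<in>Y. z p - z q)" by (rule prod.swap)
    finally show ?thesis .
  qed
  have Y_val: "poly C (z j) = 0" if "j \<in> Y" for j
    unfolding C_def poly_mult poly_prod using that fin by (auto intro!: prod_zero)
  show ?thesis using that[OF deg X_val Y_val] by blast
qed

section \<open>Exactness of the division defining \<open>S_laurent\<close>\<close>

lemma vandermonde_eq: "vandermonde I = (\<Prod>(i, j)\<in>ordered_pairs I. var_pow i 1 - var_pow j 1)"
  by (simp add: vandermonde_def ordered_pairs_def)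

lemma var_pow_power: "var_pow i 1 ^ e = var_pow i (int e)"
  by (induction e) (simp_all add: var_pow_def mult_single single_add[symmetric] flip: single_one)

text \<open>The definite description has a meaning only if the division is exact, and Laurent
  polynomials allow no interpolation with quotients. Multiplying the first row by R, the product of
  all \<open>x_p - x_q\<close>, turns it into values of a polynomial C. The determinant becomes the
  top coefficient of C times the full Vandermonde product, and R cancels in the domain; the quotient
  is that coefficient.\<close>

lemma S_laurent_spec:
  assumes k: "k > 0"
  shows "S_laurent k m (int u) * (vandermonde {1..k} * vandermonde {k+1..k+m}) =
    det (S_matrix k m (int u))"
proof -
  let ?x = "\<lambda>i. var_pow i 1" and ?N = "k + m"
  define R where "R = (\<Prod>p=1..k. \<Prod>q=k+1..k+m. ?x p - ?x q)"
  obtain C where C: "degree C < ?N"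
    "\<And>i. i \<in> {1..k} \<Longrightarrow> poly C (?x i) = poly (monom 1 u) (?x i) * R"
    "\<And>j. j \<in> {k+1..k+m} \<Longrightarrow> poly C (?x j) = 0"
    using interpolation_common_denominator[of "{1..k}" "{k+1..k+m}" ?x "monom 1 u"] k
    unfolding R_def by auto
  have S: "S_matrix k m (int u) \<in> carrier_mat ?N ?N" by (simp add: S_matrix_def)
  have "multrow 0 R (S_matrix k m (int u)) = first_row_poly_mat ?N C ?x"
    using C(2,3)
    by (intro eq_matI)
      (auto simp: S_matrix_def first_row_poly_mat_def poly_monom var_pow_power of_nat_diff
        not_less mult.commute)
  hence "R * det (S_matrix k m (int u)) = coeff C (?N - 1) * det (vandermonde_mat ?N ?x)"
    using det_first_row_poly_mat[OF C(1)] det_multrow[OF _ S, of 0 R] k by simp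
  also have "det (vandermonde_mat ?N ?x) = R * (vandermonde {1..k} * vandermonde {k+1..k+m})"
    unfolding det_vandermonde_mat prod_ordered_pairs_split vandermonde_eq R_def ..
  finally have "R * det (S_matrix k m (int u)) =
      R * (coeff C (?N - 1) * (vandermonde {1..k} * vandermonde {k+1..k+m}))"
    by (simp only: mult_ac)
  moreover have "R \<noteq> 0"
  proof -
    have "det (vandermonde_mat ?N ?x) = vandermonde {1..?N}"
      unfolding det_vandermonde_mat vandermonde_eq ..
    thus ?thesis using vandermonde_nonzero[of "{1..?N}"]
      \<open>det (vandermonde_mat ?N ?x) = R * (vandermonde {1..k} * vandermonde {k+1..k+m})\<close> by auto
  qed
  ultimately have "coeff C (?N - 1) * (vandermonde {1..k} * vandermonde {k+1..k+m}) =
      det (S_matrix k m (int u))" by simp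
  from theI[of "\<lambda>f. f * (vandermonde {1..k} * vandermonde {k+1..k+m}) = det (S_matrix k m (int u))", OF this]
  show ?thesis unfolding S_laurent_def using S_laurent_unique \<open>_ = det (S_matrix k m (int u))\<close> by blast
qed

section \<open>Evaluation of Laurent polynomials\<close>

text \<open>Evaluation of Laurent polynomials, restriction of their variables and restriction of
  supports to a face are all of this form; multiplicativity of \<open>\<mu>\<close> makes them
  homomorphisms.\<close>

definition linear_extension :: "('c \<Rightarrow> 's) \<Rightarrow> ('m \<Rightarrow> 's) \<Rightarrow> ('m \<Rightarrow>\<^sub>0 'c :: zero) \<Rightarrow> 's :: comm_semiring_1" where
  "linear_extension c \<mu> f = (\<Sum>m\<in>Poly_Mapping.keys f. c (Poly_Mapping.lookup f m) * \<mu> m)"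

lemma poly_mapping_eq_sum_single:
  "f = (\<Sum>m\<in>Poly_Mapping.keys f. Poly_Mapping.single m (Poly_Mapping.lookup f m))"
  by (rule poly_mapping_eqI) (simp add: lookup_sum lookup_single when_def sum.delta in_keys_iff)

context
  fixes c :: "'c :: comm_semiring_1 \<Rightarrow> 's :: comm_ring_1" and \<mu> :: "'m :: comm_monoid_add \<Rightarrow> 's"
  assumes c0: "c 0 = 0" and c_add: "\<And>x y. c (x + y) = c x + c y"
    and c1: "c 1 = 1" and c_mult: "\<And>x y. c (x * y) = c x * c y"
begin

lemma linear_extension_add: "linear_extension c \<mu> (f + g) = linear_extension c \<mu> f + linear_extension c \<mu> g"
  unfolding linear_extension_def
  by (rule setsum_keys_plus_distrib) (simp_all add: c0 c_add algebra_simps)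

lemma linear_extension_zero: "linear_extension c \<mu> 0 = 0"
  by (simp add: linear_extension_def)

lemma linear_extension_single: "linear_extension c \<mu> (Poly_Mapping.single m x) = c x * \<mu> m"
  by (simp add: linear_extension_def c0)

lemma linear_extension_sum: "linear_extension c \<mu> (\<Sum>i\<in>A. f i) = (\<Sum>i\<in>A. linear_extension c \<mu> (f i))"
  by (induction A rule: infinite_finite_induct) (simp_all add: linear_extension_add linear_extension_zero)

lemma linear_extension_mult:
  assumes mult: "\<And>m m'. m \<in> Poly_Mapping.keys f \<Longrightarrow> m' \<in> Poly_Mapping.keys g \<Longrightarrow> \<mu> (m + m') = \<mu> m * \<mu> m'"
  shows "linear_extension c \<mu> (f * g) = linear_extension c \<mu> f * linear_extension c \<mu> g"
proof -
  let ?F = "Poly_Mapping.keys f" and ?G = "Poly_Mapping.keys g"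
  have "f * g = (\<Sum>m\<in>?F. \<Sum>m'\<in>?G. Poly_Mapping.single (m + m') (Poly_Mapping.lookup f m * Poly_Mapping.lookup g m'))"
    by (subst poly_mapping_eq_sum_single[of f], subst poly_mapping_eq_sum_single[of g])
      (simp add: sum_product mult_single)
  also have "linear_extension c \<mu> \<dots> =
      (\<Sum>m\<in>?F. \<Sum>m'\<in>?G. (c (Poly_Mapping.lookup f m) * \<mu> m) * (c (Poly_Mapping.lookup g m') * \<mu> m'))"
    unfolding linear_extension_sum linear_extension_single c_mult
    by (intro sum.cong refl) (simp add: mult mult_ac)
  also have "\<dots> = linear_extension c \<mu> f * linear_extension c \<mu> g"
    by (simp add: linear_extension_def sum_product)
  finally show ?thesis .
qed

end

text \<open>The substitution of 1 for every variable outside V. It detects which variables occur in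
  an element that is known only through its defining equation.\<close>

definition restrict_vars :: "nat set \<Rightarrow> claurent \<Rightarrow> claurent" where
  "restrict_vars V = linear_extension (Poly_Mapping.single 0)
     (\<lambda>m. Poly_Mapping.single (\<Sum>i\<in>V. Poly_Mapping.single i (Poly_Mapping.lookup m i)) 1)"

lemma comm_ring_hom_linear_extension:
  fixes c :: "complex \<Rightarrow> 's :: comm_ring_1" and \<mu> :: "'m :: comm_monoid_add \<Rightarrow> 's"
  assumes "c 0 = 0" "\<And>x y. c (x + y) = c x + c y" "c 1 = 1" "\<And>x y. c (x * y) = c x * c y"
    and "\<mu> 0 = 1" "\<And>m m'. \<mu> (m + m') = \<mu> m * \<mu> m'"
  shows "comm_ring_hom (linear_extension c \<mu>)"
proof (unfold_locales)
  note simps = linear_extension_add[of c, OF assms(1-4)]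
    linear_extension_zero[of c, OF assms(1-4)]
    linear_extension_mult[of c, OF assms(1-4) assms(6)]
  show "linear_extension c \<mu> (f + g) = linear_extension c \<mu> f + linear_extension c \<mu> g" for f g
    by (rule simps)
  show "linear_extension c \<mu> (f * g) = linear_extension c \<mu> f * linear_extension c \<mu> g" for f g
    by (rule simps)
  show "linear_extension c \<mu> 0 = 0" by (rule simps)
  show "linear_extension c \<mu> 1 = 1"
    using assms by (simp add: linear_extension_def)
qed

lemma comm_ring_hom_restrict_vars: "comm_ring_hom (restrict_vars V)"
  unfolding restrict_vars_def
  by (rule comm_ring_hom_linear_extension)
    (auto simp: single_add mult_single lookup_add sum.distrib simp flip: single_one)

text \<open>Values must be nonzero for exponents to add: since \<open>0 powi (- 1) = 0\<close>, a
  variable and its inverse would not multiply to 1 at 0.\<close>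

lemma comm_ring_hom_claurent_eval:
  assumes v: "\<And>i. v i \<noteq> 0"
  shows "comm_ring_hom (\<lambda>f. claurent_eval f v)"
proof -
  define \<mu> where "\<mu> m = (\<Prod>i\<in>Poly_Mapping.keys m. v i powi Poly_Mapping.lookup m i)"
    for m :: "nat \<Rightarrow>\<^sub>0 int"
  have sup: "\<mu> m = (\<Prod>i\<in>A. v i powi Poly_Mapping.lookup m i)" if "finite A" "Poly_Mapping.keys m \<subseteq> A" for m A
    unfolding \<mu>_def using that by (intro prod.mono_neutral_left) (auto simp: in_keys_iff)
  have add: "\<mu> (m + m') = \<mu> m * \<mu> m'" for m m'
  proof -
    let ?A = "Poly_Mapping.keys m \<union> Poly_Mapping.keys m'"
    have "\<mu> (m + m') = (\<Prod>i\<in>?A. v i powi Poly_Mapping.lookup (m + m') i)"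
      by (rule sup) (use Poly_Mapping.keys_add[of m m'] in auto)
    also have "\<dots> = (\<Prod>i\<in>?A. v i powi Poly_Mapping.lookup m i * v i powi Poly_Mapping.lookup m' i)"
      using v by (simp add: lookup_add power_int_add)
    also have "\<dots> = \<mu> m * \<mu> m'"
      unfolding prod.distrib by (subst (1 2) sup[of ?A]) auto
    finally show ?thesis .
  qed
  have "(\<lambda>f. claurent_eval f v) = linear_extension (\<lambda>x. x) \<mu>"
    by (rule ext) (simp add: claurent_eval_def linear_extension_def \<mu>_def)
  moreover have "comm_ring_hom (linear_extension (\<lambda>x. x) \<mu>)"
    by (rule comm_ring_hom_linear_extension) (auto simp: add, simp add: \<mu>_def)
  ultimately show ?thesis by simp
qed

lemma claurent_eval_var_pow: "claurent_eval (var_pow i e) v = v i powi e"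
  by (simp add: claurent_eval_def var_pow_def)

lemma restrict_vars_var_pow:
  assumes "finite V" "i \<in> V"
  shows "restrict_vars V (var_pow i e) = var_pow i e"
proof -
  have "(\<Sum>j\<in>V. Poly_Mapping.single j (Poly_Mapping.lookup (Poly_Mapping.single i e) j)) =
      (\<Sum>j\<in>V. if j = i then Poly_Mapping.single i e else 0)"
    by (rule sum.cong) (auto simp: lookup_single)
  also have "\<dots> = Poly_Mapping.single i e" using assms by simp
  finally show ?thesis unfolding restrict_vars_def var_pow_def
    by (subst linear_extension_single) (simp_all add: mult_single single_add)
qed

lemma keys_restrict_vars:
  assumes "m \<in> Poly_Mapping.keys (restrict_vars V f)"
  shows "Poly_Mapping.keys m \<subseteq> V"
proof -
  have "Poly_Mapping.keys (restrict_vars V f) \<subseteq> (\<Union>m\<in>Poly_Mapping.keys f.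
      Poly_Mapping.keys (Poly_Mapping.single 0 (Poly_Mapping.lookup f m) *
        Poly_Mapping.single (\<Sum>i\<in>V. Poly_Mapping.single i (Poly_Mapping.lookup m i)) (1 :: complex)))"
    unfolding restrict_vars_def linear_extension_def by (rule keys_sum)
  with assms obtain m' where "m = (\<Sum>i\<in>V. Poly_Mapping.single i (Poly_Mapping.lookup m' i))"
    by (auto simp: mult_single split: if_splits)
  moreover have "Poly_Mapping.keys (\<Sum>i\<in>V. Poly_Mapping.single i (Poly_Mapping.lookup m' i)) \<subseteq>
      (\<Union>i\<in>V. Poly_Mapping.keys (Poly_Mapping.single i (Poly_Mapping.lookup m' i)))"
    by (rule keys_sum)
  ultimately show ?thesis by (auto split: if_splits)
qed

text \<open>The determinant and the Vandermonde products involve the variables \<open>1..N\<close>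
  only, so the restricted quotient solves the same equation and uniqueness applies.\<close>

lemma S_laurent_restrict_vars:
  assumes "k > 0" and N: "N = k + m"
  shows "restrict_vars {1..N} (S_laurent k m (int u)) = S_laurent k m (int u)"
proof -
  interpret comm_ring_hom "restrict_vars {1..N}" by (rule comm_ring_hom_restrict_vars)
  have var: "restrict_vars {1..N} (var_pow i e) = var_pow i e" if "i \<in> {1..N}" for i e
    by (rule restrict_vars_var_pow) (use that in auto)
  have vd: "restrict_vars {1..N} (vandermonde I) = vandermonde I" if "I \<subseteq> {1..N}" for I
    unfolding vandermonde_eq hom_prod
  proof (intro prod.cong refl)
    fix ij assume "ij \<in> ordered_pairs I"
    then obtain i j where "ij = (i, j)" "i \<in> I" "j \<in> I" by (auto simp: ordered_pairs_def)
    hence "ij = (i, j)" "i \<in> {1..N}" "j \<in> {1..N}" using \<open>I \<subseteq> {1..N}\<close> by blast+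
    thus "restrict_vars {1..N} (case ij of (i, j) \<Rightarrow> var_pow i 1 - var_pow j 1) =
        (case ij of (i, j) \<Rightarrow> var_pow i 1 - var_pow j 1)"
      by (simp only: prod.case hom_minus var)
  qed
  have "map_mat (restrict_vars {1..N}) (S_matrix k m (int u)) = S_matrix k m (int u)"
  proof -
    have "restrict_vars {Suc 0..k + m} (var_pow (Suc j) e) = var_pow (Suc j) e" if "j < k + m" for j e
      using var[of "Suc j" e] that by (simp add: N)
    moreover have "restrict_vars {Suc 0..k + m} 0 = 0" using hom_zero by (simp add: N)
    ultimately show ?thesis by (intro eq_matI) (auto simp: S_matrix_def N)
  qed
  hence det: "restrict_vars {1..N} (det (S_matrix k m (int u))) = det (S_matrix k m (int u))"
    by (metis hom_det)
  note spec = S_laurent_spec[OF assms(1), of m u]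
  have vd': "restrict_vars {1..N} (vandermonde {1..k} * vandermonde {k+1..k+m}) =
      vandermonde {1..k} * vandermonde {k+1..k+m}"
  proof -
    have "restrict_vars {1..N} (vandermonde {1..k}) = vandermonde {1..k}" by (rule vd) (simp add: N)
    moreover have "restrict_vars {1..N} (vandermonde {k+1..k+m}) = vandermonde {k+1..k+m}"
      by (rule vd) (simp add: N)
    ultimately show ?thesis by (simp only: hom_mult)
  qed
  have "restrict_vars {1..N} (S_laurent k m (int u)) * (vandermonde {1..k} * vandermonde {k+1..k+m}) =
      det (S_matrix k m (int u))"
    using arg_cong[OF spec, of "restrict_vars {1..N}"] unfolding det vd' hom_mult[of "S_laurent _ _ _"] .
  thus ?thesis using spec by (rule S_laurent_unique)
qed

lemma keys_S_laurent:
  assumes "k > 0" "t \<in> Poly_Mapping.keys (S_laurent k m (int u))"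
  shows "Poly_Mapping.keys t \<subseteq> {1..k + m}"
  using keys_restrict_vars[of t "{1..k + m}" "S_laurent k m (int u)"] assms(2)
  unfolding S_laurent_restrict_vars[OF assms(1) refl] .

lemma claurent_eval_cong:
  assumes "\<And>m i. m \<in> Poly_Mapping.keys f \<Longrightarrow> i \<in> Poly_Mapping.keys m \<Longrightarrow> v i = w i"
  shows "claurent_eval f v = claurent_eval f w"
  unfolding claurent_eval_def using assms by (intro sum.cong arg_cong2[of _ _ _ _ "(*)"] prod.cong) auto

lemma tendsto_claurent_eval:
  assumes "\<And>m i. m \<in> Poly_Mapping.keys f \<Longrightarrow> i \<in> Poly_Mapping.keys m \<Longrightarrow>
    ((\<lambda>x. v x i) \<longlongrightarrow> w i) F \<and> w i \<noteq> 0"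
  shows "((\<lambda>x. claurent_eval f (v x)) \<longlongrightarrow> claurent_eval f w) F"
  unfolding claurent_eval_def using assms
  by (intro tendsto_sum tendsto_mult tendsto_const tendsto_prod tendsto_power_int) auto

text \<open>Let B interpolate \<open>z i ^ u\<close> on the first k nodes and 0 on the others. The
  first row then consists of values of B, so the quotient is the top coefficient of B, a divided
  difference, times the factors that the two partial Vandermonde products lack.\<close>

lemma claurent_eval_S_laurent:
  assumes k: "k > 0" and inj: "inj_on z {1..k + m}" and nz: "\<And>i. i \<in> {1..k + m} \<Longrightarrow> z i \<noteq> 0"
  shows "claurent_eval (S_laurent k m (int u)) z =
    (\<Prod>p=1..k. \<Prod>q=k+1..k+m. z p - z q) *
    (\<Sum>i=1..k. z i ^ u / (\<Prod>j\<in>{1..k + m} - {i}. z i - z j))"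
proof -
  define N where "N = k + m"
  \<comment> \<open>Indices outside \<open>{1..N}\<close> receive the value 1, as evaluation is a
    homomorphism only at points without zeros; the keys of \<open>S_laurent\<close> allow the return
    to z.\<close>
  define z' where "z' i = (if i \<in> {1..N} then z i else 1)" for i
  have z': "z' i \<noteq> 0" for i using nz by (simp add: z'_def N_def)
  have z'z: "z' i = z i" if "i \<in> {1..N}" for i using that by (simp add: z'_def)
  interpret comm_ring_hom "\<lambda>f. claurent_eval f z'" by (rule comm_ring_hom_claurent_eval[OF z'])
  define y where "y i = (if i \<le> k then z' i ^ u else 0)" for i
  define B where "B = lagrange_poly {1..N} z' y"
  have inj': "inj_on z' {1..N}" using inj_on_cong[of "{1..N}" z' z, OF z'z] inj unfolding N_def by blast
  have B: "degree B < N" "coeff B (N - 1) = (\<Sum>i\<in>{1..N}. y i / (\<Prod>j\<in>{1..N} - {i}. z' i - z' j))"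
    using degree_lagrange_poly[of "{1..N}" z' y] coeff_lagrange_poly[of "{1..N}" z' y] k
    by (simp_all add: B_def N_def)
  have eval_B: "poly B (z' i) = y i" if "i \<in> {1..N}" for i
    unfolding B_def by (rule lagrange_poly_eval[OF _ inj' that]) simp
  have "map_mat (\<lambda>f. claurent_eval f z') (S_matrix k m (int u)) = first_row_poly_mat N B z'"
  proof (rule eq_matI)
    fix i j assume "i < dim_row (first_row_poly_mat N B z')" "j < dim_col (first_row_poly_mat N B z')"
    hence ij: "i < N" "j < N" by (simp_all add: first_row_poly_mat_def)
    hence B_val: "poly B (z' (Suc j)) = y (Suc j)" by (intro eval_B) auto
    have exp: "int (k + m) - int (i + 1) = int (N - Suc i)" using ij by (simp add: N_def of_nat_diff)
    have pow: "claurent_eval (var_pow (Suc j) (int (N - Suc i))) z' = z' (Suc j) ^ (N - Suc i)"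
      by (simp only: claurent_eval_var_pow power_int_of_nat)
    have "map_mat (\<lambda>f. claurent_eval f z') (S_matrix k m (int u)) $$ (i, j) =
        claurent_eval (S_matrix k m (int u) $$ (i, j)) z'"
      using ij by (intro index_map_mat) (simp_all add: S_matrix_def N_def)
    also have "S_matrix k m (int u) $$ (i, j) = (if i = 0 then (if j < k then var_pow (Suc j) (int u) else 0)
        else var_pow (Suc j) (int (k + m) - int (i + 1)))"
      using ij unfolding N_def S_matrix_def by simp
    also have "claurent_eval \<dots> z' = first_row_poly_mat N B z' $$ (i, j)"
      unfolding exp using ij B_val hom_zero pow
      by (cases "i = 0"; cases "j < k")
        (simp_all add: first_row_poly_mat_def claurent_eval_var_pow y_def)
    finally show "map_mat (\<lambda>f. claurent_eval f z') (S_matrix k m (int u)) $$ (i, j) =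
        first_row_poly_mat N B z' $$ (i, j)" .
  qed (simp_all add: S_matrix_def first_row_poly_mat_def N_def)
  hence "claurent_eval (det (S_matrix k m (int u))) z' = det (first_row_poly_mat N B z')"
    by (metis hom_det)
  also have "\<dots> = coeff B (N - 1) * (\<Prod>(i, j)\<in>ordered_pairs {1..N}. z' i - z' j)"
    by (simp add: det_first_row_poly_mat[OF B(1)] det_vandermonde_mat)
  also have "\<dots> = coeff B (N - 1) * ((\<Prod>p=1..k. \<Prod>q=k+1..k+m. z' p - z' q) *
    ((\<Prod>(i, j)\<in>ordered_pairs {1..k}. z' i - z' j) * (\<Prod>(i, j)\<in>ordered_pairs {k+1..k+m}. z' i - z' j)))"
    unfolding N_def prod_ordered_pairs_split ..
  finally have det: "claurent_eval (det (S_matrix k m (int u))) z' = \<dots>" .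
  have vd: "claurent_eval (vandermonde I) z' = (\<Prod>(i, j)\<in>ordered_pairs I. z' i - z' j)" for I
    unfolding vandermonde_eq hom_prod
    by (rule prod.cong) (auto simp: hom_minus claurent_eval_var_pow)
  have nz_vd: "(\<Prod>(i, j)\<in>ordered_pairs I. z' i - z' j) \<noteq> 0" if "I \<subseteq> {1..N}" for I
  proof -
    have "finite (ordered_pairs I)" using that finite_subset by (blast intro: finite_ordered_pairs)
    moreover have "z' i - z' j \<noteq> 0" if "(i, j) \<in> ordered_pairs I" for i j
      using inj_onD[OF inj_on_subset[OF inj' \<open>I \<subseteq> {1..N}\<close>], of i j] that by (auto simp: ordered_pairs_def)
    ultimately show ?thesis by (auto simp: prod_zero_iff)
  qed
  have "claurent_eval (S_laurent k m (int u) * (vandermonde {1..k} * vandermonde {k+1..k+m})) z' =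
      claurent_eval (det (S_matrix k m (int u))) z'"
    using S_laurent_spec[of k m u] k by simp
  hence "claurent_eval (S_laurent k m (int u)) z' *
      ((\<Prod>(i, j)\<in>ordered_pairs {1..k}. z' i - z' j) * (\<Prod>(i, j)\<in>ordered_pairs {k+1..k+m}. z' i - z' j)) =
      (coeff B (N - 1) * (\<Prod>p=1..k. \<Prod>q=k+1..k+m. z' p - z' q)) *
      ((\<Prod>(i, j)\<in>ordered_pairs {1..k}. z' i - z' j) * (\<Prod>(i, j)\<in>ordered_pairs {k+1..k+m}. z' i - z' j))"
    unfolding det hom_mult vd by (simp only: mult_ac)
  hence "claurent_eval (S_laurent k m (int u)) z' =
      coeff B (N - 1) * (\<Prod>p=1..k. \<Prod>q=k+1..k+m. z' p - z' q)"
    using nz_vd[of "{1..k}"] nz_vd[of "{k+1..k+m}"] by (simp add: N_def)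
  also have "claurent_eval (S_laurent k m (int u)) z' = claurent_eval (S_laurent k m (int u)) z"
    using keys_S_laurent[OF k] by (intro claurent_eval_cong z'z) (auto simp: N_def subset_iff)
  also have "(\<Prod>p=1..k. \<Prod>q=k+1..k+m. z' p - z' q) = (\<Prod>p=1..k. \<Prod>q=k+1..k+m. z p - z q)"
    by (intro prod.cong refl) (simp add: z'z N_def)
  also have "coeff B (N - 1) = (\<Sum>i\<in>{1..k}. y i / (\<Prod>j\<in>{1..N} - {i}. z' i - z' j))"
    unfolding B(2) by (rule sum.mono_neutral_right) (auto simp: N_def y_def)
  also have "\<dots> = (\<Sum>i=1..k. z i ^ u / (\<Prod>j\<in>{1..k + m} - {i}. z i - z j))"
  proof (rule sum.cong[OF refl])
    fix i assume i: "i \<in> {1..k}"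
    have "(\<Prod>j\<in>{1..N} - {i}. z' i - z' j) = (\<Prod>j\<in>{1..N} - {i}. z i - z j)"
      by (rule prod.cong) (use i in \<open>auto simp: z'z N_def\<close>)
    thus "y i / (\<Prod>j\<in>{1..N} - {i}. z' i - z' j) = z i ^ u / (\<Prod>j\<in>{1..k + m} - {i}. z i - z j)"
      using i by (simp add: y_def z'z N_def)
  qed
  finally show ?thesis by (simp only: mult.commute)
qed

text \<open>With \<open>x i = a i / E i\<close> each factor is
  \<open>a i * E j - a j * E i = E i * E j * (x i - x j)\<close>. Of the \<open>n - 1\<close>
  factors \<open>E i\<close> the numerator absorbs \<open>n - 2\<close>, and the last one completes
  the product of all \<open>E j\<close>. A generic E keeps the \<open>x i\<close> distinct even when
  weights coincide, so that interpolation applies.\<close>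

lemma leading_sum_eq_S_laurent:
  fixes a :: "nat \<Rightarrow> int" and E :: "nat \<Rightarrow> real"
  assumes k: "0 < k" "k < n"
    and neg: "\<And>i. i \<in> {1..k} \<Longrightarrow> a i < 0" and pos: "\<And>i. i \<in> {k+1..n} \<Longrightarrow> a i > 0"
    and E: "\<And>i. i \<in> {1..n} \<Longrightarrow> E i \<noteq> 0" and gen: "generic_slopes {1..n} a E"
  defines "x \<equiv> \<lambda>i. complex_of_real (of_int (a i) / E i)"
  shows "of_real (leading_sum {1..n} a E) = - claurent_eval (S_laurent k (n - k) (int (n - 2))) x /
    ((\<Prod>i=1..n. of_real (E i)) * (\<Prod>p=1..k. \<Prod>q=k+1..n. x p - x q))"
proof -
  have a0: "a i \<noteq> 0" if "i \<in> {1..n}" for i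
    using neg[of i] pos[of i] that by (cases "i \<le> k") auto
  have nz: "x i \<noteq> 0" if "i \<in> {1..n}" for i using E[OF that] a0[OF that] by (simp add: x_def)
  have inj: "inj_on x {1..n}"
  proof (rule inj_onI, rule ccontr)
    fix i j assume ij: "i \<in> {1..n}" "j \<in> {1..n}" "x i = x j" "i \<noteq> j"
    hence "of_int (a i) / E i = of_int (a j) / E j" unfolding x_def of_real_eq_iff by blast
    hence "of_int (a i) * E j - of_int (a j) * E i = 0"
      using E[OF ij(1)] E[OF ij(2)] by (simp add: field_simps)
    thus False using generic_slopesD[OF gen ij(1,2,4)] a0[OF ij(1)] by simp
  qed
  let ?R = "\<Prod>p=1..k. \<Prod>q=k+1..n. x p - x q" and ?P = "\<Prod>i=1..n. complex_of_real (E i)"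
  have R: "?R \<noteq> 0"
  proof -
    have "x p - x q \<noteq> 0" if "p \<in> {1..k}" "q \<in> {k+1..n}" for p q
      using inj_onD[OF inj, of p q] that k by auto
    thus ?thesis by (simp add: prod_zero_iff)
  qed
  have "{i \<in> {1..n}. a i < 0} = {1..k}"
  proof (intro subset_antisym subsetI)
    fix i assume i: "i \<in> {i \<in> {1..n}. a i < 0}"
    show "i \<in> {1..k}" using i pos[of i] by (cases "i \<le> k") auto
  qed (use neg k in auto)
  hence "of_real (leading_sum {1..n} a E) = (\<Sum>i=1..k. complex_of_real (- (of_int (a i) ^ (n - 2)) /
     (\<Prod>j\<in>{1..n} - {i}. of_int (a i) * E j - of_int (a j) * E i)))"
    unfolding leading_sum_def by simp
  also have "\<dots> = (\<Sum>i=1..k. - (1 / ?P) * (x i ^ (n - 2) / (\<Prod>j\<in>{1..n} - {i}. x i - x j)))"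
  proof (rule sum.cong[OF refl])
    fix i assume "i \<in> {1..k}"
    hence i: "i \<in> {1..n}" using k by auto
    have "complex_of_real (\<Prod>j\<in>{1..n} - {i}. of_int (a i) * E j - of_int (a j) * E i) =
        (\<Prod>j\<in>{1..n} - {i}. of_real (E i) * of_real (E j) * (x i - x j))"
      unfolding of_real_prod
      by (rule prod.cong) (use E[OF i] E in \<open>auto simp: x_def field_simps\<close>)
    also have "\<dots> = of_real (E i) ^ (n - 1) * (\<Prod>j\<in>{1..n} - {i}. of_real (E j)) * (\<Prod>j\<in>{1..n} - {i}. x i - x j)"
      using i by (simp add: prod.distrib)
    also have "complex_of_real (E i) ^ (n - 1) = of_real (E i) ^ (n - 2) * of_real (E i)"
      using k by (metis Suc_diff_Suc Suc_lessI diff_Suc_1 less_trans numeral_2_eq_2 power_Suc2 not_less_eq zero_less_diff One_nat_def)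
    also have "\<dots> * (\<Prod>j\<in>{1..n} - {i}. of_real (E j)) = of_real (E i) ^ (n - 2) * ?P"
      using prod.remove[of "{1..n}" i "\<lambda>i. complex_of_real (E i)"] i by (simp add: mult.assoc)
    finally have den: "complex_of_real (\<Prod>j\<in>{1..n} - {i}. of_int (a i) * E j - of_int (a j) * E i) =
        of_real (E i) ^ (n - 2) * ?P * (\<Prod>j\<in>{1..n} - {i}. x i - x j)" .
    have "complex_of_real (of_int (a i)) = x i * of_real (E i)" using E[OF i] by (simp add: x_def)
    hence num: "complex_of_real (- (of_int (a i) ^ (n - 2))) = - (x i ^ (n - 2) * of_real (E i) ^ (n - 2))"
      by (simp add: power_mult_distrib)
    show "complex_of_real (- (of_int (a i) ^ (n - 2)) /
        (\<Prod>j\<in>{1..n} - {i}. of_int (a i) * E j - of_int (a j) * E i)) =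
        - (1 / ?P) * (x i ^ (n - 2) / (\<Prod>j\<in>{1..n} - {i}. x i - x j))"
      unfolding of_real_divide num den using E[OF i] by simp
  qed
  also have "\<dots> = - (1 / ?P) * (\<Sum>i=1..k. x i ^ (n - 2) / (\<Prod>j\<in>{1..n} - {i}. x i - x j))"
    by (rule sum_distrib_left[symmetric])
  also have "(\<Sum>i=1..k. x i ^ (n - 2) / (\<Prod>j\<in>{1..n} - {i}. x i - x j)) =
      claurent_eval (S_laurent k (n - k) (int (n - 2))) x / ?R"
    using claurent_eval_S_laurent[of k x "n - k" "n - 2"] k inj nz R by simp
  finally show ?thesis by (simp add: mult.commute)
qed

section \<open>Invariant polynomials and the Hilbert series\<close>

definition weight :: "nat \<Rightarrow> (nat \<Rightarrow> int) \<Rightarrow> (nat \<Rightarrow>\<^sub>0 nat) \<Rightarrow> int" where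
  "weight n a m = (\<Sum>i=1..n. a i * int (Poly_Mapping.lookup m i))"

definition invariant_monomials :: "nat \<Rightarrow> (nat \<Rightarrow> int) \<Rightarrow> (nat \<Rightarrow>\<^sub>0 nat) set" where
  "invariant_monomials n a = {m. Poly_Mapping.keys m \<subseteq> {1..n} \<and> weight n a m = 0}"

lemma base_expansion_unique:
  fixes f g :: "nat \<Rightarrow> nat"
  assumes "\<And>i. i < N \<Longrightarrow> f i < B" "\<And>i. i < N \<Longrightarrow> g i < B"
    and "(\<Sum>i<N. f i * B ^ i) = (\<Sum>i<N. g i * B ^ i)" "i < N"
  shows "f i = g i"
  using assms
proof (induction N arbitrary: f g i)
  case (Suc N)
  have split: "(\<Sum>i<Suc N. h i * B ^ i) = h 0 + B * (\<Sum>i<N. h (Suc i) * B ^ i)" for h :: "nat \<Rightarrow> nat"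
    by (simp add: sum.lessThan_Suc_shift sum_distrib_left algebra_simps del: sum.lessThan_Suc)
  have eq: "f 0 + B * (\<Sum>i<N. f (Suc i) * B ^ i) = g 0 + B * (\<Sum>i<N. g (Suc i) * B ^ i)"
    using Suc.prems(3) unfolding split .
  have B: "f 0 < B" "g 0 < B" using Suc.prems(1,2) by auto
  have "f 0 = (f 0 + B * (\<Sum>i<N. f (Suc i) * B ^ i)) mod B" using B by simp
  also have "\<dots> = g 0" unfolding eq using B by simp
  finally have 0: "f 0 = g 0" .
  hence "(\<Sum>i<N. f (Suc i) * B ^ i) = (\<Sum>i<N. g (Suc i) * B ^ i)" using eq B by simp
  hence "f (Suc j) = g (Suc j)" if "j < N" for j
    by (intro Suc.IH[of "\<lambda>i. f (Suc i)" "\<lambda>i. g (Suc i)"]) (use Suc.prems that in auto)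
  thus ?case using 0 Suc.prems(4) by (cases i) auto
qed simp

text \<open>Kronecker substitution: \<open>z\<^sub>i = x^(B^i)\<close> separates monomials with exponents below \<open>B\<close>.\<close>

lemma poly_function_zero_imp_coeffs_zero:
  fixes S :: "(nat \<Rightarrow>\<^sub>0 nat) set" and c :: "(nat \<Rightarrow>\<^sub>0 nat) \<Rightarrow> complex"
  assumes S: "finite S" and zero: "\<And>z. (\<Sum>m\<in>S. c m * (\<Prod>i\<in>Poly_Mapping.keys m. z i ^ Poly_Mapping.lookup m i)) = 0"
    and m: "m \<in> S"
  shows "c m = 0"
proof -
  define V where "V = (\<Union>m\<in>S. Poly_Mapping.keys m)"
  have V: "finite V" using S by (simp add: V_def)
  define N where "N = Suc (Max (insert 0 V))"
  have N: "i < N" if "i \<in> V" for i using that V by (simp add: N_def less_Suc_eq_le)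
  define B where "B = Suc (\<Sum>m\<in>S. \<Sum>i<N. Poly_Mapping.lookup m i)"
  have B: "Poly_Mapping.lookup m i < B" if "m \<in> S" "i < N" for m i
  proof -
    have "Poly_Mapping.lookup m i \<le> (\<Sum>i<N. Poly_Mapping.lookup m i)"
      by (rule member_le_sum) (use that in auto)
    also have "\<dots> \<le> (\<Sum>m\<in>S. \<Sum>i<N. Poly_Mapping.lookup m i)"
      by (rule member_le_sum[of m S "\<lambda>m. \<Sum>i<N. Poly_Mapping.lookup m i"]) (use that S in auto)
    finally show ?thesis by (simp add: B_def)
  qed
  define \<phi> where "\<phi> m = (\<Sum>i<N. Poly_Mapping.lookup m i * B ^ i)" for m :: "nat \<Rightarrow>\<^sub>0 nat"
  have inj: "inj_on \<phi> S"
  proof (rule inj_onI, rule poly_mapping_eqI)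
    fix m m' i assume mm: "m \<in> S" "m' \<in> S" "\<phi> m = \<phi> m'"
    show "Poly_Mapping.lookup m i = Poly_Mapping.lookup m' i"
    proof (cases "i < N")
      case True
      thus ?thesis using base_expansion_unique[of N "Poly_Mapping.lookup m" B "Poly_Mapping.lookup m'" i]
        B mm by (simp add: \<phi>_def)
    next
      case False
      hence "i \<notin> V" using N by blast
      thus ?thesis using mm by (auto simp: V_def in_keys_iff)
    qed
  qed
  define p where "p = (\<Sum>m\<in>S. monom (c m) (\<phi> m))"
  have "poly p x = 0" for x
  proof -
    have "(\<Prod>i\<in>Poly_Mapping.keys m. (x ^ (B ^ i)) ^ Poly_Mapping.lookup m i) = x ^ \<phi> m" if "m \<in> S" for m
    proof -
      have "(\<Prod>i\<in>Poly_Mapping.keys m. (x ^ (B ^ i)) ^ Poly_Mapping.lookup m i) =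
          (\<Prod>i<N. (x ^ (B ^ i)) ^ Poly_Mapping.lookup m i)"
      proof (rule prod.mono_neutral_left)
        show "Poly_Mapping.keys m \<subseteq> {..<N}" using that N by (auto simp: V_def)
      qed (auto simp: in_keys_iff)
      thus ?thesis by (simp add: \<phi>_def power_sum mult.commute flip: power_mult)
    qed
    thus ?thesis using zero[of "\<lambda>i. x ^ (B ^ i)"] by (simp add: p_def poly_sum poly_monom)
  qed
  hence "p = 0" by (simp add: poly_all_0_iff_0[symmetric])
  hence "0 = coeff p (\<phi> m)" by simp
  also have "\<dots> = (\<Sum>m'\<in>S. if m' = m then c m else 0)"
    unfolding p_def coeff_sum by (rule sum.cong) (use inj m in \<open>auto simp: inj_on_def\<close>)
  also have "\<dots> = c m" using S m by simp
  finally show ?thesis by simp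
qed

text \<open>The action multiplies a monomial by \<open>w powi weight n a m\<close>, and monomials
  are independent as functions.\<close>

lemma invariants_eq:
  "invariants n a = {p. Poly_Mapping.keys p \<subseteq> invariant_monomials n a}"
proof -
  have act: "(\<Prod>i\<in>Poly_Mapping.keys m. torus_act a w z i ^ Poly_Mapping.lookup m i) =
      w powi weight n a m * (\<Prod>i\<in>Poly_Mapping.keys m. z i ^ Poly_Mapping.lookup m i)"
    if m: "Poly_Mapping.keys m \<subseteq> {1..n}" and w: "w \<noteq> 0" for m w z
  proof -
    have pw: "w powi (\<Sum>i\<in>A. f i) = (\<Prod>i\<in>A. w powi f i)" for A :: "nat set" and f
      by (induction A rule: infinite_finite_induct) (simp_all add: power_int_add w)
    have "weight n a m = (\<Sum>i\<in>Poly_Mapping.keys m. a i * int (Poly_Mapping.lookup m i))"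
      unfolding weight_def by (rule sum.mono_neutral_right) (use m in \<open>auto simp: in_keys_iff\<close>)
    thus ?thesis
      by (simp add: torus_act_def power_mult_distrib prod.distrib pw power_int_mult)
  qed
  show ?thesis
  proof (intro subset_antisym subsetI CollectI)
    fix p m assume p: "p \<in> invariants n a" and m: "m \<in> Poly_Mapping.keys p"
    have car: "Poly_Mapping.keys m \<subseteq> {1..n}" if "m \<in> Poly_Mapping.keys p" for m
      using p that by (auto simp: invariants_def poly_carrier_def)
    \<comment> \<open>The single torus element 2 is enough: it is not a root of unity, so only
      weight 0 is fixed by it.\<close>
    have "Poly_Mapping.lookup p m * (2 powi weight n a m - 1) = 0"
    proof (rule poly_function_zero_imp_coeffs_zero[of "Poly_Mapping.keys p"
          "\<lambda>m. Poly_Mapping.lookup p m * (2 powi weight n a m - 1)"])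
      fix z :: "nat \<Rightarrow> complex"
      have "cpoly_eval p (torus_act a 2 z) = cpoly_eval p z" using p by (simp add: invariants_def)
      thus "(\<Sum>m\<in>Poly_Mapping.keys p. Poly_Mapping.lookup p m * (2 powi weight n a m - 1) *
          (\<Prod>i\<in>Poly_Mapping.keys m. z i ^ Poly_Mapping.lookup m i)) = 0"
        unfolding cpoly_eval_def using act[OF car, of _ 2 z]
        by (simp add: algebra_simps sum_subtractf)
    qed (use m in auto)
    hence 1: "(2 :: complex) powi weight n a m = 1" using m by (simp add: in_keys_iff)
    have "weight n a m = 0"
    proof (rule ccontr)
      assume "weight n a m \<noteq> 0"
      moreover have "(2 :: real) powi weight n a m = 1"
        using arg_cong[OF 1, of norm] by (simp add: norm_power_int)
      ultimately show False
        using power_int_strict_increasing[of 0 "weight n a m" "2 :: real"]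
          power_int_strict_increasing[of "weight n a m" 0 "2 :: real"] by (cases "weight n a m" "0 :: int" rule: linorder_cases) auto
    qed
    thus "m \<in> invariant_monomials n a" using car[OF m] by (simp add: invariant_monomials_def)
  next
    fix p :: cpoly assume p: "p \<in> {p. Poly_Mapping.keys p \<subseteq> invariant_monomials n a}"
    have "cpoly_eval p (torus_act a w z) = cpoly_eval p z" if w: "w \<noteq> 0" for w z
      unfolding cpoly_eval_def
    proof (rule sum.cong[OF refl])
      fix m assume "m \<in> Poly_Mapping.keys p"
      hence "Poly_Mapping.keys m \<subseteq> {1..n}" "weight n a m = 0"
        using p by (auto simp: invariant_monomials_def)
      thus "Poly_Mapping.lookup p m * (\<Prod>i\<in>Poly_Mapping.keys m. torus_act a w z i ^ Poly_Mapping.lookup m i) =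
        Poly_Mapping.lookup p m * (\<Prod>i\<in>Poly_Mapping.keys m. z i ^ Poly_Mapping.lookup m i)"
        using act[of m w z] w by simp
    qed
    thus "p \<in> invariants n a"
      using p by (auto simp: invariants_def poly_carrier_def invariant_monomials_def)
  qed
qed

lemma homogeneous_invariant_iff:
  assumes "p \<in> invariants n a"
  shows "homogeneous d p \<longleftrightarrow>
    (\<forall>m\<in>Poly_Mapping.keys p. (\<Sum>i=1..n. Poly_Mapping.lookup m i) = d)"
proof -
  have "(\<Sum>i\<in>Poly_Mapping.keys m. Poly_Mapping.lookup m i) = (\<Sum>i=1..n. Poly_Mapping.lookup m i)"
    if "m \<in> Poly_Mapping.keys p" for m
  proof (rule sum.mono_neutral_left)
    show "Poly_Mapping.keys m \<subseteq> {1..n}"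
      using that assms by (auto simp: invariants_eq invariant_monomials_def)
  qed (auto simp: in_keys_iff)
  thus ?thesis by (simp add: homogeneous_def)
qed

section \<open>The Hilbert series as a count of exponent vectors\<close>

lemma bij_betw_invariant_monomials_solutions:
  "bij_betw Poly_Mapping.lookup
     {m \<in> invariant_monomials n a. (\<Sum>i=1..n. Poly_Mapping.lookup m i) = d}
     (solutions {1..n} a (\<lambda>_. 1) d)"
  unfolding bij_betw_def
proof (intro conjI subset_antisym subsetI)
  show "inj_on Poly_Mapping.lookup {m \<in> invariant_monomials n a. (\<Sum>i=1..n. Poly_Mapping.lookup m i) = d}"
    by (rule inj_onI) (simp add: poly_mapping_eqI)
next
  fix f assume "f \<in> Poly_Mapping.lookup ` {m \<in> invariant_monomials n a. (\<Sum>i=1..n. Poly_Mapping.lookup m i) = d}"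
  thus "f \<in> solutions {1..n} a (\<lambda>_. 1) d"
    by (auto simp: solutions_def invariant_monomials_def weight_def in_keys_iff subset_iff)
next
  fix f assume f: "f \<in> solutions {1..n} a (\<lambda>_. 1) d"
  have "{i. f i \<noteq> 0} \<subseteq> {1..n}" using f by (auto simp: solutions_def)
  hence "finite {i. f i \<noteq> 0}" by (rule finite_subset) simp
  hence l: "Poly_Mapping.lookup (Abs_poly_mapping f) = f" by (rule lookup_Abs_poly_mapping)
  show "f \<in> Poly_Mapping.lookup ` {m \<in> invariant_monomials n a. (\<Sum>i=1..n. Poly_Mapping.lookup m i) = d}"
  proof (rule image_eqI[of _ _ "Abs_poly_mapping f"])
    show "Abs_poly_mapping f \<in> {m \<in> invariant_monomials n a. (\<Sum>i=1..n. Poly_Mapping.lookup m i) = d}"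
      using f by (auto simp: invariant_monomials_def weight_def l solutions_def subset_iff keys.rep_eq)
  qed (simp add: l)
qed

lemma cpoly_scale_single: "cpoly_scale c (Poly_Mapping.single m x) = Poly_Mapping.single m (c * x)"
  by (simp add: cpoly_scale_def mult_single)

lemma lookup_cpoly_scale: "Poly_Mapping.lookup (cpoly_scale c p) m = c * Poly_Mapping.lookup p m"
proof -
  have "cpoly_scale c p = (\<Sum>m\<in>Poly_Mapping.keys p. Poly_Mapping.single m (c * Poly_Mapping.lookup p m))"
    by (subst (1) poly_mapping_eq_sum_single[of p]) (simp add: cpoly_scale_def sum_distrib_left mult_single)
  thus ?thesis by (simp add: lookup_sum lookup_single when_def sum.delta in_keys_iff)
qed

lemma in_span_monomials:
  assumes "Poly_Mapping.keys p \<subseteq> S"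
  shows "p \<in> module.span cpoly_scale ((\<lambda>m. Poly_Mapping.single m 1) ` S)"
proof -
  interpret vector_space cpoly_scale by (rule vector_space_cpoly_scale)
  have "(\<Sum>m\<in>Poly_Mapping.keys p. cpoly_scale (Poly_Mapping.lookup p m) (Poly_Mapping.single m 1)) \<in>
      span ((\<lambda>m. Poly_Mapping.single m 1) ` S)"
    by (intro span_sum span_scale span_base imageI) (use assms in blast)
  thus ?thesis using poly_mapping_eq_sum_single[of p] by (simp add: cpoly_scale_single)
qed

text \<open>Invariance and homogeneity are conditions on single monomials, so the monomials that
  satisfy them form a basis of the graded piece.\<close>

lemma hilbert_series_eq: "hilbert_series n a = solution_series {1..n} a (\<lambda>_. 1)"
proof (rule fps_ext)
  fix d
  interpret vector_space cpoly_scale by (rule vector_space_cpoly_scale)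
  define S where "S = {m \<in> invariant_monomials n a. (\<Sum>i=1..n. Poly_Mapping.lookup m i) = d}"
  define V where "V = {p \<in> invariants n a. homogeneous d p}"
  have fin: "finite S"
    using bij_betw_finite[OF bij_betw_invariant_monomials_solutions[of n a d]] finite_solutions[of "{1..n}" "\<lambda>_. 1" a d]
    by (simp add: S_def)
  have V: "V = {p. Poly_Mapping.keys p \<subseteq> S}"
    unfolding V_def S_def using homogeneous_invariant_iff[of _ n a d] by (auto simp: invariants_eq)
  define b where "b m = Poly_Mapping.single m (1 :: complex)" for m :: "nat \<Rightarrow>\<^sub>0 nat"
  have inj: "inj b" by (rule injI) (metis b_def keys_single singleton_inject zero_neq_one)
  have "dim V = card (b ` S)"
  proof (rule dim_unique[of "b ` S"])
    show "b ` S \<subseteq> V" by (auto simp: V b_def)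
    show "V \<subseteq> span (b ` S)"
      using in_span_monomials[of _ S] unfolding V b_def by blast
    show "independent (b ` S)"
    proof (rule independent_if_scalars_zero)
      fix f p assume sum: "(\<Sum>x\<in>b ` S. cpoly_scale (f x) x) = 0" and "p \<in> b ` S"
      then obtain m where m: "m \<in> S" "p = b m" by blast
      have "(\<Sum>m\<in>S. cpoly_scale (f (b m)) (b m)) = 0"
        using sum by (simp add: sum.reindex inj_on_subset[OF inj])
      from arg_cong[OF this, of "\<lambda>q. Poly_Mapping.lookup q m"] have "f (b m) = 0"
        using m fin by (simp add: b_def cpoly_scale_single lookup_sum lookup_single when_def)
      thus "f p = 0" using m by simp
    qed (use fin in simp)
  qed simp
  also have "card (b ` S) = card S" by (rule card_image[OF inj_on_subset[OF inj]]) simp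
  also have "card S = card (solutions {1..n} a (\<lambda>_. 1) d)"
    unfolding S_def by (rule bij_betw_same_card[OF bij_betw_invariant_monomials_solutions])
  finally show "hilbert_series n a $ d = solution_series {1..n} a (\<lambda>_. 1) $ d"
    by (simp add: hilbert_series_def solution_series_def V_def)
qed

section \<open>Krull dimension\<close>

lemma invariant_monomials_add:
  "m \<in> invariant_monomials n a \<Longrightarrow> m' \<in> invariant_monomials n a \<Longrightarrow> m + m' \<in> invariant_monomials n a"
  using Poly_Mapping.keys_add[of m m']
  by (auto simp: invariant_monomials_def weight_def lookup_add distrib_left sum.distrib)

lemma invariants_closed:
  shows "0 \<in> invariants n a" "1 \<in> invariants n a"
    and "p \<in> invariants n a \<Longrightarrow> q \<in> invariants n a \<Longrightarrow> p + q \<in> invariants n a"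
    and "p \<in> invariants n a \<Longrightarrow> q \<in> invariants n a \<Longrightarrow> p * q \<in> invariants n a"
    and "p \<in> invariants n a \<Longrightarrow> - p \<in> invariants n a"
proof -
  show "0 \<in> invariants n a" "1 \<in> invariants n a"
    by (simp_all add: invariants_eq invariant_monomials_def weight_def)
  show "p \<in> invariants n a \<Longrightarrow> q \<in> invariants n a \<Longrightarrow> p + q \<in> invariants n a"
    using Poly_Mapping.keys_add[of p q] by (auto simp: invariants_eq)
  show "p \<in> invariants n a \<Longrightarrow> q \<in> invariants n a \<Longrightarrow> p * q \<in> invariants n a"
    using Poly_Mapping.keys_mult[of p q] invariant_monomials_add[of _ n a] by (fastforce simp: invariants_eq)
  show "p \<in> invariants n a \<Longrightarrow> - p \<in> invariants n a"
    by (simp add: invariants_eq)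
qed

lemma cpoly_scale_invariants: "p \<in> invariants n a \<Longrightarrow> cpoly_scale c p \<in> invariants n a"
  by (auto simp: invariants_eq in_keys_iff lookup_cpoly_scale subset_iff)

lemma cring_invariant_ring: "cring (invariant_ring n a)"
proof (rule cringI)
  show "abelian_group (invariant_ring n a)"
    by (rule abelian_groupI)
      (auto simp: invariant_ring_def invariants_closed algebra_simps intro: invariants_closed
        intro!: bexI[of _ "- _"])
  show "Group.comm_monoid (invariant_ring n a)"
    by (rule Group.comm_monoidI) (auto simp: invariant_ring_def invariants_closed algebra_simps)
qed (simp add: invariant_ring_def algebra_simps)

text \<open>Prime ideals in terms of the operations of the type \<open>cpoly\<close>, so that chains
  can be treated without the ring record.\<close>

definition prime_subset :: "nat \<Rightarrow> (nat \<Rightarrow> int) \<Rightarrow> cpoly set \<Rightarrow> bool" where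
  "prime_subset n a P \<longleftrightarrow> P \<subseteq> invariants n a \<and> 0 \<in> P \<and> 1 \<notin> P \<and>
     (\<forall>x\<in>P. \<forall>y\<in>P. x + y \<in> P) \<and> (\<forall>x\<in>P. \<forall>r\<in>invariants n a. r * x \<in> P) \<and>
     (\<forall>x\<in>invariants n a. \<forall>y\<in>invariants n a. x * y \<in> P \<longrightarrow> x \<in> P \<or> y \<in> P)"

lemma primeideal_invariant_ring_iff: "primeideal P (invariant_ring n a) \<longleftrightarrow> prime_subset n a P"
proof
  let ?R = "invariant_ring n a"
  assume "primeideal P ?R"
  then interpret primeideal P ?R .
  have carr: "P \<subseteq> invariants n a" using a_subset by (simp add: invariant_ring_def)
  have l: "r * x \<in> P" if "x \<in> P" "r \<in> invariants n a" for r x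
    using I_l_closed that by (simp add: invariant_ring_def)
  have "1 \<notin> P"
  proof
    assume "1 \<in> P"
    hence "invariants n a \<subseteq> P" using l[of 1] by auto
    thus False using carr I_notcarr by (simp add: invariant_ring_def)
  qed
  moreover have "0 \<in> P"
    using additive_subgroup.zero_closed[OF is_additive_subgroup] by (simp add: invariant_ring_def)
  moreover have "x + y \<in> P" if "x \<in> P" "y \<in> P" for x y
    using additive_subgroup.a_closed[OF is_additive_subgroup] that by (simp add: invariant_ring_def)
  moreover have "x \<in> P \<or> y \<in> P" if "x \<in> invariants n a" "y \<in> invariants n a" "x * y \<in> P" for x y
    using I_prime that by (simp add: invariant_ring_def)
  ultimately show "prime_subset n a P" using carr l by (simp add: prime_subset_def)
next
  let ?R = "invariant_ring n a"
  assume P: "prime_subset n a P"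
  interpret R: cring ?R by (rule cring_invariant_ring)
  have carr: "P \<subseteq> invariants n a" using P by (simp add: prime_subset_def)
  have inv: "\<ominus>\<^bsub>?R\<^esub> x = - x" if "x \<in> invariants n a" for x
    by (rule R.minus_equality) (use that in \<open>auto simp: invariant_ring_def invariants_closed\<close>)
  have neg: "- x \<in> P" if "x \<in> P" for x
  proof -
    have "- 1 \<in> invariants n a" by (intro invariants_closed)
    hence "(- 1) * x \<in> P" using P that unfolding prime_subset_def by blast
    thus ?thesis by simp
  qed
  show "primeideal P ?R"
  proof (rule primeidealI)
    show "ideal P ?R"
    proof (rule idealI)
      show "ring ?R" by (rule R.ring_axioms)
      show "subgroup P (add_monoid ?R)"
      proof
        fix x assume x: "x \<in> P"
        show "inv\<^bsub>add_monoid ?R\<^esub> x \<in> P"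
          using inv[of x] neg[OF x] x carr by (auto simp: a_inv_def)
      qed (use P in \<open>auto simp: prime_subset_def invariant_ring_def\<close>)
    next
      fix x r assume "x \<in> P" "r \<in> carrier ?R"
      thus "r \<otimes>\<^bsub>?R\<^esub> x \<in> P" "x \<otimes>\<^bsub>?R\<^esub> r \<in> P"
        using P by (auto simp: prime_subset_def invariant_ring_def mult.commute)
    qed
    show "cring ?R" by (rule R.is_cring)
    show "carrier ?R \<noteq> P"
      using P invariants_closed(2)[of n a] by (auto simp: prime_subset_def invariant_ring_def)
  next
    fix x y assume "x \<in> carrier ?R" "y \<in> carrier ?R" "x \<otimes>\<^bsub>?R\<^esub> y \<in> P"
    thus "x \<in> P \<or> y \<in> P" using P by (simp add: prime_subset_def invariant_ring_def)
  qed
qed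

section \<open>Lower bound: primes from faces\<close>

definition restrict_support :: "nat set \<Rightarrow> cpoly \<Rightarrow> cpoly" where
  "restrict_support I = linear_extension (Poly_Mapping.single 0)
     (\<lambda>m. if Poly_Mapping.keys m \<subseteq> I then Poly_Mapping.single m 1 else 0)"

lemma keys_add_nat: "Poly_Mapping.keys (m + m' :: nat \<Rightarrow>\<^sub>0 nat) = Poly_Mapping.keys m \<union> Poly_Mapping.keys m'"
  by (auto simp: in_keys_iff lookup_add)

text \<open>This is the substitution of 0 for the variables outside I. It is multiplicative because
  natural exponents never cancel: the support of a product of monomials is the union of their
  supports.\<close>

lemma comm_ring_hom_restrict_support: "comm_ring_hom (restrict_support I)"
  unfolding restrict_support_def
  by (rule comm_ring_hom_linear_extension)
    (auto simp: single_add mult_single keys_add_nat simp flip: single_one)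

lemma lookup_restrict_support:
  "Poly_Mapping.lookup (restrict_support I p) m = (if Poly_Mapping.keys m \<subseteq> I then Poly_Mapping.lookup p m else 0)"
proof -
  have "restrict_support I p = (\<Sum>m\<in>Poly_Mapping.keys p. if Poly_Mapping.keys m \<subseteq> I
      then Poly_Mapping.single m (Poly_Mapping.lookup p m) else 0)"
    unfolding restrict_support_def linear_extension_def by (rule sum.cong) (auto simp: mult_single)
  also have "Poly_Mapping.lookup \<dots> m = (\<Sum>m'\<in>Poly_Mapping.keys p.
      if m' = m then (if Poly_Mapping.keys m \<subseteq> I then Poly_Mapping.lookup p m else 0) else 0)"
    unfolding lookup_sum by (rule sum.cong) (auto simp: lookup_single)
  finally show ?thesis by (simp add: in_keys_iff)
qed

definition face_prime :: "nat \<Rightarrow> (nat \<Rightarrow> int) \<Rightarrow> nat set \<Rightarrow> cpoly set" where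
  "face_prime n a I = {p \<in> invariants n a. restrict_support I p = 0}"

text \<open>The kernel of a homomorphism into a domain.\<close>

lemma prime_subset_face_prime: "prime_subset n a (face_prime n a I)"
proof -
  interpret comm_ring_hom "restrict_support I" by (rule comm_ring_hom_restrict_support)
  show ?thesis
    by (auto simp: prime_subset_def face_prime_def invariants_closed hom_add hom_mult)
qed

lemma face_prime_psubset:
  assumes "I \<subseteq> J" "m \<in> invariant_monomials n a" "Poly_Mapping.keys m \<subseteq> J" "\<not> Poly_Mapping.keys m \<subseteq> I"
  shows "face_prime n a J \<subset> face_prime n a I"
proof
  have zero: "restrict_support K p = 0 \<longleftrightarrow> (\<forall>m. Poly_Mapping.keys m \<subseteq> K \<longrightarrow> Poly_Mapping.lookup p m = 0)" for K p
    by (auto simp: poly_mapping_eq_iff fun_eq_iff lookup_restrict_support)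
  show "face_prime n a J \<subseteq> face_prime n a I"
    using assms(1) by (auto simp: face_prime_def zero)
  have "Poly_Mapping.single m 1 \<in> face_prime n a I" "Poly_Mapping.single m 1 \<notin> face_prime n a J"
    using assms by (auto simp: face_prime_def zero invariants_eq lookup_single when_def)
  thus "face_prime n a J \<noteq> face_prime n a I" by blast
qed

lemma ex_prime_chain:
  assumes k: "0 < k" "k < n"
    and neg: "\<And>i. i \<in> {1..k} \<Longrightarrow> a i < 0" and pos: "\<And>i. i \<in> {k+1..n} \<Longrightarrow> a i > 0"
  shows "\<exists>P. (\<forall>i\<le>n - 1. primeideal (P i) (invariant_ring n a)) \<and> (\<forall>i<n - 1. P i \<subset> P (Suc i))"
proof -
  define v where "v p q = Poly_Mapping.single p (nat (a q)) + Poly_Mapping.single q (nat (- a p))" for p q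
  have v: "v p q \<in> invariant_monomials n a" "Poly_Mapping.keys (v p q) = {p, q}"
    if pq: "p \<in> {1..k}" "q \<in> {k+1..n}" for p q
  proof -
    show keys: "Poly_Mapping.keys (v p q) = {p, q}"
      using neg[OF pq(1)] pos[OF pq(2)] by (auto simp: v_def keys_add_nat)
    have "weight n a (v p q) = (\<Sum>i=1..n. (if i = p then a p * a q else 0) + (if i = q then - a p * a q else 0))"
      unfolding weight_def
      by (rule sum.cong) (use pq neg[OF pq(1)] pos[OF pq(2)] in \<open>auto simp: v_def lookup_add lookup_single when_def\<close>)
    also have "\<dots> = 0" using pq k by (simp add: sum.distrib)
    finally show "v p q \<in> invariant_monomials n a"
      using keys pq k by (auto simp: invariant_monomials_def)
  qed
  \<comment> \<open>All faces but the last keep 1 and n, of opposite signs, so the index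
    \<open>j + 2\<close> that is lost next pairs with one of them in an invariant monomial. The last
    step drops \<open>{1, n}\<close> at once, since the weight of a single index admits no
    nonconstant invariant monomial. This gives \<open>n - 1\<close> strict inclusions.\<close>
  define I where "I j = (if j < n - 1 then {1} \<union> {j + 2..n} else {})" for j
  have "face_prime n a (I j) \<subset> face_prime n a (I (Suc j))" if j: "j < n - 1" for j
  proof -
    have I: "I (Suc j) \<subseteq> I j" "j + 2 \<in> I j" "1 \<in> I j" "n \<in> I j" "j + 2 \<notin> I (Suc j)"
      using j k by (simp_all add: I_def) auto
    obtain p q where pq: "p \<in> {1..k}" "q \<in> {k+1..n}" "{p, q} \<subseteq> I j" "\<not> {p, q} \<subseteq> I (Suc j)"
    proof (cases "j + 2 \<le> k")
      case True
      thus ?thesis using that[of "j + 2" n] I k by simp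
    next
      case False
      thus ?thesis using that[of 1 "j + 2"] I j k by simp
    qed
    show ?thesis
      by (rule face_prime_psubset[OF I(1) v(1)[OF pq(1,2)]]) (use v(2)[OF pq(1,2)] pq(3,4) in simp_all)
  qed
  thus ?thesis
    using prime_subset_face_prime by (intro exI[of _ "\<lambda>j. face_prime n a (I j)"]) (simp add: primeideal_invariant_ring_iff)
qed

text \<open>A nontrivial relation \<open>\<Sum> c\<^sub>\<alpha> x^\<alpha> \<in> P\<^sub>t\<close> can be divided by the highest possible
  power of \<open>x\<^sub>t \<notin> P\<^sub>t\<close>. Modulo \<open>x\<^sub>t \<in> P\<^sub>t\<^sub>+\<^sub>1\<close> it then becomes a nontrivial relation without \<open>x\<^sub>t\<close>.\<close>

lemma prime_chain_no_relation:
  assumes prime: "\<And>i. i \<le> N \<Longrightarrow> prime_subset n a (P i)" and sub: "\<And>i. i < N \<Longrightarrow> P i \<subseteq> P (Suc i)"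
    and x: "\<And>i. i < N \<Longrightarrow> x i \<in> P (Suc i) - P i"
    and t: "t \<le> N" and A: "finite A" "A \<noteq> {}" and c: "\<And>\<alpha>. \<alpha> \<in> A \<Longrightarrow> c \<alpha> \<noteq> 0"
    and inj: "\<And>\<alpha> \<beta>. \<alpha> \<in> A \<Longrightarrow> \<beta> \<in> A \<Longrightarrow> (\<And>i. t \<le> i \<Longrightarrow> i < N \<Longrightarrow> \<alpha> i = \<beta> i) \<Longrightarrow> \<alpha> = \<beta>"
  shows "(\<Sum>\<alpha>\<in>A. cpoly_scale (c \<alpha>) (\<Prod>i\<in>{t..<N}. x i ^ (\<alpha> i :: nat))) \<notin> P t"
  using t A c inj
proof (induction t arbitrary: A rule: inc_induct)
  case base
  then obtain \<alpha> where \<alpha>: "\<alpha> \<in> A" by blast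
  \<comment> \<open>At \<open>t = N\<close> no index is left to tell exponent vectors apart, so the
    relation is one nonzero constant, which would put 1 into \<open>P N\<close>.\<close>
  have "A = {\<alpha>}" using base.prems(4)[OF _ \<alpha>] \<alpha> by fastforce
  show ?case
  proof
    assume "(\<Sum>\<alpha>\<in>A. cpoly_scale (c \<alpha>) (\<Prod>i\<in>{N..<N}. x i ^ \<alpha> i)) \<in> P N"
    hence "cpoly_scale (c \<alpha>) 1 \<in> P N" by (simp add: \<open>A = {\<alpha>}\<close>)
    moreover have "cpoly_scale (1 / c \<alpha>) 1 \<in> invariants n a"
      by (intro cpoly_scale_invariants invariants_closed)
    ultimately have "cpoly_scale (1 / c \<alpha>) 1 * cpoly_scale (c \<alpha>) 1 \<in> P N"
      using prime[of N] unfolding prime_subset_def by blast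
    moreover have "cpoly_scale (1 / c \<alpha>) 1 * cpoly_scale (c \<alpha>) 1 = 1"
      using base.prems(3)[OF \<alpha>] by (simp add: cpoly_scale_def mult_single)
    ultimately show False using prime[of N] by (simp add: prime_subset_def)
  qed
next
  case (step t)
  note A = step.prems(1,2)
  have Pt: "prime_subset n a (P t)" and Pt1: "prime_subset n a (P (Suc t))" using prime step.hyps by auto
  have xi: "x i \<in> invariants n a" if "i < N" for i
    using x[OF that] prime[of "Suc i"] that by (auto simp: prime_subset_def)
  have pow: "y ^ e \<in> invariants n a" if "y \<in> invariants n a" for y e
    by (induction e) (use that in \<open>auto intro: invariants_closed\<close>)
  have prd: "(\<Prod>i\<in>J. x i ^ f i) \<in> invariants n a" if "\<And>i. i \<in> J \<Longrightarrow> i < N" for J f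
    using that by (induction J rule: infinite_finite_induct) (auto intro!: invariants_closed pow xi)
  have sm: "(\<Sum>\<alpha>\<in>B. f \<alpha>) \<in> invariants n a" if "\<And>\<alpha>. \<alpha> \<in> B \<Longrightarrow> f \<alpha> \<in> invariants n a" for B and f :: "'b \<Rightarrow> cpoly"
    using that by (induction B rule: infinite_finite_induct) (auto intro!: invariants_closed)
  define e where "e = Min ((\<lambda>\<alpha>. \<alpha> t) ` A)"
  have e_le: "e \<le> \<alpha> t" if "\<alpha> \<in> A" for \<alpha> unfolding e_def using A that by (intro Min_le) auto
  have e_in: "\<exists>\<alpha>\<in>A. \<alpha> t = e"
  proof -
    have "e \<in> (\<lambda>\<alpha>. \<alpha> t) ` A" unfolding e_def by (rule Min_in) (use A in auto)
    thus ?thesis by blast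
  qed
  \<comment> \<open>Modulo \<open>x t\<close> only the vectors with minimal t-th exponent survive.
    They agree at t, so the indices beyond t still separate them, as the induction hypothesis
    requires.\<close>
  define A' where "A' = {\<alpha> \<in> A. \<alpha> t = e}"
  define Q where "Q \<alpha> = cpoly_scale (c \<alpha>) (\<Prod>i\<in>{Suc t..<N}. x i ^ \<alpha> i)" for \<alpha>
  have Q: "Q \<alpha> \<in> invariants n a" for \<alpha>
    unfolding Q_def by (intro cpoly_scale_invariants prd) auto
  have scale_mult: "cpoly_scale u (y * z) = y * cpoly_scale u z" for u y z
    by (simp add: cpoly_scale_def mult_ac)
  show ?case
  proof
    assume mem: "(\<Sum>\<alpha>\<in>A. cpoly_scale (c \<alpha>) (\<Prod>i\<in>{t..<N}. x i ^ \<alpha> i)) \<in> P t"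
    have "(\<Sum>\<alpha>\<in>A. cpoly_scale (c \<alpha>) (\<Prod>i\<in>{t..<N}. x i ^ \<alpha> i)) =
        x t ^ e * (\<Sum>\<alpha>\<in>A. x t ^ (\<alpha> t - e) * Q \<alpha>)"
      unfolding sum_distrib_left
    proof (rule sum.cong[OF refl])
      fix \<alpha> assume "\<alpha> \<in> A"
      have "(\<Prod>i\<in>{t..<N}. x i ^ \<alpha> i) = x t ^ \<alpha> t * (\<Prod>i\<in>{Suc t..<N}. x i ^ \<alpha> i)"
        using step.hyps by (simp add: prod.atLeast_Suc_lessThan)
      also have "x t ^ \<alpha> t = x t ^ e * x t ^ (\<alpha> t - e)"
        using e_le[OF \<open>\<alpha> \<in> A\<close>] by (simp flip: power_add)
      finally show "cpoly_scale (c \<alpha>) (\<Prod>i\<in>{t..<N}. x i ^ \<alpha> i) = x t ^ e * (x t ^ (\<alpha> t - e) * Q \<alpha>)"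
        by (simp only: Q_def scale_mult mult.assoc)
    qed
    with mem have "x t ^ e * (\<Sum>\<alpha>\<in>A. x t ^ (\<alpha> t - e) * Q \<alpha>) \<in> P t" by simp
    moreover have "y \<in> P t" if "x t ^ e * y \<in> P t" "y \<in> invariants n a" for y
      using that(1)
    proof (induction e)
      case (Suc e)
      have "x t \<notin> P t" "x t \<in> invariants n a" using x[OF step.hyps(2)] xi[OF step.hyps(2)] by auto
      moreover have "x t * (x t ^ e * y) \<in> P t" using Suc.prems by (simp add: mult.assoc)
      moreover have "x t ^ e * y \<in> invariants n a" using pow xi[OF step.hyps(2)] that(2) by (intro invariants_closed)
      ultimately have "x t ^ e * y \<in> P t" using Pt unfolding prime_subset_def by blast
      thus ?case by (rule Suc.IH)
    qed simp
    ultimately have "(\<Sum>\<alpha>\<in>A. x t ^ (\<alpha> t - e) * Q \<alpha>) \<in> P t"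
      using pow[OF xi[OF step.hyps(2)]] Q by (metis (no_types, lifting) invariants_closed(4) sm)
    hence mem1: "(\<Sum>\<alpha>\<in>A. x t ^ (\<alpha> t - e) * Q \<alpha>) \<in> P (Suc t)" using sub[OF step.hyps(2)] by blast
    have sumP: "(\<Sum>\<alpha>\<in>B. f \<alpha>) \<in> P (Suc t)" if "\<And>\<alpha>. \<alpha> \<in> B \<Longrightarrow> f \<alpha> \<in> P (Suc t)" for B and f :: "'b \<Rightarrow> cpoly"
      using that Pt1 by (induction B rule: infinite_finite_induct) (auto simp: prime_subset_def)
    have rest: "(\<Sum>\<alpha>\<in>A - A'. x t ^ (\<alpha> t - e) * Q \<alpha>) \<in> P (Suc t)"
    proof (rule sumP)
      fix \<alpha> assume "\<alpha> \<in> A - A'"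
      hence "\<alpha> t > e" using e_le[of \<alpha>] by (auto simp: A'_def)
      then obtain d where "\<alpha> t - e = Suc d" by (metis Suc_diff_Suc)
      hence eq: "x t ^ (\<alpha> t - e) * Q \<alpha> = (x t ^ d * Q \<alpha>) * x t" by (simp add: mult_ac)
      moreover have "x t ^ d * Q \<alpha> \<in> invariants n a" by (intro invariants_closed pow xi Q step.hyps)
      moreover have "x t \<in> P (Suc t)" using x[OF step.hyps(2)] by blast
      ultimately have "(x t ^ d * Q \<alpha>) * x t \<in> P (Suc t)" using Pt1 unfolding prime_subset_def by blast
      thus "x t ^ (\<alpha> t - e) * Q \<alpha> \<in> P (Suc t)" by (simp only: eq)
    qed
    have "(\<Sum>\<alpha>\<in>A. x t ^ (\<alpha> t - e) * Q \<alpha>) = (\<Sum>\<alpha>\<in>A - A'. x t ^ (\<alpha> t - e) * Q \<alpha>) + (\<Sum>\<alpha>\<in>A'. x t ^ (\<alpha> t - e) * Q \<alpha>)"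
      by (rule sum.subset_diff) (use A in \<open>auto simp: A'_def\<close>)
    also have "(\<Sum>\<alpha>\<in>A'. x t ^ (\<alpha> t - e) * Q \<alpha>) = (\<Sum>\<alpha>\<in>A'. Q \<alpha>)"
      by (rule sum.cong) (auto simp: A'_def)
    finally have "(\<Sum>\<alpha>\<in>A'. Q \<alpha>) = (\<Sum>\<alpha>\<in>A. x t ^ (\<alpha> t - e) * Q \<alpha>) +
        (- 1) * (\<Sum>\<alpha>\<in>A - A'. x t ^ (\<alpha> t - e) * Q \<alpha>)" by simp
    also have "\<dots> \<in> P (Suc t)"
    proof -
      have "- 1 \<in> invariants n a" by (intro invariants_closed)
      thus ?thesis using mem1 rest Pt1 unfolding prime_subset_def by blast
    qed
    finally have "(\<Sum>\<alpha>\<in>A'. Q \<alpha>) \<in> P (Suc t)" .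
    moreover have "(\<Sum>\<alpha>\<in>A'. Q \<alpha>) \<notin> P (Suc t)"
      unfolding Q_def
    proof (rule step.IH)
      show "finite A'" "A' \<noteq> {}" using A e_in by (auto simp: A'_def)
      show "c \<alpha> \<noteq> 0" if "\<alpha> \<in> A'" for \<alpha> using that step.prems(3) by (simp add: A'_def)
      fix \<alpha> \<beta> assume ab: "\<alpha> \<in> A'" "\<beta> \<in> A'" and eq: "\<And>i. Suc t \<le> i \<Longrightarrow> i < N \<Longrightarrow> \<alpha> i = \<beta> i"
      show "\<alpha> = \<beta>"
      proof (rule step.prems(4))
        fix i assume i: "t \<le> i" "i < N"
        show "\<alpha> i = \<beta> i"
          using ab eq[OF _ i(2)] i(1) by (cases "i = t") (auto simp: A'_def)
      qed (use ab in \<open>auto simp: A'_def\<close>)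
    qed
    ultimately show False by blast
  qed
qed

section \<open>Upper bound: counting invariants of bounded degree\<close>

definition invariants_upto :: "nat \<Rightarrow> (nat \<Rightarrow> int) \<Rightarrow> nat \<Rightarrow> cpoly set" where
  "invariants_upto n a D = {p \<in> invariants n a.
     \<forall>m\<in>Poly_Mapping.keys p. (\<Sum>i=1..n. Poly_Mapping.lookup m i) \<le> D}"

lemma invariants_upto_mult:
  assumes "p \<in> invariants_upto n a D" "q \<in> invariants_upto n a D'"
  shows "p * q \<in> invariants_upto n a (D + D')"
  unfolding invariants_upto_def
proof (intro CollectI conjI ballI)
  show "p * q \<in> invariants n a" using assms by (auto simp: invariants_upto_def intro: invariants_closed)
  fix m assume "m \<in> Poly_Mapping.keys (p * q)"
  then obtain u v where uv: "m = u + v" "u \<in> Poly_Mapping.keys p" "v \<in> Poly_Mapping.keys q"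
    using Poly_Mapping.keys_mult[of p q] by blast
  have "(\<Sum>i=1..n. Poly_Mapping.lookup u i) \<le> D" "(\<Sum>i=1..n. Poly_Mapping.lookup v i) \<le> D'"
    using assms uv by (auto simp: invariants_upto_def)
  thus "(\<Sum>i=1..n. Poly_Mapping.lookup m i) \<le> D + D'"
    by (simp add: uv lookup_add sum.distrib)
qed

lemma invariants_upto_one: "1 \<in> invariants_upto n a 0"
  using invariants_closed(2)[of n a] by (simp add: invariants_upto_def)

lemma invariants_upto_mono: "D \<le> D' \<Longrightarrow> invariants_upto n a D \<subseteq> invariants_upto n a D'"
  by (force simp: invariants_upto_def)

lemma invariants_upto_power:
  "p \<in> invariants_upto n a D \<Longrightarrow> p ^ e \<in> invariants_upto n a (e * D)"
  by (induction e) (auto simp: invariants_upto_one intro: invariants_upto_mult)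

lemma invariants_upto_prod:
  assumes "finite A" "\<And>i. i \<in> A \<Longrightarrow> p i \<in> invariants_upto n a D"
  shows "(\<Prod>i\<in>A. p i) \<in> invariants_upto n a (card A * D)"
  using assms by (induction A rule: finite_induct) (auto simp: invariants_upto_one intro: invariants_upto_mult)

lemma ex_invariants_upto:
  assumes "p \<in> invariants n a"
  shows "\<exists>D. p \<in> invariants_upto n a D"
proof
  let ?d = "\<lambda>m. \<Sum>i=1..n. Poly_Mapping.lookup m i"
  have "?d m \<le> sum ?d (Poly_Mapping.keys p)" if "m \<in> Poly_Mapping.keys p" for m
    by (rule member_le_sum[of m _ ?d]) (use that in simp_all)
  thus "p \<in> invariants_upto n a (sum ?d (Poly_Mapping.keys p))"
    using assms by (simp add: invariants_upto_def)
qed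

text \<open>As \<open>a n \<noteq> 0\<close>, the weight equation determines the last exponent from
  the others, which leaves \<open>n - 1\<close> exponents of size at most D.\<close>

lemma card_invariant_monomials_le:
  fixes n :: nat
  assumes "a n \<noteq> 0" "n > 0"
  defines "T \<equiv> \<lambda>D. {m \<in> invariant_monomials n a. (\<Sum>i=1..n. Poly_Mapping.lookup m i) \<le> D}"
  shows "finite (T D)" "card (T D) \<le> (D + 1) ^ (n - 1)"
proof -
  let ?f = "\<lambda>m. restrict (Poly_Mapping.lookup m) {1..<n}"
  let ?B = "PiE {1..<n} (\<lambda>_. {..D})"
  have le: "Poly_Mapping.lookup m i \<le> D" if "m \<in> T D" "i \<in> {1..n}" for m i
  proof -
    have "Poly_Mapping.lookup m i \<le> (\<Sum>i=1..n. Poly_Mapping.lookup m i)"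
      by (rule member_le_sum) (use that in auto)
    thus ?thesis using that by (simp add: T_def)
  qed
  have sub: "?f ` T D \<subseteq> ?B" using le by (auto simp: PiE_iff)
  have inj: "inj_on ?f (T D)"
  proof (rule inj_onI)
    fix m m' assume m: "m \<in> T D" "m' \<in> T D" "?f m = ?f m'"
    have eq: "Poly_Mapping.lookup m i = Poly_Mapping.lookup m' i" if "i \<in> {1..<n}" for i
      using fun_cong[OF m(3), of i] that by simp
    have n: "{1..n} = insert n {1..<n}" using assms(2) by auto
    have w: "a n * int (Poly_Mapping.lookup m n) + (\<Sum>i\<in>{1..<n}. a i * int (Poly_Mapping.lookup m i)) = 0"
      if "m \<in> T D" for m
      using that unfolding T_def invariant_monomials_def weight_def n by simp
    have "(\<Sum>i\<in>{1..<n}. a i * int (Poly_Mapping.lookup m i)) = (\<Sum>i\<in>{1..<n}. a i * int (Poly_Mapping.lookup m' i))"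
      by (rule sum.cong) (use eq in auto)
    hence "a n * int (Poly_Mapping.lookup m n) = a n * int (Poly_Mapping.lookup m' n)"
      using w[OF m(1)] w[OF m(2)] by linarith
    hence eqn: "Poly_Mapping.lookup m n = Poly_Mapping.lookup m' n" using assms(1) by simp
    show "m = m'"
    proof (rule poly_mapping_eqI)
      fix i
      consider "i \<in> {1..<n}" | "i = n" | "i \<notin> {1..n}" by force
      thus "Poly_Mapping.lookup m i = Poly_Mapping.lookup m' i"
      proof cases
        case 3
        hence "i \<notin> Poly_Mapping.keys m" "i \<notin> Poly_Mapping.keys m'"
          using m by (auto simp: T_def invariant_monomials_def)
        thus ?thesis by (simp add: in_keys_iff)
      qed (use eq eqn in auto)
    qed
  qed
  have B: "finite ?B" "card ?B = (D + 1) ^ (n - 1)" by (simp_all add: finite_PiE card_PiE)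
  show "finite (T D)" using inj sub B(1) by (rule inj_on_finite)
  show "card (T D) \<le> (D + 1) ^ (n - 1)" using card_inj_on_le[OF inj sub B(1)] B(2) by simp
qed

text \<open>The family is indexed by B because different exponent vectors may yield the same
  product; two equal members already give a relation. Indices with coefficient 0 are discarded, as
  the argument on prime chains divides by coefficients.\<close>

lemma ex_linear_relation:
  fixes f :: "'b \<Rightarrow> cpoly"
  assumes B: "finite B" and T: "finite T" "card T < card B"
    and keys: "\<And>b. b \<in> B \<Longrightarrow> Poly_Mapping.keys (f b) \<subseteq> T"
  obtains A c where "A \<subseteq> B" "A \<noteq> {}" "\<And>b. b \<in> A \<Longrightarrow> c b \<noteq> 0"
    "(\<Sum>b\<in>A. cpoly_scale (c b) (f b)) = 0"
proof (cases "inj_on f B")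
  case False
  then obtain b b' where b: "b \<in> B" "b' \<in> B" "b \<noteq> b'" "f b = f b'" by (auto simp: inj_on_def)
  interpret vector_space cpoly_scale by (rule vector_space_cpoly_scale)
  show ?thesis
  proof (rule that[of "{b, b'}" "\<lambda>x. if x = b then 1 else - 1"])
    show "(\<Sum>x\<in>{b, b'}. cpoly_scale (if x = b then 1 else - 1) (f x)) = 0"
      using b by (simp add: scale_minus_left)
  qed (use b in auto)
next
  case True
  interpret vector_space cpoly_scale by (rule vector_space_cpoly_scale)
  let ?b = "\<lambda>m. Poly_Mapping.single m (1 :: complex)"
  have "dependent (f ` B)"
  proof (rule ccontr)
    assume "\<not> dependent (f ` B)"
    moreover have "f ` B \<subseteq> span (?b ` T)" using in_span_monomials keys by blast
    ultimately have "card (f ` B) \<le> card (?b ` T)"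
      using independent_span_bound[of "?b ` T" "f ` B"] T by simp
    also have "\<dots> \<le> card T" by (rule card_image_le[OF T(1)])
    finally show False using T(2) card_image[OF True] by simp
  qed
  then obtain S u where S: "finite S" "S \<subseteq> f ` B" "(\<Sum>v\<in>S. cpoly_scale (u v) v) = 0" "\<exists>v\<in>S. u v \<noteq> 0"
    unfolding dependent_explicit by blast
  define A where "A = {b \<in> B. f b \<in> S \<and> u (f b) \<noteq> 0}"
  show ?thesis
  proof (rule that[of A "\<lambda>b. u (f b)"])
    show "A \<noteq> {}" using S(2,4) by (auto simp: A_def)
    have "(\<Sum>b\<in>A. cpoly_scale (u (f b)) (f b)) = (\<Sum>v\<in>f ` A. cpoly_scale (u v) v)"
      by (rule sum.reindex_cong[of f, symmetric]) (auto intro: inj_on_subset[OF True] simp: A_def)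
    also have "\<dots> = (\<Sum>v\<in>S. cpoly_scale (u v) v)"
    proof (rule sum.mono_neutral_left)
      show "\<forall>v\<in>S - f ` A. cpoly_scale (u v) v = 0"
        using S(2) by (force simp: A_def)
    qed (use S in \<open>auto simp: A_def\<close>)
    finally show "(\<Sum>b\<in>A. cpoly_scale (u (f b)) (f b)) = 0" using S(3) by simp
  qed (auto simp: A_def)
qed

text \<open>The number of monomials of degree at most \<open>D\<close> in the invariants is \<open>O(D^(n-1))\<close>, while
  there are \<open>(r+1)^n\<close> products of \<open>n\<close> invariants with exponents up to \<open>r\<close>. So any \<open>n\<close>
  invariants are algebraically dependent.\<close>

lemma prime_chain_length_le:
  fixes n :: nat
  assumes n: "n > 0" and an: "a n \<noteq> 0"
    and prime: "\<And>i. i \<le> l \<Longrightarrow> prime_subset n a (P i)" and sub: "\<And>i. i < l \<Longrightarrow> P i \<subset> P (Suc i)"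
  shows "l \<le> n - 1"
proof (rule ccontr)
  assume "\<not> l \<le> n - 1"
  hence l: "n \<le> l" by simp
  have "\<exists>x. x \<in> P (Suc i) - P i" if "i < n" for i using sub[of i] that l by auto
  then obtain x where x: "\<And>i. i < n \<Longrightarrow> x i \<in> P (Suc i) - P i" by metis
  have xi: "x i \<in> invariants n a" if "i < n" for i
    using x[OF that] prime[of "Suc i"] that l by (auto simp: prime_subset_def)
  have "\<forall>i. \<exists>d. i < n \<longrightarrow> x i \<in> invariants_upto n a d"
    using ex_invariants_upto[OF xi] by blast
  from choice[OF this] obtain d where d: "\<And>i. i < n \<Longrightarrow> x i \<in> invariants_upto n a (d i)"
    by blast
  define c where "c = Suc (\<Sum>i<n. d i)"
  have xc: "x i \<in> invariants_upto n a c" if "i < n" for i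
  proof -
    have "d i \<le> c" using member_le_sum[of i "{..<n}" d] that by (simp add: c_def)
    thus ?thesis using d[OF that] invariants_upto_mono by blast
  qed
  \<comment> \<open>Chosen so that
    \<open>(n * c * (r + 1)) ^ (n - 1) = r * (r + 1) ^ (n - 1)\<close>, which is just below the
    number \<open>(r + 1) ^ n\<close> of exponent vectors.\<close>
  define r where "r = (n * c) ^ (n - 1)"
  define D where "D = n * (r * c)"
  define B where "B = PiE {..<n} (\<lambda>_. {..r})"
  define T where "T = {m \<in> invariant_monomials n a. (\<Sum>i=1..n. Poly_Mapping.lookup m i) \<le> D}"
  have B: "finite B" "card B = (r + 1) ^ n" by (simp_all add: B_def finite_PiE card_PiE)
  have T: "finite T" "card T \<le> (D + 1) ^ (n - 1)"
    unfolding T_def by (rule card_invariant_monomials_le[of a n, OF an n])+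
  have "card T < card B"
  proof -
    have "1 \<le> n * c" using n by (simp add: c_def)
    hence "D + 1 \<le> n * c * (r + 1)" by (simp add: D_def algebra_simps)
    hence "(D + 1) ^ (n - 1) \<le> (n * c * (r + 1)) ^ (n - 1)" by (rule power_mono) simp
    also have "\<dots> = r * (r + 1) ^ (n - 1)" by (simp only: power_mult_distrib r_def)
    also have "\<dots> < (r + 1) * (r + 1) ^ (n - 1)" by simp
    also have "\<dots> = (r + 1) ^ n" using n by (metis Suc_diff_1 power_Suc)
    finally show ?thesis using T(2) B(2) by simp
  qed
  have keys: "Poly_Mapping.keys (\<Prod>i\<in>{0..<n}. x i ^ \<alpha> i) \<subseteq> T" if "\<alpha> \<in> B" for \<alpha>
  proof -
    have "(\<Prod>i\<in>{0..<n}. x i ^ \<alpha> i) \<in> invariants_upto n a (card {0..<n} * (r * c))"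
    proof (rule invariants_upto_prod)
      fix i assume i: "i \<in> {0..<n}"
      hence "\<alpha> i \<le> r" using that by (auto simp: B_def PiE_iff)
      hence "\<alpha> i * c \<le> r * c" by simp
      thus "x i ^ \<alpha> i \<in> invariants_upto n a (r * c)"
        using invariants_upto_power[OF xc, of i "\<alpha> i"] i
          invariants_upto_mono[of "\<alpha> i * c" "r * c" n a] by auto
    qed simp
    thus ?thesis by (auto simp: invariants_upto_def T_def D_def invariants_eq)
  qed
  obtain A \<gamma> where A: "A \<subseteq> B" "A \<noteq> {}" "\<And>\<alpha>. \<alpha> \<in> A \<Longrightarrow> \<gamma> \<alpha> \<noteq> 0"
    "(\<Sum>\<alpha>\<in>A. cpoly_scale (\<gamma> \<alpha>) (\<Prod>i\<in>{0..<n}. x i ^ \<alpha> i)) = 0"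
    using ex_linear_relation[OF B(1) T(1) \<open>card T < card B\<close> keys, of "\<lambda>\<alpha>. \<alpha>"] by blast
  have "(\<Sum>\<alpha>\<in>A. cpoly_scale (\<gamma> \<alpha>) (\<Prod>i\<in>{0..<n}. x i ^ \<alpha> i)) \<notin> P 0"
  proof (rule prime_chain_no_relation[where N = n and P = P and n = n and a = a])
    show "prime_subset n a (P i)" if "i \<le> n" for i using prime that l by simp
    show "P i \<subseteq> P (Suc i)" if "i < n" for i using sub[of i] that l by auto
    show "x i \<in> P (Suc i) - P i" if "i < n" for i by (rule x[OF that])
    show "finite A" using A(1) B(1) by (rule finite_subset)
    show "A \<noteq> {}" by (rule A(2))
    show "\<gamma> \<alpha> \<noteq> 0" if "\<alpha> \<in> A" for \<alpha> by (rule A(3)[OF that])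
    fix \<alpha> \<beta> assume ab: "\<alpha> \<in> A" "\<beta> \<in> A" and eq: "\<And>i. 0 \<le> i \<Longrightarrow> i < n \<Longrightarrow> \<alpha> i = \<beta> i"
    show "\<alpha> = \<beta>"
    proof (rule PiE_ext)
      show "\<alpha> \<in> PiE {..<n} (\<lambda>_. {..r})" "\<beta> \<in> PiE {..<n} (\<lambda>_. {..r})" using ab A(1) by (auto simp: B_def)
    qed (use eq in auto)
  qed simp
  thus False using A(4) prime[of 0] by (simp add: prime_subset_def)
qed

lemma krull_dim_invariant_ring:
  assumes k: "0 < k" "k < n"
    and neg: "\<And>i. i \<in> {1..k} \<Longrightarrow> a i < 0" and pos: "\<And>i. i \<in> {k+1..n} \<Longrightarrow> a i > 0"
  shows "krull_dim (invariant_ring n a) = enat (n - 1)"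
proof (rule antisym)
  show "krull_dim (invariant_ring n a) \<le> enat (n - 1)"
    unfolding krull_dim_def
  proof (rule Sup_least)
    fix d assume "d \<in> {enat l |l P. (\<forall>i\<le>l. primeideal (P i) (invariant_ring n a)) \<and> (\<forall>i<l. P i \<subset> P (Suc i))}"
    then obtain l P where d: "d = enat l" and "\<forall>i\<le>l. prime_subset n a (P i)" "\<forall>i<l. P i \<subset> P (Suc i)"
      by (auto simp: primeideal_invariant_ring_iff)
    moreover have "a n \<noteq> 0" using pos[of n] k by simp
    ultimately have "l \<le> n - 1" using prime_chain_length_le[of n a l P] k by auto
    thus "d \<le> enat (n - 1)" by (simp add: d)
  qed
  show "enat (n - 1) \<le> krull_dim (invariant_ring n a)"
    unfolding krull_dim_def
    by (rule Sup_upper) (use ex_prime_chain[of k n a] k neg pos in blast)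
qed

section \<open>The Laurent coefficient\<close>

text \<open>The limit makes the singularity of \<open>s^r * P / Q\<close> removable. All
  coefficients come from the Taylor series of the extended function, shifted by r, and its constant
  term is the limit.\<close>

lemma hilbert_laurent_coeffs_of_pole_limit:
  assumes dim: "krull_dim (invariant_ring n a) = enat r"
    and lim: "pole_limit (hilbert_series n a) r g"
  obtains G where "hilbert_laurent_coeffs n a G" "G 0 = g"
proof -
  obtain P Q where PQ: "Q \<noteq> 0" "fps_of_poly P = hilbert_series n a * fps_of_poly Q"
    "((\<lambda>s. s ^ r * (poly P (1 - s) / poly Q (1 - s))) \<longlongrightarrow> g) (at 0)"
    using lim unfolding pole_limit_def by blast
  define h where "h = (\<lambda>s. if s = 0 then g else s ^ r * (poly P (1 - s) / poly Q (1 - s)))"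
  have lim_h: "(h \<longlongrightarrow> h 0) (at 0)"
  proof -
    have "eventually (\<lambda>s. s ^ r * (poly P (1 - s) / poly Q (1 - s)) = h s) (at 0)"
      by (simp add: h_def eventually_at_filter)
    with PQ(3) have "(h \<longlongrightarrow> g) (at 0)" by (rule Lim_transform_eventually)
    thus ?thesis by (simp add: h_def)
  qed
  have "eventually (\<lambda>s. poly Q (1 - s) \<noteq> 0) (at 0)"
    by (rule eventually_poly_1_minus_nonzero[OF PQ(1)])
  then obtain e where e: "e > 0" "\<And>s. s \<noteq> 0 \<Longrightarrow> dist s 0 < e \<Longrightarrow> poly Q (1 - s) \<noteq> 0"
    unfolding eventually_at by auto
  have "h holomorphic_on ball 0 e"
  proof (rule no_isolated_singularity)
    show "open (ball (0 :: complex) e)" "finite {0 :: complex}" by simp_all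
    have "(\<lambda>s. s ^ r * (poly P (1 - s) / poly Q (1 - s))) holomorphic_on ball 0 e - {0}"
      by (intro holomorphic_intros) (use e in \<open>auto simp: dist_commute\<close>)
    thus hol: "h holomorphic_on ball 0 e - {0}"
      by (rule holomorphic_transform) (auto simp: h_def)
    show "continuous_on (ball 0 e) h"
      unfolding continuous_on_eq_continuous_at[OF open_ball]
    proof
      fix s :: complex assume s: "s \<in> ball 0 e"
      show "isCont h s"
      proof (cases "s = 0")
        case True
        thus ?thesis using lim_h by (simp add: isCont_def)
      next
        case False
        have "open (ball 0 e - {0 :: complex})" by (intro open_Diff) auto
        thus ?thesis using holomorphic_on_imp_continuous_on[OF hol] False s
          by (simp add: continuous_on_eq_continuous_at)
      qed
    qed
  qed
  hence "h analytic_on {0}" using e(1) by (auto simp: analytic_at intro!: exI[of _ "ball 0 e"])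
  then obtain F where F: "h has_fps_expansion F" using analytic_at_imp_has_fps_expansion_0 by blast
  have F0: "fps_nth F 0 = g" using has_fps_expansion_imp_0_eq_fps_nth_0[OF F] by (simp add: h_def)
  have "h has_laurent_expansion fps_to_fls F" using F by (rule has_laurent_expansion_fps)
  hence "(\<lambda>s. h s * s powi (- int r)) has_laurent_expansion fls_shift (int r) (fps_to_fls F)"
    by (intro laurent_expansion_intros) 
  also have "?this \<longleftrightarrow> (\<lambda>s. poly P (1 - s) / poly Q (1 - s)) has_laurent_expansion
      fls_shift (int r) (fps_to_fls F)"
    by (rule has_laurent_expansion_cong)
      (auto simp: eventually_at_filter h_def power_int_minus field_simps)
  finally have "hilbert_laurent_coeffs n a (fps_nth F)"
    unfolding hilbert_laurent_coeffs_def dim using PQ(1,2)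
    by (intro exI[of _ P] exI[of _ Q]) (simp add: fps_nth_inverse)
  with F0 show ?thesis using that by blast
qed

lemma hilbert_gamma_eq:
  assumes "hilbert_laurent_coeffs n a G"
  shows "hilbert_gamma n a = G"
  unfolding hilbert_gamma_def
  by (rule the_equality) (use assms hilbert_laurent_coeffs_unique in blast)+

text \<open>These are the perturbed degrees: for \<open>i \<ge> 1\<close> they equal 1 at 0, the
  standard degree, and the positive exponents separate the coefficients \<open>c i\<close> from the
  constant terms.\<close>

lemma int_independent_one_plus_power: "int_independent {1..n} (\<lambda>i. 1 + monom 1 i)"
  unfolding int_independent_def
proof (intro allI impI ballI)
  fix c :: "nat \<Rightarrow> int" and i
  assume zero: "(\<Sum>i=1..n. Polynomial.smult (of_int (c i)) (1 + monom 1 i)) = (0 :: real poly)" and i: "i \<in> {1..n}"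
  have "0 = coeff (\<Sum>i=1..n. Polynomial.smult (of_int (c i)) (1 + monom (1 :: real) i)) i"
    by (simp only: zero coeff_0)
  also have "\<dots> = (\<Sum>j=1..n. if j = i then of_int (c i) else 0)"
    unfolding coeff_sum by (rule sum.cong) (use i in auto)
  finally show "c i = 0" using i by simp
qed

text \<open>Negative weights precede positive ones, so filtering by sign and concatenating
  reproduces the weight vector. Only the positions \<open>1..n\<close> of the list are read, since
  no other variable occurs in \<open>S_laurent\<close>.\<close>

lemma S_weights_eq:
  assumes k: "0 < k" "k < n"
    and neg: "\<And>i. i \<in> {1..k} \<Longrightarrow> a i < 0" and pos: "\<And>i. i \<in> {k+1..n} \<Longrightarrow> a i > 0"
  shows "S_weights (int u) n a = claurent_eval (S_laurent k (n - k) (int u)) (\<lambda>i. of_int (a i))"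
proof -
  have up: "[1..<n+1] = [1..<k+1] @ [k+1..<n+1]"
    using upt_add_eq_append[of 1 "k+1" "n-k"] k by simp
  have xs: "filter (\<lambda>c. c < 0) (map a [1..<n+1]) = map a [1..<k+1]"
  proof -
    have "filter (\<lambda>c. c < 0) (map a [1..<k+1]) = map a [1..<k+1]"
      by (rule filter_True) (use neg in auto)
    moreover have "filter (\<lambda>c. c < 0) (map a [k+1..<n+1]) = []"
      by (rule filter_False) (use pos in force)
    ultimately show ?thesis by (simp only: up map_append filter_append append_Nil2)
  qed
  have ys: "filter (\<lambda>c. c > 0) (map a [1..<n+1]) = map a [k+1..<n+1]"
  proof -
    have "filter (\<lambda>c. c > 0) (map a [1..<k+1]) = []"
      by (rule filter_False) (use neg in force)
    moreover have "filter (\<lambda>c. c > 0) (map a [k+1..<n+1]) = map a [k+1..<n+1]"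
      by (rule filter_True) (use pos in auto)
    ultimately show ?thesis by (simp only: up map_append filter_append append_Nil)
  qed
  have len: "length (map a [1..<k+1]) = k" "length (map a [k+1..<n+1]) = n - k"
    by (simp_all del: upt_Suc)
  have "S_weights (int u) n a = claurent_eval (S_laurent k (n - k) (int u))
      (\<lambda>i. of_int (map a [1..<n+1] ! (i - 1)))"
    by (simp only: S_weights_def Let_def xs ys len map_append[symmetric] up[symmetric])
  also have "\<dots> = claurent_eval (S_laurent k (n - k) (int u)) (\<lambda>i. of_int (a i))"
  proof (rule claurent_eval_cong)
    fix t i assume "t \<in> Poly_Mapping.keys (S_laurent k (n - k) (int u))" "i \<in> Poly_Mapping.keys t"
    hence "i \<in> {1..n}" using keys_S_laurent[OF k(1), of t "n - k" u] k by auto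
    hence "map a [1..<n+1] ! (i - 1) = a i" by (subst nth_map) (auto simp: nth_upt simp del: upt_Suc)
    thus "of_int (map a [1..<n+1] ! (i - 1)) = of_int (a i)" by simp
  qed
  finally show ?thesis .
qed

theorem theorem6p2:
  fixes n k :: nat and a :: "nat \<Rightarrow> int"
  assumes effective: "Gcd (a ` {1..n}) = 1"
    and k: "0 < k" "k < n"
    and neg: "\<And>i. i \<in> {1..k} \<Longrightarrow> a i < 0"
    and pos: "\<And>i. i \<in> {k+1..n} \<Longrightarrow> a i > 0"
  shows "krull_dim (invariant_ring n a) = enat (n - 1) \<and>
    hilbert_gamma n a 0 =
      - S_weights (int n - 2) n a / (\<Prod>p=1..k. \<Prod>q=k+1..n. of_int (a p - a q)) \<and>
    hilbert_gamma n a 0 \<noteq> 0 \<and>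
    ((\<forall>i\<in>{1..k}. \<forall>j\<in>{1..k}. i \<noteq> j \<longrightarrow> a i \<noteq> a j) \<longrightarrow>
      hilbert_gamma n a 0 =
        (\<Sum>i=1..k. - (of_int (a i) ^ (n - 2)) / (\<Prod>j\<in>{1..n} - {i}. of_int (a i - a j))))"
proof -
  have a0: "a i \<noteq> 0" if "i \<in> {1..n}" for i
    using neg[of i] pos[of i] that by (cases "i \<le> k") auto
  have dim: "krull_dim (invariant_ring n a) = enat (n - 1)"
    by (rule krull_dim_invariant_ring[OF k neg pos])
  define E where "E = (\<lambda>i :: nat. 1 + monom (1 :: real) i)"
  define Ex where "Ex = (\<lambda>x i. poly (E i) x)"
  have ind: "int_independent {1..n} E" unfolding E_def by (rule int_independent_one_plus_power)
  have "{i \<in> {1..n}. a i \<noteq> 0} = {1..n}" using a0 by auto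
  hence "\<exists>g\<ge>0. pole_limit (solution_series {1..n} a (\<lambda>_. 1)) (card {1..n} - 1) (of_real g) \<and>
    ((\<lambda>x. leading_sum {1..n} a (\<lambda>i. poly (E i) x)) \<longlongrightarrow> g) (at 0) \<and>
    ((\<exists>i\<in>{1..n}. a i < 0) \<and> (\<exists>i\<in>{1..n}. a i > 0) \<longrightarrow> g > 0)"
    by (intro pole_limit_leading_sum ind effective) (use k in \<open>auto simp: E_def poly_monom\<close>)
  then obtain g where g: "pole_limit (hilbert_series n a) (n - 1) (of_real g)"
    "((\<lambda>x. leading_sum {1..n} a (Ex x)) \<longlongrightarrow> g) (at 0)"
    "(\<exists>i\<in>{1..n}. a i < 0) \<and> (\<exists>i\<in>{1..n}. a i > 0) \<longrightarrow> g > 0"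
    by (auto simp: hilbert_series_eq Ex_def)
  have "g > 0" using g(3) neg[of 1] pos[of n] k by force
  obtain G where "hilbert_laurent_coeffs n a G" "G 0 = of_real g"
    using hilbert_laurent_coeffs_of_pole_limit[OF dim g(1)] .
  hence gamma: "hilbert_gamma n a 0 = of_real g" using hilbert_gamma_eq by blast
  have Ex: "((\<lambda>x. Ex x i) \<longlongrightarrow> 1) (at 0)" if "i \<in> {1..n}" for i
  proof -
    have "((\<lambda>x. Ex x i) \<longlongrightarrow> poly (E i) 0) (at 0)" unfolding Ex_def by (intro tendsto_intros)
    thus ?thesis using that by (simp add: E_def poly_monom zero_power)
  qed
  have lim: "((\<lambda>x. complex_of_real (leading_sum {1..n} a (Ex x))) \<longlongrightarrow> hilbert_gamma n a 0) (at 0)"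
    unfolding gamma using g(2) by (rule tendsto_of_real)

  define f where "f = S_laurent k (n - k) (int (n - 2))"
  define X where "X = (\<lambda>x i. complex_of_real (of_int (a i) / Ex x i))"
  have X: "((\<lambda>x. X x i) \<longlongrightarrow> of_int (a i)) (at 0)" if "i \<in> {1..n}" for i
  proof -
    have "((\<lambda>x. X x i) \<longlongrightarrow> of_real (of_int (a i) / 1)) (at 0)"
      unfolding X_def by (intro tendsto_intros Ex that) simp
    thus ?thesis by simp
  qed
  have ev1: "eventually (\<lambda>x. \<forall>i\<in>{1..n}. Ex x i \<noteq> 0) (at 0)"
    by (intro eventually_ball_finite ballI tendsto_imp_eventually_ne[OF Ex]) auto
  have ev2: "eventually (\<lambda>x. generic_slopes {1..n} a (Ex x)) (at 0)"
    unfolding Ex_def by (rule eventually_generic_slopes[OF _ ind]) simp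
  \<comment> \<open>Equality with the leading sum is available only for generic parameters, but this
    expression converges also when weights coincide: f is a Laurent polynomial with nonzero limit
    arguments, and the differences below pair weights of opposite sign.\<close>
  have "((\<lambda>x. - claurent_eval f (X x) /
      ((\<Prod>i=1..n. of_real (Ex x i)) * (\<Prod>p=1..k. \<Prod>q=k+1..n. X x p - X x q))) \<longlongrightarrow>
      - claurent_eval f (\<lambda>i. of_int (a i)) /
      ((\<Prod>i=1..n. of_real 1) * (\<Prod>p=1..k. \<Prod>q=k+1..n. of_int (a p) - of_int (a q)))) (at 0)"
  proof (intro tendsto_divide tendsto_minus tendsto_mult tendsto_prod tendsto_diff tendsto_of_real)
    show "((\<lambda>x. claurent_eval f (X x)) \<longlongrightarrow> claurent_eval f (\<lambda>i. of_int (a i))) (at 0)"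
    proof (rule tendsto_claurent_eval, rule conjI)
      fix t i assume "t \<in> Poly_Mapping.keys f" "i \<in> Poly_Mapping.keys t"
      hence i: "i \<in> {1..n}" using keys_S_laurent[OF k(1), of t "n - k" "n - 2"] k by (auto simp: f_def)
      show "((\<lambda>x. X x i) \<longlongrightarrow> of_int (a i)) (at 0)" by (rule X[OF i])
      show "(of_int (a i) :: complex) \<noteq> 0" using a0[OF i] by simp
    qed
    have "a p \<noteq> a q" if "p \<in> {1..k}" "q \<in> {k+1..n}" for p q
      using neg[OF that(1)] pos[OF that(2)] by simp
    thus "(\<Prod>i=1..n. of_real 1) * (\<Prod>p=1..k. \<Prod>q=k+1..n. complex_of_int (a p) - of_int (a q)) \<noteq> 0"
      by (simp add: prod_zero_iff)
  qed (use k in \<open>auto intro!: X Ex\<close>)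
  moreover have "eventually (\<lambda>x. - claurent_eval f (X x) /
      ((\<Prod>i=1..n. of_real (Ex x i)) * (\<Prod>p=1..k. \<Prod>q=k+1..n. X x p - X x q)) =
      complex_of_real (leading_sum {1..n} a (Ex x))) (at 0)"
    using ev1 ev2
    by eventually_elim (subst leading_sum_eq_S_laurent[OF k neg pos]; simp add: X_def f_def)
  ultimately have "((\<lambda>x. complex_of_real (leading_sum {1..n} a (Ex x))) \<longlongrightarrow>
      - claurent_eval f (\<lambda>i. of_int (a i)) /
      ((\<Prod>i=1..n. of_real 1) * (\<Prod>p=1..k. \<Prod>q=k+1..n. of_int (a p) - of_int (a q)))) (at 0)"
    by (rule Lim_transform_eventually)
  hence "hilbert_gamma n a 0 = - claurent_eval f (\<lambda>i. of_int (a i)) /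
      ((\<Prod>i=1..n. of_real 1) * (\<Prod>p=1..k. \<Prod>q=k+1..n. of_int (a p) - of_int (a q)))"
    by (rule tendsto_unique[OF at_neq_bot lim])
  moreover have "S_weights (int n - 2) n a = claurent_eval f (\<lambda>i. of_int (a i))"
    using S_weights_eq[OF k neg pos, where u = "n - 2"] k by (simp add: f_def of_nat_diff)
  ultimately have S: "hilbert_gamma n a 0 =
      - S_weights (int n - 2) n a / (\<Prod>p=1..k. \<Prod>q=k+1..n. of_int (a p - a q))"
    by simp

  have distinct: "hilbert_gamma n a 0 =
      (\<Sum>i=1..k. - (of_int (a i) ^ (n - 2)) / (\<Prod>j\<in>{1..n} - {i}. of_int (a i - a j)))"
    if dist: "\<forall>i\<in>{1..k}. \<forall>j\<in>{1..k}. i \<noteq> j \<longrightarrow> a i \<noteq> a j"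
  proof -
    have negs: "{i \<in> {1..n}. a i < 0} = {1..k}"
    proof (intro subset_antisym subsetI)
      fix i assume i: "i \<in> {i \<in> {1..n}. a i < 0}"
      show "i \<in> {1..k}" using i pos[of i] by (cases "i \<le> k") auto
    qed (use neg k in auto)
    \<comment> \<open>Now the limit is taken termwise. Every difference in a denominator contains a
      negative \<open>a i\<close>, so in the limit it could vanish only through two equal negative
      weights; equal positive weights do no harm.\<close>
    have "((\<lambda>x. complex_of_real (leading_sum {1..n} a (Ex x))) \<longlongrightarrow>
        of_real (\<Sum>i=1..k. - (of_int (a i) ^ (n - 2)) / (\<Prod>j\<in>{1..n} - {i}. of_int (a i) * 1 - of_int (a j) * 1))) (at 0)"
      unfolding leading_sum_def negs card_atLeastAtMost diff_Suc_1
    proof (intro tendsto_of_real tendsto_sum tendsto_divide tendsto_const tendsto_prod tendsto_diff tendsto_mult)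
      fix i assume i: "i \<in> {1..k}"
      have "a i \<noteq> a j" if "j \<in> {1..n} - {i}" for j
        using dist neg[OF i] pos[of j] i that by (cases "j \<le> k") force+
      thus "(\<Prod>j\<in>{1..n} - {i}. real_of_int (a i) * 1 - of_int (a j) * 1) \<noteq> 0"
        by (simp add: prod_zero_iff)
    qed (use k in \<open>auto intro!: Ex\<close>)
    hence "hilbert_gamma n a 0 = of_real (\<Sum>i=1..k. - (of_int (a i) ^ (n - 2)) /
        (\<Prod>j\<in>{1..n} - {i}. of_int (a i) * 1 - of_int (a j) * 1))"
      by (rule tendsto_unique[OF at_neq_bot lim])
    thus ?thesis by simp
  qed
  have "hilbert_gamma n a 0 \<noteq> 0" using \<open>g > 0\<close> by (simp add: gamma)
  with dim S distinct show ?thesis by blast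
qed

end
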